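(* Let $d,n\ge 2$, let $\mathcal D$ be a domain in $Q_0(d,n)$ whose closure $\overline{\mathcal D}$ is a compact subset of $Q_0(d,n)$, and let $\mathfrak P$ be a reduction of $\mathcal V(d,n)$ to a principal $K$-bundle over $\overline{\mathcal D}$. If $\mathfrak u\in\partial_e\mathcal D$, then $ev_{\mathfrak u}$ is a boundary representation of $\Gamma_c(\partial\mathcal D,\mathfrak M^*(\mathfrak P;d,n))$ for $\mathbb S(\mathcal D,\mathfrak P;d,n)$.
   Context: Setting. $G=PGL(n,\mathbb C)$, $K=PU(n,\mathbb C)$, acting on $M_n(\mathbb C)$ by $s\cdot A=sAs^{-1}$ and on $M_n(\mathbb C)^d$ on the right by $\mathfrak z\cdot s=s^{-1}\mathfrak z s=(s^{-1}Z_1s,\dots,s^{-1}Z_ds)$. $\mathcal V(d,n)$ is the set of $\mathfrak z=(Z_1,\dots,Z_d)\in M_n(\mathbb C)^d$ such that $Z_1,\dots,Z_d$ generate the algebra $M_n(\mathbb C)$. $\mathbb I_0(d,n)$ is the algebra of $G$-invariant polynomial functions $M_n(\mathbb C)^d\to\mathbb C$; $p\in\mathbb I_0(d,n)$ is also identified with the matrix-valued function $\mathfrak z\mapsto p(\mathfrak z)I_n$. $\mathbb G_0(d,n)$ is the algebra of functions $M_n(\mathbb C)^d\to M_n(\mathbb C)$ generated by the coordinate functions $\mathcal Z_i(\mathfrak z)=Z_i$, and $\mathbb S_0(d,n)$ (the trace algebra) is the algebra generated by $\mathbb G_0(d,n)$ and $\mathbb I_0(d,n)$; its elements $\phi$ satisfy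 $\phi(s^{-1}\mathfrak z s)=s^{-1}\phi(\mathfrak z)s$. $Q(d,n)$ is the spectrum of the finitely generated algebra $\mathbb I_0(d,n)$, with its analytic topology, $\pi_0:M_n(\mathbb C)^d\to Q(d,n)$ is the surjection dual to the inclusion of $\mathbb I_0(d,n)$ in the polynomial functions, and $Q_0(d,n)=\pi_0(\mathcal V(d,n))$. By a theorem of Procesi (may be assumed), $Q_0(d,n)$ is an open subset of the smooth points of $Q(d,n)$ and $\pi_0:\mathcal V(d,n)\to Q_0(d,n)$ is a holomorphic principal $G$-bundle; write $[\mathfrak z]=\pi_0(\mathfrak z)$. Elements of $\mathbb I_0(d,n)$ are regarded as regular functions on $Q(d,n)$. Function algebra. $\mathbb I(\mathcal D;d,n)$ is the sup-norm closure of (the restrictions to $\overline{\mathcal D}$ of) $\mathbb I_0(d,n)$ in $C(\overline{\mathcal D})$; it is a function algebra on $\overline{\mathcal D}$. $\partial\mathcal D\subseteq\overline{\mathcal D}$ is its Shilov boundary, and $\partial_e\mathcal D\subseteq\partial\mathcal D$ is its Choquet (extreme) boundary, i.e. the set of points of $\overline{\mathcal D}$ that have a unique representing measure for $\mathbb I(\mathcal D;d,n)$ supported in $\overline{\mathcal D}$. Reductions and bundles. A reduction $\mathfrak P$ of $\mathcal V(d,n)$ to a principal $K$-bundle over $\overline{\mathcal D}$ is the principal $K$-bundle given by a compact $K$-invariant subset $\mathcal P\subseteq\mathcal V(d,n)$ which $\pi_0$ maps onto $\overline{\mathcal D}$ and for which $\pi_0$ identifies $\mathcal P/K$ with $\overline{\mathcal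 D}$. $\mathfrak M^*(\mathfrak P;d,n)$ is the associated $M_n(\mathbb C)$-bundle, with total space $\mathcal P\times_K M_n(\mathbb C)$ (quotient of $\mathcal P\times M_n(\mathbb C)$ by $(\mathfrak z,A)\cdot k=(k^{-1}\mathfrak z k,k^{-1}Ak)$) and projection $\pi([\mathfrak z,A])=[\mathfrak z]$; each fibre $\pi^{-1}(\mathfrak u)$ is a $C^*$-algebra isomorphic to $M_n(\mathbb C)$ via $A\mapsto[\mathfrak z,A]$ for any $\mathfrak z\in\mathcal P$ with $\pi_0(\mathfrak z)=\mathfrak u$. $\Gamma_c(\partial\mathcal D,\mathfrak M^*(\mathfrak P;d,n))$ is the $C^*$-algebra of continuous cross sections over $\partial\mathcal D$, with fibrewise operations and the supremum norm. For $\phi\in\mathbb S_0(d,n)$, $\Psi(\phi)$ is the section $\Psi(\phi)([\mathfrak z])=[\mathfrak z,\phi(\mathfrak z)]$, $\mathfrak z\in\mathcal P$. $\mathbb S(\mathcal D,\mathfrak P;d,n)$ (the tracial function algebra) is the norm closure of $\Psi(\mathbb S_0(d,n))$ in $\Gamma_c(\partial\mathcal D,\mathfrak M^*(\mathfrak P;d,n))$. For $\mathfrak u\in\partial\mathcal D$, $ev_{\mathfrak u}$ is the $*$-homomorphism $\sigma\mapsto\sigma(\mathfrak u)$ from $\Gamma_c(\partial\mathcal D,\mathfrak M^*(\mathfrak P;d,n))$ onto $\pi^{-1}(\mathfrak u)\cong M_n(\mathbb C)$, regarded through such an isomorphism as an irreducible representation on $\mathbb C^n$. Boundary representation: if $B$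 is a unital $C^*$-algebra and $A$ a norm-closed subalgebra containing the unit of $B$ and generating $B$ as a $C^*$-algebra, an irreducible representation $\rho:B\to B(H_\rho)$ is a boundary representation for $A$ if $\rho$ is the only unital completely positive map $\omega:B\to B(H_\rho)$ with $\omega|_A=\rho|_A$. *)

theory Defs
  imports "HOL-Analysis.Analysis" "HOL-Algebra.Ring"
begin

section \<open>Matrices and tuples of matrices\<close>

text \<open>
  \<open>M\<^sub>n(\<complex>)\<close> is \<open>complex^'n^'n\<close> and \<open>M\<^sub>n(\<complex>)\<^sup>d\<close> is \<open>complex^'n^'n^'d\<close>.  Matrix multiplication is \<open>**\<close>
  (\<open>*\<close> would be entrywise), and \<open>mat c ** A\<close> is the scalar multiple \<open>c A\<close>.
\<close>

type_synonym ('d, 'n) quot_point = "(complex^'n^'n^'d \<Rightarrow> complex) \<Rightarrow> complex"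
type_synonym ('d, 'n) bundle_point = "((complex^'n^'n^'d) \<times> (complex^'n^'n)) set"

definition mat_star :: "complex^'n^'n \<Rightarrow> complex^'n^'n" where
  "mat_star A = (\<chi> i j. cnj (A $ j $ i))"

definition unitary_mat :: "complex^'n^'n \<Rightarrow> bool" where
  "unitary_mat k \<longleftrightarrow> mat_star k ** k = mat 1 \<and> k ** mat_star k = mat 1"

definition mat_conj :: "complex^'n^'n \<Rightarrow> complex^'n^'n \<Rightarrow> complex^'n^'n" where
  "mat_conj A s = matrix_inv s ** A ** s"

text \<open>
  Conjugation by \<open>s\<close> only depends on the class of \<open>s\<close> modulo scalars.  The actions of \<open>PGL(n,\<complex>)\<close> and
  \<open>PU(n,\<complex>)\<close> are therefore given through invertible and unitary representatives.
\<close>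

definition tuple_conj :: "complex^'n^'n^'d \<Rightarrow> complex^'n^'n \<Rightarrow> complex^'n^'n^'d" where
  "tuple_conj z s = (\<chi> i. mat_conj (z $ i) s)"

inductive_set mat_subalgebra :: "(complex^'n^'n) set \<Rightarrow> (complex^'n^'n) set"
  for S :: "(complex^'n^'n) set" where
  gen: "A \<in> S \<Longrightarrow> A \<in> mat_subalgebra S"
| one: "mat 1 \<in> mat_subalgebra S"
| add: "A \<in> mat_subalgebra S \<Longrightarrow> B \<in> mat_subalgebra S \<Longrightarrow> A + B \<in> mat_subalgebra S"
| mult: "A \<in> mat_subalgebra S \<Longrightarrow> B \<in> mat_subalgebra S \<Longrightarrow> A ** B \<in> mat_subalgebra S"
| scale: "A \<in> mat_subalgebra S \<Longrightarrow> mat c ** A \<in> mat_subalgebra S"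

definition gen_tuples :: "(complex^'n^'n^'d) set" where
  "gen_tuples = {z. mat_subalgebra (range (\<lambda>i. z $ i)) = UNIV}"


section \<open>Invariants, generic matrices and the trace algebra\<close>

inductive_set poly_functions :: "(complex^'n^'n^'d \<Rightarrow> complex) set" where
  const: "(\<lambda>_. c) \<in> poly_functions"
| coord: "(\<lambda>z. z $ i $ j $ k) \<in> poly_functions"
| add: "p \<in> poly_functions \<Longrightarrow> q \<in> poly_functions \<Longrightarrow> (\<lambda>z. p z + q z) \<in> poly_functions"
| mult: "p \<in> poly_functions \<Longrightarrow> q \<in> poly_functions \<Longrightarrow> (\<lambda>z. p z * q z) \<in> poly_functions"

definition invariants :: "(complex^'n^'n^'d \<Rightarrow> complex) set" where
  "invariants = {p \<in> poly_functions. \<forall>z s. invertible s \<longrightarrow> p (tuple_conj z s) = p z}"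

inductive_set fun_subalgebra ::
  "(complex^'n^'n^'d \<Rightarrow> complex^'n^'n) set \<Rightarrow> (complex^'n^'n^'d \<Rightarrow> complex^'n^'n) set"
  for S :: "(complex^'n^'n^'d \<Rightarrow> complex^'n^'n) set" where
  gen: "f \<in> S \<Longrightarrow> f \<in> fun_subalgebra S"
| one: "(\<lambda>_. mat 1) \<in> fun_subalgebra S"
| add: "f \<in> fun_subalgebra S \<Longrightarrow> g \<in> fun_subalgebra S \<Longrightarrow> (\<lambda>z. f z + g z) \<in> fun_subalgebra S"
| mult: "f \<in> fun_subalgebra S \<Longrightarrow> g \<in> fun_subalgebra S \<Longrightarrow> (\<lambda>z. f z ** g z) \<in> fun_subalgebra S"
| scale: "f \<in> fun_subalgebra S \<Longrightarrow> (\<lambda>z. mat c ** f z) \<in> fun_subalgebra S"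

definition generic_matrices :: "(complex^'n^'n^'d \<Rightarrow> complex^'n^'n) set" where
  "generic_matrices = fun_subalgebra (range (\<lambda>i z. z $ i))"

definition trace_algebra :: "(complex^'n^'n^'d \<Rightarrow> complex^'n^'n) set" where
  "trace_algebra = fun_subalgebra (generic_matrices \<union> (\<lambda>p z. mat (p z)) ` invariants)"


section \<open>The quotient variety\<close>

text \<open>
  A point of the spectrum of the algebra of invariants is a unital algebra homomorphism into \<open>\<complex>\<close>,
  with value \<open>undefined\<close> off the invariants; an invariant \<open>p\<close>, as a regular function on the spectrum,
  is \<open>x \<mapsto> x p\<close>.  The topology inherited from the product topology on the function type is the
  coarsest one making all regular functions continuous.  Since the algebra is finitely generated,
  this is the analytic topology.
\<close>

definition quot_variety :: "('d::finite, 'n::finite) quot_point set" where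
  "quot_variety = {x \<in> extensional invariants.
     (\<forall>c. x (\<lambda>_. c) = c) \<and>
     (\<forall>p\<in>invariants. \<forall>q\<in>invariants. x (\<lambda>z. p z + q z) = x p + x q) \<and>
     (\<forall>p\<in>invariants. \<forall>q\<in>invariants. x (\<lambda>z. p z * q z) = x p * x q)}"

definition quot_map :: "complex^'n^'n^'d \<Rightarrow> ('d::finite, 'n::finite) quot_point" where
  "quot_map z = restrict (\<lambda>p. p z) invariants"

definition gen_quot :: "('d::finite, 'n::finite) quot_point set" where
  "gen_quot = quot_map ` gen_tuples"


section \<open>Function algebras and their boundaries\<close>

text \<open>
  The Shilov boundary is the smallest closed boundary, hence the intersection of all of them; the
  supremum norm of \<open>f\<close> over \<open>X\<close> is attained on each closed boundary, as \<open>X\<close> is compact below.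
\<close>

definition shilov_boundary :: "'a::topological_space set \<Rightarrow> ('a \<Rightarrow> complex) set \<Rightarrow> 'a set" where
  "shilov_boundary X F = X \<inter> \<Inter>{E. closedin (top_of_set X) E \<and>
     (\<forall>f\<in>F. \<exists>y\<in>E. \<forall>x\<in>X. cmod (f x) \<le> cmod (f y))}"

definition representing_measure ::
  "'a::topological_space set \<Rightarrow> ('a \<Rightarrow> complex) set \<Rightarrow> 'a \<Rightarrow> 'a measure \<Rightarrow> bool" where
  "representing_measure X F x \<mu> \<longleftrightarrow>
     space \<mu> = X \<and> sets \<mu> = sets (restrict_space borel X) \<and> emeasure \<mu> X = 1 \<and>
     (\<forall>f\<in>F. integrable \<mu> f \<and> integral\<^sup>L \<mu> f = f x)"

definition choquet_boundary :: "'a::topological_space set \<Rightarrow> ('a \<Rightarrow> complex) set \<Rightarrow> 'a set" where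
  "choquet_boundary X F = {x \<in> X. \<exists>!\<mu>. representing_measure X F x \<mu>}"

definition invariant_function_algebra ::
  "('d::finite, 'n::finite) quot_point set \<Rightarrow> (('d, 'n) quot_point \<Rightarrow> complex) set" where
  "invariant_function_algebra X = {f \<in> extensional X. continuous_on X f \<and>
     (\<forall>e>0. \<exists>p\<in>invariants. \<forall>x\<in>X. cmod (f x - x p) < e)}"


section \<open>\<open>C\<^sup>*\<close>-algebras and boundary representations\<close>

record 'b star_alg = "'b ring" +
  scale :: "complex \<Rightarrow> 'b \<Rightarrow> 'b"
  star :: "'b \<Rightarrow> 'b"
  cnorm :: "'b \<Rightarrow> real"

locale unital_cstar_algebra = ring B for B :: "('b, 'm) star_alg_scheme" (structure) +
  assumes scale_closed: "x \<in> carrier B \<Longrightarrow> scale B c x \<in> carrier B"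
    and scale_add_right: "x \<in> carrier B \<Longrightarrow> y \<in> carrier B \<Longrightarrow>
      scale B c (x \<oplus> y) = scale B c x \<oplus> scale B c y"
    and scale_add_left: "x \<in> carrier B \<Longrightarrow> scale B (c + c') x = scale B c x \<oplus> scale B c' x"
    and scale_scale: "x \<in> carrier B \<Longrightarrow> scale B c (scale B c' x) = scale B (c * c') x"
    and scale_one: "x \<in> carrier B \<Longrightarrow> scale B 1 x = x"
    and scale_mult_left: "x \<in> carrier B \<Longrightarrow> y \<in> carrier B \<Longrightarrow>
      scale B c x \<otimes> y = scale B c (x \<otimes> y)"
    and scale_mult_right: "x \<in> carrier B \<Longrightarrow> y \<in> carrier B \<Longrightarrow>
      x \<otimes> scale B c y = scale B c (x \<otimes> y)"
    and star_closed: "x \<in> carrier B \<Longrightarrow> star B x \<in> carrier B"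
    and star_star: "x \<in> carrier B \<Longrightarrow> star B (star B x) = x"
    and star_add: "x \<in> carrier B \<Longrightarrow> y \<in> carrier B \<Longrightarrow> star B (x \<oplus> y) = star B x \<oplus> star B y"
    and star_scale: "x \<in> carrier B \<Longrightarrow> star B (scale B c x) = scale B (cnj c) (star B x)"
    and star_mult: "x \<in> carrier B \<Longrightarrow> y \<in> carrier B \<Longrightarrow> star B (x \<otimes> y) = star B y \<otimes> star B x"
    and cnorm_nonneg: "x \<in> carrier B \<Longrightarrow> 0 \<le> cnorm B x"
    and cnorm_eq_0: "x \<in> carrier B \<Longrightarrow> cnorm B x = 0 \<longleftrightarrow> x = \<zero>"
    and cnorm_add: "x \<in> carrier B \<Longrightarrow> y \<in> carrier B \<Longrightarrow> cnorm B (x \<oplus> y) \<le> cnorm B x + cnorm B y"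
    and cnorm_scale: "x \<in> carrier B \<Longrightarrow> cnorm B (scale B c x) = cmod c * cnorm B x"
    and cnorm_mult: "x \<in> carrier B \<Longrightarrow> y \<in> carrier B \<Longrightarrow> cnorm B (x \<otimes> y) \<le> cnorm B x * cnorm B y"
    and cnorm_star_mult: "x \<in> carrier B \<Longrightarrow> cnorm B (star B x \<otimes> x) = (cnorm B x)\<^sup>2"
    and complete: "(\<And>i. X i \<in> carrier B) \<Longrightarrow>
      (\<forall>e>0. \<exists>N. \<forall>i\<ge>N. \<forall>j\<ge>N. cnorm B (X i \<ominus> X j) < e) \<Longrightarrow>
      \<exists>x\<in>carrier B. (\<lambda>i::nat. cnorm B (X i \<ominus> x)) \<longlonglongrightarrow> 0"

definition norm_closure :: "('b, 'm) star_alg_scheme \<Rightarrow> 'b set \<Rightarrow> 'b set" where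
  "norm_closure B A = {x \<in> carrier B. \<forall>e>0. \<exists>a\<in>A. cnorm B (x \<ominus>\<^bsub>B\<^esub> a) < e}"

definition closed_unital_subalgebra :: "('b, 'm) star_alg_scheme \<Rightarrow> 'b set \<Rightarrow> bool" where
  "closed_unital_subalgebra B A \<longleftrightarrow> A \<subseteq> carrier B \<and> \<one>\<^bsub>B\<^esub> \<in> A \<and>
     (\<forall>x\<in>A. \<forall>y\<in>A. x \<oplus>\<^bsub>B\<^esub> y \<in> A) \<and> (\<forall>x\<in>A. \<forall>y\<in>A. x \<otimes>\<^bsub>B\<^esub> y \<in> A) \<and>
     (\<forall>c. \<forall>x\<in>A. scale B c x \<in> A) \<and> norm_closure B A \<subseteq> A"

definition generates_cstar :: "('b, 'm) star_alg_scheme \<Rightarrow> 'b set \<Rightarrow> bool" where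
  "generates_cstar B A \<longleftrightarrow>
     (\<forall>C. A \<subseteq> C \<and> closed_unital_subalgebra B C \<and> (\<forall>x\<in>C. star B x \<in> C) \<longrightarrow> C = carrier B)"

text \<open>
  All representations below act on the finite-dimensional Hilbert space \<open>\<complex>\<^sup>n\<close>, and \<open>B(\<complex>\<^sup>n)\<close> is
  \<open>complex^'n^'n\<close>.
\<close>

definition linear_into_mat :: "('b, 'm) star_alg_scheme \<Rightarrow> ('b \<Rightarrow> complex^'n^'n) \<Rightarrow> bool" where
  "linear_into_mat B \<omega> \<longleftrightarrow>
     (\<forall>x\<in>carrier B. \<forall>y\<in>carrier B. \<omega> (x \<oplus>\<^bsub>B\<^esub> y) = \<omega> x + \<omega> y) \<and>
     (\<forall>c. \<forall>x\<in>carrier B. \<omega> (scale B c x) = mat c ** \<omega> x)"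

definition star_representation :: "('b, 'm) star_alg_scheme \<Rightarrow> ('b \<Rightarrow> complex^'n^'n) \<Rightarrow> bool" where
  "star_representation B \<rho> \<longleftrightarrow> linear_into_mat B \<rho> \<and> \<rho> \<one>\<^bsub>B\<^esub> = mat 1 \<and>
     (\<forall>x\<in>carrier B. \<forall>y\<in>carrier B. \<rho> (x \<otimes>\<^bsub>B\<^esub> y) = \<rho> x ** \<rho> y) \<and>
     (\<forall>x\<in>carrier B. \<rho> (star B x) = mat_star (\<rho> x))"

definition irreducible_representation ::
  "('b, 'm) star_alg_scheme \<Rightarrow> ('b \<Rightarrow> complex^'n^'n) \<Rightarrow> bool" where
  "irreducible_representation B \<rho> \<longleftrightarrow> star_representation B \<rho> \<and>
     (\<forall>W. vec.subspace W \<and> (\<forall>x\<in>carrier B. \<forall>v\<in>W. \<rho> x *v v \<in> W) \<longrightarrow> W = {0} \<or> W = UNIV)"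

text \<open>
  Positive elements of the matrix algebra \<open>M\<^sub>m(B)\<close> are those of the form \<open>b\<^sup>* b\<close>; positivity in
  \<open>M\<^sub>m(B(\<complex>\<^sup>n)) = B((\<complex>\<^sup>n)\<^sup>m)\<close> is positivity of the quadratic form.
\<close>

definition positive_matrix :: "('b, 'm) star_alg_scheme \<Rightarrow> nat \<Rightarrow> (nat \<Rightarrow> nat \<Rightarrow> 'b) \<Rightarrow> bool" where
  "positive_matrix B m a \<longleftrightarrow>
     (\<exists>b. (\<forall>k<m. \<forall>i<m. b k i \<in> carrier B) \<and>
       (\<forall>i<m. \<forall>j<m. a i j = (\<Oplus>\<^bsub>B\<^esub>k\<in>{..<m}. star B (b k i) \<otimes>\<^bsub>B\<^esub> b k j)))"

definition cinner :: "complex^'n \<Rightarrow> complex^'n \<Rightarrow> complex" where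
  "cinner v w = (\<Sum>i\<in>UNIV. v $ i * cnj (w $ i))"

definition unital_completely_positive ::
  "('b, 'm) star_alg_scheme \<Rightarrow> ('b \<Rightarrow> complex^'n^'n) \<Rightarrow> bool" where
  "unital_completely_positive B \<omega> \<longleftrightarrow> linear_into_mat B \<omega> \<and> \<omega> \<one>\<^bsub>B\<^esub> = mat 1 \<and>
     (\<forall>m a v. positive_matrix B m a \<longrightarrow>
        (\<Sum>i<m. \<Sum>j<m. cinner (\<omega> (a i j) *v v j) (v i)) \<in> \<real>\<^sub>\<ge>\<^sub>0)"

definition boundary_representation ::
  "('b, 'm) star_alg_scheme \<Rightarrow> 'b set \<Rightarrow> ('b \<Rightarrow> complex^'n^'n) \<Rightarrow> bool" where
  "boundary_representation B A \<rho> \<longleftrightarrow>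
     unital_cstar_algebra B \<and> closed_unital_subalgebra B A \<and> generates_cstar B A \<and>
     irreducible_representation B \<rho> \<and>
     (\<forall>\<omega>. unital_completely_positive B \<omega> \<and> (\<forall>a\<in>A. \<omega> a = \<rho> a) \<longrightarrow>
        (\<forall>b\<in>carrier B. \<omega> b = \<rho> b))"


section \<open>Reductions and the associated matrix bundle\<close>

text \<open>
  \<open>\<pi>\<^sub>0\<close> identifies \<open>P/K\<close> with \<open>X\<close>: it restricts to a quotient map from \<open>P\<close> onto \<open>X\<close> whose fibres are
  the \<open>K\<close>-orbits.
\<close>

definition bundle_reduction ::
  "('d::finite, 'n::finite) quot_point set \<Rightarrow> (complex^'n^'n^'d) set \<Rightarrow> bool" where
  "bundle_reduction X P \<longleftrightarrow> P \<subseteq> gen_tuples \<and> compact P \<and>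
     (\<forall>z\<in>P. \<forall>k. unitary_mat k \<longrightarrow> tuple_conj z k \<in> P) \<and>
     quot_map ` P = X \<and> quotient_map (top_of_set P) (top_of_set X) quot_map \<and>
     (\<forall>z\<in>P. \<forall>w\<in>P. quot_map z = quot_map w \<longrightarrow> (\<exists>k. unitary_mat k \<and> w = tuple_conj z k))"

definition bundle_pt ::
  "complex^'n^'n^'d \<Rightarrow> complex^'n^'n \<Rightarrow> ('d::finite, 'n::finite) bundle_point" where
  "bundle_pt z A = {(tuple_conj z k, mat_conj A k) |k. unitary_mat k}"

definition bundle_space ::
  "(complex^'n^'n^'d) set \<Rightarrow> ('d::finite, 'n::finite) bundle_point set" where
  "bundle_space P = {bundle_pt z A |z A. z \<in> P}"

definition bundle_topology ::
  "(complex^'n^'n^'d) set \<Rightarrow> ('d::finite, 'n::finite) bundle_point topology" where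
  "bundle_topology P = topology (\<lambda>U. U \<subseteq> bundle_space P \<and>
     openin (top_of_set (P \<times> UNIV)) {(z, A) \<in> P \<times> UNIV. bundle_pt z A \<in> U})"

lemma openin_bundle_topology:
  "openin (bundle_topology P) U \<longleftrightarrow> U \<subseteq> bundle_space P \<and>
     openin (top_of_set (P \<times> UNIV)) {(z, A) \<in> P \<times> UNIV. bundle_pt z A \<in> U}"
proof -
  let ?Q = "\<lambda>U. {(z, A) \<in> P \<times> UNIV. bundle_pt z A \<in> U}"
  have "?Q (U \<inter> V) = ?Q U \<inter> ?Q V" for U V by auto
  moreover have "?Q (\<Union>\<K>) = (\<Union>U\<in>\<K>. ?Q U)" for \<K> by auto
  ultimately have "istopology (\<lambda>U. U \<subseteq> bundle_space P \<and> openin (top_of_set (P \<times> UNIV)) (?Q U))"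
    unfolding istopology_def by (auto intro!: openin_Int openin_Union)
  then show ?thesis
    unfolding bundle_topology_def by (simp add: topology_inverse')
qed

definition bundle_proj :: "('d::finite, 'n::finite) bundle_point \<Rightarrow> ('d, 'n) quot_point" where
  "bundle_proj x = (THE u. \<exists>z A. x = bundle_pt z A \<and> u = quot_map z)"

text \<open>
  A tuple in \<^const>\<open>gen_tuples\<close> has only scalar stabilisers, so the class \<open>[z,A]\<close>, a set of pairs, is
  the graph of a function on the \<open>K\<close>-orbit of \<open>z\<close>.  Fibrewise operations are operations on the
  matrix components over equal first components: \<open>[z,A] + [z,B] = [z,A+B]\<close>, and so on.
\<close>

definition fibre_op1 ::
  "(complex^'n^'n \<Rightarrow> complex^'n^'n) \<Rightarrow> ('d::finite, 'n::finite) bundle_point \<Rightarrow>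
   ('d, 'n) bundle_point" where
  "fibre_op1 h x = {(z, h A) |z A. (z, A) \<in> x}"

definition fibre_op2 ::
  "(complex^'n^'n \<Rightarrow> complex^'n^'n \<Rightarrow> complex^'n^'n) \<Rightarrow> ('d::finite, 'n::finite) bundle_point \<Rightarrow>
   ('d, 'n) bundle_point \<Rightarrow> ('d, 'n) bundle_point" where
  "fibre_op2 h x y = {(z, h A B) |z A B. (z, A) \<in> x \<and> (z, B) \<in> y}"

definition fibre_norm :: "('d::finite, 'n::finite) bundle_point \<Rightarrow> real" where
  "fibre_norm x = (THE r. \<exists>z A. x = bundle_pt z A \<and> r = onorm (\<lambda>v. A *v v))"

text \<open>The section \<open>[z] \<mapsto> [z, \<phi> z]\<close>, \<open>z \<in> P\<close>, over \<open>E\<close>.\<close>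

definition induced_section ::
  "(complex^'n^'n^'d) set \<Rightarrow> ('d::finite, 'n::finite) quot_point set \<Rightarrow>
   (complex^'n^'n^'d \<Rightarrow> complex^'n^'n) \<Rightarrow>
   ('d, 'n) quot_point \<Rightarrow> ('d, 'n) bundle_point" where
  "induced_section P E \<phi> =
     (\<lambda>u\<in>E. THE x. \<exists>z\<in>P. quot_map z = u \<and> x = bundle_pt z (\<phi> z))"

definition section_algebra ::
  "(complex^'n^'n^'d) set \<Rightarrow> ('d::finite, 'n::finite) quot_point set \<Rightarrow>
   (('d, 'n) quot_point \<Rightarrow> ('d, 'n) bundle_point) star_alg" where
  "section_algebra P E = \<lparr>
     carrier = {\<sigma> \<in> extensional E.
       continuous_map (top_of_set E) (bundle_topology P) \<sigma> \<and> (\<forall>u\<in>E. bundle_proj (\<sigma> u) = u)},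
     monoid.mult = (\<lambda>\<sigma> \<tau>. \<lambda>u\<in>E. fibre_op2 (**) (\<sigma> u) (\<tau> u)),
     one = induced_section P E (\<lambda>_. mat 1),
     zero = induced_section P E (\<lambda>_. 0),
     add = (\<lambda>\<sigma> \<tau>. \<lambda>u\<in>E. fibre_op2 (+) (\<sigma> u) (\<tau> u)),
     scale = (\<lambda>c \<sigma>. \<lambda>u\<in>E. fibre_op1 (\<lambda>A. mat c ** A) (\<sigma> u)),
     star = (\<lambda>\<sigma>. \<lambda>u\<in>E. fibre_op1 mat_star (\<sigma> u)),
     cnorm = (\<lambda>\<sigma>. SUP u\<in>E. fibre_norm (\<sigma> u)) \<rparr>"

definition tracial_function_algebra ::
  "(complex^'n^'n^'d) set \<Rightarrow> ('d::finite, 'n::finite) quot_point set \<Rightarrow>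
   (('d, 'n) quot_point \<Rightarrow> ('d, 'n) bundle_point) set" where
  "tracial_function_algebra P E =
     norm_closure (section_algebra P E) (induced_section P E ` trace_algebra)"

text \<open>
  Evaluation at \<open>u\<close>, with the fibre over \<open>u\<close> identified with \<open>M\<^sub>n(\<complex>)\<close> by \<open>A \<mapsto> [z,A]\<close> for a chosen \<open>z\<close>
  over \<open>u\<close>.
\<close>

definition eval_rep ::
  "complex^'n^'n^'d \<Rightarrow> ('d::finite, 'n::finite) quot_point \<Rightarrow>
   (('d, 'n) quot_point \<Rightarrow> ('d, 'n) bundle_point) \<Rightarrow> complex^'n^'n" where
  "eval_rep z u \<sigma> = (THE A. \<sigma> u = bundle_pt z A)"


section \<open>Domains\<close>

definition quot_domain :: "('d::finite, 'n::finite) quot_point set \<Rightarrow> bool" where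
  "quot_domain D \<longleftrightarrow> D \<noteq> {} \<and> connected D \<and> openin (top_of_set gen_quot) D"

definition domain_closure ::
  "('d::finite, 'n::finite) quot_point set \<Rightarrow> ('d, 'n) quot_point set" where
  "domain_closure D = top_of_set quot_variety closure_of D"

definition domain_shilov ::
  "('d::finite, 'n::finite) quot_point set \<Rightarrow> ('d, 'n) quot_point set" where
  "domain_shilov D =
     shilov_boundary (domain_closure D) (invariant_function_algebra (domain_closure D))"

definition domain_choquet ::
  "('d::finite, 'n::finite) quot_point set \<Rightarrow> ('d, 'n) quot_point set" where
  "domain_choquet D =
     choquet_boundary (domain_closure D) (invariant_function_algebra (domain_closure D))"

end

theory Submission
  imports Defs
begin

text \<open>
  Let \<open>X\<close> be the closure of the domain, \<open>E\<close> its Shilov boundary, \<open>B\<close> the algebra of sections over \<open>E\<close>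
  and \<open>A\<close> the tracial function algebra.  A section over \<open>E\<close> is the same as a \<open>K\<close>-equivariant continuous
  map \<open>F\<close> from the part of \<open>P\<close> over \<open>E\<close> to the matrices, with \<open>u \<mapsto> [z, F z]\<close> for any \<open>z\<close> over \<open>u\<close>
  (\<open>equivariant_map_of_section\<close>).  Under this identification all operations of \<open>B\<close> are pointwise and
  the norm is the supremum of the operator norms, so that \<open>B\<close> is a \<open>C\<^sup>*\<close>-algebra and \<open>A\<close> a closed
  subalgebra.

  That \<open>A\<close> generates \<open>B\<close> is a Stone-Weierstrass theorem (\<open>tracial_generates\<close>).  Invariants and their
  conjugates separate the points of \<open>E\<close>, so the generated algebra contains all scalar sections; since
  the tuples in \<open>P\<close> generate the matrix algebra, every section agrees with an element of \<open>A\<close> at any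
  given point, and a partition of unity finishes the argument.  The same remark shows that evaluations
  are onto, hence irreducible.

  For uniqueness (\<open>ucp_extension_unique\<close>) let \<open>\<omega>\<close> be unital and completely positive with \<open>\<omega> = ev\<^sub>u\<close> on
  \<open>A\<close>.  For each vector \<open>v \<noteq> 0\<close> the normalised functional \<open>f \<mapsto> \<langle>\<omega>(f 1) v, v\<rangle>\<close> is a state on the continuous
  functions that represents \<open>u\<close> on the algebra of invariants.  As \<open>u\<close> has only one representing measure,
  \<open>\<omega>(f 1) = f(u) 1\<close>.  A section \<open>b\<close> vanishing at \<open>u\<close> factors as \<open>b = g c\<close> with the scalar section
  \<open>g = \<bar>b\<bar>\<^sup>1\<^sup>/\<^sup>2\<close>, so \<open>\<omega>(g\<^sup>* g) = 0\<close> and 2-positivity gives \<open>\<omega>(b) = 0\<close>.  Hence \<open>\<omega>(b)\<close> depends only on \<open>b(u)\<close>,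
  and it equals \<open>b(u)\<close> because some element of \<open>A\<close> has the same value at \<open>u\<close>.

  Passing from unique representing measures to unique states requires the Riesz representation theorem
  on \<open>X\<close> (\<open>riesz_representation\<close>), obtained from the Daniell outer measure.  Evaluation at \<open>u\<close> makes
  sense because the Choquet boundary lies in the Shilov boundary (\<open>choquet_subset_shilov\<close>): for a closed
  boundary \<open>E'\<close> the Hahn-Banach theorem extends evaluation at \<open>u\<close> to a state dominated by the supremum
  over \<open>E'\<close>; that state is evaluation at \<open>u\<close>, and so \<open>u \<in> E'\<close>.
\<close>

section \<open>Measures representing states on a compact space\<close>

text \<open>
  A normalised positive linear functional on the real continuous functions on \<open>X\<close>.  These are
  represented by functions on the whole type that are continuous on \<open>X\<close>; by positivity the value of
  the functional depends only on the restriction to \<open>X\<close> (\<open>state_on_cong\<close>).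
\<close>

definition state_on :: "'a::topological_space set \<Rightarrow> (('a \<Rightarrow> real) \<Rightarrow> real) \<Rightarrow> bool" where
  "state_on X L \<longleftrightarrow>
     (\<forall>f g. continuous_on X f \<longrightarrow> continuous_on X g \<longrightarrow> L (\<lambda>x. f x + g x) = L f + L g) \<and>
     (\<forall>c f. continuous_on X f \<longrightarrow> L (\<lambda>x. c * f x) = c * L f) \<and>
     (\<forall>f. continuous_on X f \<longrightarrow> (\<forall>x\<in>X. 0 \<le> f x) \<longrightarrow> 0 \<le> L f) \<and> L (\<lambda>_. 1) = 1"

lemma state_onD:
  assumes "state_on X L"
  shows "\<And>f g. continuous_on X f \<Longrightarrow> continuous_on X g \<Longrightarrow> L (\<lambda>x. f x + g x) = L f + L g"
    and "\<And>c f. continuous_on X f \<Longrightarrow> L (\<lambda>x. c * f x) = c * L f"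
    and "\<And>f. continuous_on X f \<Longrightarrow> (\<And>x. x \<in> X \<Longrightarrow> 0 \<le> f x) \<Longrightarrow> 0 \<le> L f"
    and "L (\<lambda>_. 1) = 1"
  using assms unfolding state_on_def by blast+

lemma state_on_diff:
  assumes L: "state_on X L" and f: "continuous_on X f" and g: "continuous_on X g"
  shows "L (\<lambda>x. f x - g x) = L f - L g"
proof -
  have "L (\<lambda>x. f x + (-1) * g x) = L f + (-1) * L g"
    using state_onD(1)[OF L f, of "\<lambda>x. (-1) * g x"] state_onD(2)[OF L g, of "-1"] g
    by (simp add: continuous_on_minus)
  then show ?thesis by simp
qed

lemma state_on_mono:
  assumes L: "state_on X L" and f: "continuous_on X f" and g: "continuous_on X g"
    and le: "\<And>x. x \<in> X \<Longrightarrow> f x \<le> g x"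
  shows "L f \<le> L g"
  using state_onD(3)[OF L, of "\<lambda>x. g x - f x"] state_on_diff[OF L g f] le f g
  by (simp add: continuous_on_diff)

lemma state_on_const: assumes "state_on X L" shows "L (\<lambda>_. c) = c"
  using state_onD(2)[OF assms, of "\<lambda>_. 1" c] state_onD(4)[OF assms] by simp

lemma state_on_cong:
  assumes L: "state_on X L" and f: "continuous_on X f" and eq: "\<And>x. x \<in> X \<Longrightarrow> f x = g x"
  shows "L f = L g"
proof -
  have g: "continuous_on X g" using f eq by (metis continuous_on_cong)
  show ?thesis using state_on_mono[OF L f g] state_on_mono[OF L g f] eq by force
qed

lemma state_on_superset:
  assumes L: "state_on E L" and sub: "E \<subseteq> X"
  shows "state_on X L"
  unfolding state_on_def
proof (intro conjI allI impI)
  fix f g :: "'a \<Rightarrow> real" assume "continuous_on X f" "continuous_on X g"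
  then show "L (\<lambda>x. f x + g x) = L f + L g"
    using sub by (intro state_onD(1)[OF L]) (auto intro: continuous_on_subset)
next
  fix c and f :: "'a \<Rightarrow> real" assume "continuous_on X f"
  then show "L (\<lambda>x. c * f x) = c * L f"
    using sub by (intro state_onD(2)[OF L]) (auto intro: continuous_on_subset)
next
  fix f :: "'a \<Rightarrow> real" assume "continuous_on X f" "\<forall>x\<in>X. 0 \<le> f x"
  then show "0 \<le> L f"
    using sub by (intro state_onD(3)[OF L]) (auto intro: continuous_on_subset)
qed (rule state_onD(4)[OF L])

lemma state_on_sum:
  assumes L: "state_on X L" and f: "\<And>i. i \<in> I \<Longrightarrow> continuous_on X (f i)"
  shows "L (\<lambda>x. \<Sum>i\<in>I. f i x) = (\<Sum>i\<in>I. L (f i))"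
  using f
proof (induction I rule: infinite_finite_induct)
  case (insert i I)
  then show ?case
    using state_onD(1)[OF L, of "f i" "\<lambda>x. \<Sum>i\<in>I. f i x"] by (simp add: continuous_on_sum)
qed (use state_on_const[OF L, of 0] in auto)

text \<open>
  The sequences of nonnegative continuous functions on \<open>X\<close> whose sum, possibly infinite, is at least 1
  on \<open>A\<close>.
\<close>

definition cover_seqs :: "'a::topological_space set \<Rightarrow> 'a set \<Rightarrow> (nat \<Rightarrow> 'a \<Rightarrow> real) set" where
  "cover_seqs X A = {f. (\<forall>n. continuous_on X (f n) \<and> (\<forall>x\<in>X. 0 \<le> f n x)) \<and>
     (\<forall>x\<in>A. 1 \<le> (\<Sum>n. ennreal (f n x)))}"

text \<open>
  The Daniell outer measure of a functional.  Covering by sequences of functions instead of open sets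
  makes countable subadditivity immediate.
\<close>

definition daniell_outer ::
  "'a::topological_space set \<Rightarrow> (('a \<Rightarrow> real) \<Rightarrow> real) \<Rightarrow> 'a set \<Rightarrow> ennreal" where
  "daniell_outer X L A = (INF f\<in>cover_seqs X A. \<Sum>n. ennreal (L (f n)))"

lemma daniell_outer_le_double:
  assumes c: "\<And>i k. continuous_on X (g i k)" and nn: "\<And>i k x. x \<in> X \<Longrightarrow> 0 \<le> g i k x"
    and ge: "\<And>x. x \<in> A \<Longrightarrow> 1 \<le> (\<Sum>i. \<Sum>k. ennreal (g i k x))"
  shows "daniell_outer X L A \<le> (\<Sum>i. \<Sum>k. ennreal (L (g i k)))"
proof -
  let ?f = "\<lambda>m. case prod_decode m of (i, k) \<Rightarrow> g i k"
  have s: "(\<Sum>m. (\<lambda>(i, k). t i k) (prod_decode m)) = (\<Sum>i. \<Sum>k. t i k :: ennreal)" for t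
    by (rule suminf_ennreal_2dimen) simp
  have "(\<Sum>m. ennreal (?f m x)) = (\<Sum>i. \<Sum>k. ennreal (g i k x))" for x
    using s[of "\<lambda>i k. ennreal (g i k x)"] by (simp add: case_prod_beta)
  then have "?f \<in> cover_seqs X A"
    using c nn ge by (auto simp: cover_seqs_def split: prod.splits)
  then have "daniell_outer X L A \<le> (\<Sum>m. ennreal (L (?f m)))"
    unfolding daniell_outer_def by (rule INF_lower)
  also have "\<dots> = (\<Sum>i. \<Sum>k. ennreal (L (g i k)))"
    using s[of "\<lambda>i k. ennreal (L (g i k))"] by (simp add: case_prod_beta)
  finally show ?thesis .
qed

lemma daniell_outer_le_single:
  assumes L: "state_on X L" and f: "continuous_on X f" "\<And>x. x \<in> X \<Longrightarrow> 0 \<le> f x"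
    and ge: "\<And>x. x \<in> A \<Longrightarrow> 1 \<le> f x"
  shows "daniell_outer X L A \<le> ennreal (L f)"
proof -
  let ?f = "\<lambda>n::nat. if n = 0 then f else (\<lambda>_. 0)"
  have s: "(\<Sum>n. (if n = (0::nat) then t else 0)) = (t::ennreal)" for t
    using suminf_finite[of "{0}" "\<lambda>n. if n = (0::nat) then t else 0"] by simp
  have 1: "(\<Sum>n. ennreal (?f n x)) = ennreal (f x)" for x
    using s[of "ennreal (f x)"] by (simp add: if_distrib[of ennreal] if_distribR cong: if_cong)
  have 2: "(\<Sum>n. ennreal (L (?f n))) = ennreal (L f)"
    using s[of "ennreal (L f)"] state_on_const[OF L, of 0]
    by (simp add: if_distrib[of L] if_distrib[of ennreal] cong: if_cong)
  have "?f \<in> cover_seqs X A"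
    unfolding cover_seqs_def using f ge 1 by (auto simp flip: ennreal_1 intro!: ennreal_leI)
  then show ?thesis
    unfolding daniell_outer_def by (rule INF_lower2) (simp add: 2)
qed

lemma daniell_outer_approx:
  assumes "e > 0" "daniell_outer X L A < \<infinity>"
  obtains f where "f \<in> cover_seqs X A" "(\<Sum>n. ennreal (L (f n))) < daniell_outer X L A + ennreal e"
proof -
  have "daniell_outer X L A < daniell_outer X L A + ennreal e"
    using assms by (metis add.right_neutral ennreal_add_left_cancel_less ennreal_less_zero_iff infinity_ennreal_def)
  then have "\<exists>f\<in>cover_seqs X A. (\<Sum>n. ennreal (L (f n))) < daniell_outer X L A + ennreal e"
    unfolding daniell_outer_def INF_less_iff .
  then show ?thesis using that by blast
qed

lemma suminf_geometric_ennreal: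
  assumes "e > 0" shows "(\<Sum>n. ennreal (e * (1/2) ^ Suc n)) = ennreal e"
proof -
  have "(\<lambda>n. e * (1/2) ^ Suc n) sums (e * 1)"
    by (intro sums_mult power_half_series)
  then show ?thesis using assms by (intro suminf_ennreal_eq) auto
qed

lemma daniell_outer_space:
  assumes L: "state_on X L"
  shows "outer_measure_space (Pow X) (daniell_outer X L)"
proof -
  have z: "daniell_outer X L {} = 0"
    using daniell_outer_le_single[OF L, of "\<lambda>_. 0" "{}"] state_on_const[OF L, of 0] by simp
  have mono: "daniell_outer X L A \<le> daniell_outer X L B" if "A \<subseteq> B" for A B
    unfolding daniell_outer_def using that by (intro INF_superset_mono) (auto simp: cover_seqs_def)
  have "daniell_outer X L (\<Union>i. A i) \<le> (\<Sum>i. daniell_outer X L (A i))" for A :: "nat \<Rightarrow> 'a set"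
  proof (cases "(\<Sum>i. daniell_outer X L (A i)) < \<infinity>")
    case True
    have fin: "daniell_outer X L (A i) < \<infinity>" for i
      using True ennreal_suminf_lessD by blast
    show ?thesis
    proof (rule ennreal_le_epsilon)
      fix e :: real assume e: "0 < e"
      have "\<exists>f. f \<in> cover_seqs X (A i) \<and>
          (\<Sum>n. ennreal (L (f n))) < daniell_outer X L (A i) + ennreal (e * (1/2) ^ Suc i)" for i
        using daniell_outer_approx[OF _ fin[of i], of "e * (1/2) ^ Suc i"] e by auto
      then obtain f where f: "\<And>i. f i \<in> cover_seqs X (A i)"
        "\<And>i. (\<Sum>n. ennreal (L (f i n))) < daniell_outer X L (A i) + ennreal (e * (1/2) ^ Suc i)"
        by metis
      have ge: "1 \<le> (\<Sum>i. \<Sum>k. ennreal (f i k x))" if x: "x \<in> (\<Union>i. A i)" for x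
      proof -
        obtain i where "x \<in> A i" using x by blast
        then have "1 \<le> (\<Sum>k. ennreal (f i k x))" using f(1)[of i] by (auto simp: cover_seqs_def)
        also have "\<dots> \<le> (\<Sum>i. \<Sum>k. ennreal (f i k x))"
          using sum_le_suminf[OF summableI, of "{i}" "\<lambda>i. \<Sum>k. ennreal (f i k x)"] by simp
        finally show ?thesis .
      qed
      have "daniell_outer X L (\<Union>i. A i) \<le> (\<Sum>i. \<Sum>k. ennreal (L (f i k)))"
        using f(1) ge by (intro daniell_outer_le_double) (auto simp: cover_seqs_def)
      also have "\<dots> \<le> (\<Sum>i. daniell_outer X L (A i) + ennreal (e * (1/2) ^ Suc i))"
        using f(2) by (intro suminf_le) (auto intro: less_imp_le)
      also have "\<dots> = (\<Sum>i. daniell_outer X L (A i)) + ennreal e"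
        using suminf_add[OF summableI summableI, of "\<lambda>i. daniell_outer X L (A i)"
          "\<lambda>i. ennreal (e * (1/2) ^ Suc i)"] suminf_geometric_ennreal[OF e] by simp
      finally show "daniell_outer X L (\<Union>i. A i) \<le> (\<Sum>i. daniell_outer X L (A i)) + ennreal e" .
    qed
  qed (simp add: less_top[symmetric])
  with z mono show ?thesis
    by (auto simp: outer_measure_space_def positive_def increasing_def countably_subadditive_def)
qed

text \<open>
  Caratheodory measurability of \<open>U = {h > 0}\<close>.  The functions \<open>\<phi> k = min (k h) 1\<close> increase to the
  indicator function of \<open>U\<close>, so a cover \<open>f\<close> of \<open>A\<close> splits as follows: the telescoping pieces
  \<open>f n * (\<phi> (k+1) - \<phi> k)\<close> cover \<open>A \<inter> U\<close>, and \<open>f n * (1 - \<phi> (K n))\<close> covers \<open>A - U\<close> for any choice of the \<open>K n\<close>.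
  Taking \<open>K n\<close> large makes the total cost at most that of \<open>f\<close> plus \<open>e\<close>.
\<close>

lemma cozero_in_lambda_system:
  fixes h :: "'a::topological_space \<Rightarrow> real"
  assumes L: "state_on X L" and h: "continuous_on X h" "\<And>x. x \<in> X \<Longrightarrow> 0 \<le> h x"
  shows "{x \<in> X. 0 < h x} \<in> lambda_system X (Pow X) (daniell_outer X L)"
proof -
  let ?U = "{x \<in> X. 0 < h x}" and ?\<mu> = "daniell_outer X L"
  define \<phi> where "\<phi> k x = min (real k * h x) 1" for k :: nat and x
  have \<phi>: "continuous_on X (\<phi> k)" "\<And>x. x \<in> X \<Longrightarrow> 0 \<le> \<phi> k x" "\<And>x. \<phi> k x \<le> 1" for k
    unfolding \<phi>_def using h by (auto intro!: continuous_intros)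
  have \<phi>_mono: "\<phi> k x \<le> \<phi> (Suc k) x" if "x \<in> X" for k x
    using h(2)[OF that] by (auto simp: \<phi>_def algebra_simps min_le_iff_disj)
  have \<phi>_lim: "(\<lambda>k. \<phi> k x) \<longlonglongrightarrow> 1" if "x \<in> ?U" for x
  proof (rule tendsto_eventually)
    obtain N :: nat where N: "1 / h x < real N" using reals_Archimedean2 by blast
    show "\<forall>\<^sub>F k in sequentially. \<phi> k x = 1"
    proof (rule eventually_sequentiallyI[of N])
      fix k assume "N \<le> k"
      then have "1 / h x \<le> real k" using N by linarith
      then show "\<phi> k x = 1" using that by (auto simp: \<phi>_def field_simps min_def)
    qed
  qed
  have split: "?\<mu> (?U \<inter> A) + ?\<mu> ((X - ?U) \<inter> A) \<le> ?\<mu> A" if A: "A \<subseteq> X" for A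
  proof (cases "?\<mu> A < \<infinity>")
    case True
    show ?thesis
    proof (rule ennreal_le_epsilon)
      fix e :: real assume e0: "0 < e"
      define e2 where "e2 = e / 2"
      have e: "0 < e2" using e0 by (simp add: e2_def)
      obtain f where f: "f \<in> cover_seqs X A" and fl: "(\<Sum>n. ennreal (L (f n))) < ?\<mu> A + ennreal e2"
        using daniell_outer_approx[OF e True] .
      have fc: "continuous_on X (f n)" and fnn: "\<And>x. x \<in> X \<Longrightarrow> 0 \<le> f n x" for n
        using f by (auto simp: cover_seqs_def)
      define a where "a n k x = f n x * (\<phi> (Suc k) x - \<phi> k x)" for n k x
      have ac: "continuous_on X (a n k)" and ann: "\<And>x. x \<in> X \<Longrightarrow> 0 \<le> a n k x" for n k
        unfolding a_def using fc fnn \<phi>(1) \<phi>_mono by (auto intro!: continuous_intros mult_nonneg_nonneg)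
      have Lann: "0 \<le> L (a n k)" for n k using state_onD(3)[OF L ac ann] .
      have part: "(\<Sum>k<K. L (a n k)) = L (\<lambda>x. f n x * \<phi> K x)" for n K
      proof -
        have t: "(\<Sum>k<K. \<phi> (Suc k) x - \<phi> k x) = \<phi> K x" for x
          using sum_lessThan_telescope[of "\<lambda>k. \<phi> k x" K] by (simp add: \<phi>_def)
        have "(\<Sum>k<K. L (a n k)) = L (\<lambda>x. \<Sum>k<K. a n k x)"
          using state_on_sum[OF L, of "{..<K}" "a n"] ac by simp
        also have "(\<lambda>x. \<Sum>k<K. a n k x) = (\<lambda>x. f n x * \<phi> K x)"
          by (simp add: a_def sum_distrib_left[symmetric] t)
        finally show ?thesis .
      qed
      have part_le: "L (\<lambda>x. f n x * \<phi> K x) \<le> L (f n)" for n K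
        using fc fnn \<phi> by (intro state_on_mono[OF L]) (auto intro!: continuous_intros mult_left_le)
      have sm: "summable (\<lambda>k. L (a n k))" for n
        using Lann part part_le by (intro summableI_nonneg_bounded[where x="L (f n)"]) auto
      define l where "l n = (\<Sum>k. L (a n k))" for n
      have l: "0 \<le> l n" "l n \<le> L (f n)" for n
        unfolding l_def using sm Lann part part_le by (auto intro!: suminf_nonneg suminf_le_const)
      have "\<exists>K. l n - L (\<lambda>x. f n x * \<phi> K x) < e2 * (1/2) ^ Suc n" for n
      proof -
        have "(\<lambda>K. \<Sum>k<K. L (a n k)) \<longlonglongrightarrow> l n" unfolding l_def by (rule summable_LIMSEQ[OF sm])
        then have "\<forall>\<^sub>F K in sequentially. l n - e2 * (1/2) ^ Suc n < (\<Sum>k<K. L (a n k))"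
          using e by (intro order_tendstoD(1)) auto
        then obtain K where "l n - e2 * (1/2) ^ Suc n < (\<Sum>k<K. L (a n k))"
          using eventually_happens' by force
        then show ?thesis using part[of n K] by (intro exI[of _ K]) linarith
      qed
      then obtain K where K: "\<And>n. l n - L (\<lambda>x. f n x * \<phi> (K n) x) < e2 * (1/2) ^ Suc n" by metis
      have "?\<mu> (?U \<inter> A) \<le> (\<Sum>n. \<Sum>k. ennreal (L (a n k)))"
      proof (rule daniell_outer_le_double[OF ac ann])
        fix x assume x: "x \<in> ?U \<inter> A"
        have "(\<Sum>k. ennreal (a n k x)) = ennreal (f n x)" for n
        proof (rule suminf_ennreal_eq)
          show "0 \<le> a n i x" for i using ann x by auto
          have "(\<lambda>k. \<phi> (Suc k) x - \<phi> k x) sums (1 - \<phi> 0 x)"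
            using x by (intro telescope_sums \<phi>_lim) auto
          then show "(\<lambda>k. a n k x) sums f n x"
            using sums_mult[of "\<lambda>k. \<phi> (Suc k) x - \<phi> k x" 1 "f n x"] by (simp add: a_def \<phi>_def)
        qed
        then show "1 \<le> (\<Sum>n. \<Sum>k. ennreal (a n k x))"
          using f x by (simp add: cover_seqs_def)
      qed auto
      also have "\<dots> = (\<Sum>n. ennreal (l n))"
        unfolding l_def using sm Lann by (intro suminf_cong suminf_ennreal2) auto
      finally have 1: "?\<mu> (?U \<inter> A) \<le> (\<Sum>n. ennreal (l n))" .
      let ?b = "\<lambda>n x. f n x * (1 - \<phi> (K n) x)"
      have bc: "continuous_on X (?b n)" for n using fc \<phi>(1) by (auto intro!: continuous_intros)
      have Lb: "L (?b n) = L (f n) - L (\<lambda>x. f n x * \<phi> (K n) x)" for n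
        using state_on_diff[OF L fc, of "\<lambda>x. f n x * \<phi> (K n) x" n] fc \<phi>(1)
        by (simp add: algebra_simps continuous_intros)
      have "?b \<in> cover_seqs X ((X - ?U) \<inter> A)"
      proof -
        have "\<phi> k x = 0" if "x \<in> X - ?U" for k x
          using that h(2)[of x] by (auto simp: \<phi>_def)
        then show ?thesis
          using f bc fnn \<phi>(3) unfolding cover_seqs_def by (auto intro!: mult_nonneg_nonneg)
      qed
      then have "?\<mu> ((X - ?U) \<inter> A) \<le> (\<Sum>n. ennreal (L (?b n)))"
        unfolding daniell_outer_def by (rule INF_lower)
      also have "\<dots> \<le> (\<Sum>n. ennreal (L (f n) - l n) + ennreal (e2 * (1/2) ^ Suc n))"
      proof (intro suminf_le summableI)
        fix n
        have "L (?b n) \<le> (L (f n) - l n) + e2 * (1/2) ^ Suc n" using K[of n] Lb[of n] by linarith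
        then have "ennreal (L (?b n)) \<le> ennreal ((L (f n) - l n) + e2 * (1/2) ^ Suc n)"
          by (rule ennreal_leI)
        also have "\<dots> = ennreal (L (f n) - l n) + ennreal (e2 * (1/2) ^ Suc n)"
          by (rule ennreal_plus) (use l[of n] e in auto)
        finally show "ennreal (L (?b n)) \<le> ennreal (L (f n) - l n) + ennreal (e2 * (1/2) ^ Suc n)" .
      qed
      also have "\<dots> = (\<Sum>n. ennreal (L (f n) - l n)) + ennreal e2"
        using suminf_add[OF summableI summableI, of "\<lambda>n. ennreal (L (f n) - l n)"
          "\<lambda>i. ennreal (e2 * (1/2) ^ Suc i)"] suminf_geometric_ennreal[OF e] by simp
      finally have 2: "?\<mu> ((X - ?U) \<inter> A) \<le> (\<Sum>n. ennreal (L (f n) - l n)) + ennreal e2" .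
      have "?\<mu> (?U \<inter> A) + ?\<mu> ((X - ?U) \<inter> A)
          \<le> ((\<Sum>n. ennreal (l n)) + (\<Sum>n. ennreal (L (f n) - l n))) + ennreal e2"
        using add_mono[OF 1 2] by (simp add: add.assoc)
      also have "(\<Sum>n. ennreal (l n)) + (\<Sum>n. ennreal (L (f n) - l n))
          = (\<Sum>n. ennreal (l n) + ennreal (L (f n) - l n))"
        by (rule suminf_add) auto
      also have "\<dots> = (\<Sum>n. ennreal (L (f n)))"
      proof (rule suminf_cong)
        fix n
        have "ennreal (l n + (L (f n) - l n)) = ennreal (l n) + ennreal (L (f n) - l n)"
          by (rule ennreal_plus) (use l[of n] in auto)
        then show "ennreal (l n) + ennreal (L (f n) - l n) = ennreal (L (f n))" by simp
      qed
      also have "(\<Sum>n. ennreal (L (f n))) + ennreal e2 \<le> ?\<mu> A + ennreal e2 + ennreal e2"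
        using fl by (intro add_mono) auto
      also have "\<dots> = ?\<mu> A + ennreal e"
      proof -
        have "ennreal (e2 + e2) = ennreal e2 + ennreal e2"
          by (rule ennreal_plus) (use e in auto)
        then show ?thesis by (simp add: add.assoc e2_def)
      qed
      finally show "?\<mu> (?U \<inter> A) + ?\<mu> ((X - ?U) \<inter> A) \<le> ?\<mu> A + ennreal e" .
    qed
  qed (simp add: less_top[symmetric])
  have oms: "outer_measure_space (Pow X) ?\<mu>" by (rule daniell_outer_space[OF L])
  interpret Pow: sigma_algebra X "Pow X" by (rule sigma_algebra_Pow)
  have "?\<mu> A \<le> ?\<mu> (?U \<inter> A) + ?\<mu> ((X - ?U) \<inter> A)" if "A \<subseteq> X" for A
  proof -
    have "subadditive (Pow X) ?\<mu>"
      using oms by (intro Pow.countably_subadditive_subadditive) (auto simp: outer_measure_space_def)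
    then have "?\<mu> ((?U \<inter> A) \<union> ((X - ?U) \<inter> A)) \<le> ?\<mu> (?U \<inter> A) + ?\<mu> ((X - ?U) \<inter> A)"
      by (rule subadditiveD) auto
    moreover have "(?U \<inter> A) \<union> ((X - ?U) \<inter> A) = A" using that by blast
    ultimately show ?thesis by simp
  qed
  with split have "?\<mu> (?U \<inter> A) + ?\<mu> ((X - ?U) \<inter> A) = ?\<mu> A" if "A \<subseteq> X" for A
    using that by (intro antisym) auto
  then show ?thesis unfolding lambda_system_def by blast
qed

lemma sum_clamp:
  fixes t :: real
  assumes "0 \<le> t"
  shows "(\<Sum>i<m. min (max (t - real i) 0) 1) = min t (real m)"
  using assms by (induction m) auto

text \<open>
  A one-sided form of Dini's theorem.
\<close>

lemma partial_sums_ge_on_compact: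
  fixes f :: "nat \<Rightarrow> 'a::topological_space \<Rightarrow> real"
  assumes X: "compact X" and f: "f \<in> cover_seqs X X" and e: "0 < e" "e < 1"
  shows "\<exists>N. \<forall>x\<in>X. 1 - e < (\<Sum>n<N. f n x)"
proof -
  have fc: "continuous_on X (f n)" and fnn: "\<And>x. x \<in> X \<Longrightarrow> 0 \<le> f n x" for n
    using f by (auto simp: cover_seqs_def)
  define U where "U N = {x \<in> X. 1 - e < (\<Sum>n<N. f n x)}" for N
  have U_open: "openin (top_of_set X) (U N)" for N
  proof -
    have "openin (top_of_set X) (X \<inter> (\<lambda>x. \<Sum>n<N. f n x) -` {1 - e<..})"
      using fc by (intro continuous_openin_preimage_gen continuous_on_sum) auto
    moreover have "X \<inter> (\<lambda>x. \<Sum>n<N. f n x) -` {1 - e<..} = U N" by (auto simp: U_def)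
    ultimately show ?thesis by simp
  qed
  have "X \<subseteq> \<Union>(range U)"
  proof
    fix x assume x: "x \<in> X"
    have "ennreal (1 - e) < 1" using e by (simp add: ennreal_less_one_iff)
    also have "1 \<le> (\<Sum>n. ennreal (f n x))" using f x by (auto simp: cover_seqs_def)
    also have "\<dots> = (SUP N. \<Sum>n<N. ennreal (f n x))" by (rule suminf_eq_SUP)
    finally obtain N where "ennreal (1 - e) < (\<Sum>n<N. ennreal (f n x))"
      unfolding less_SUP_iff by blast
    also have "\<dots> = ennreal (\<Sum>n<N. f n x)" using fnn[OF x] by (intro sum_ennreal) auto
    finally have "x \<in> U N" using x e by (simp add: U_def ennreal_less_iff)
    then show "x \<in> \<Union>(range U)" by blast
  qed
  then obtain D where D: "D \<subseteq> range U" "finite D" "X \<subseteq> \<Union>D"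
    using X U_open unfolding compact_eq_openin_cover by (metis (no_types, lifting) image_iff)
  then obtain I where I: "finite I" "D = U ` I" by (meson finite_subset_image)
  then obtain N where N: "\<And>i. i \<in> I \<Longrightarrow> i < N" using finite_nat_set_iff_bounded by auto
  have "1 - e < (\<Sum>n<N. f n x)" if x: "x \<in> X" for x
  proof -
    obtain i where "i \<in> I" "x \<in> U i" using D I x by blast
    moreover have "(\<Sum>n<i. f n x) \<le> (\<Sum>n<N. f n x)"
      using N[OF \<open>i \<in> I\<close>] fnn[OF x] by (intro sum_mono2) auto
    ultimately show ?thesis by (simp add: U_def)
  qed
  then show ?thesis by blast
qed

lemma daniell_outer_total:
  assumes X: "compact X" and L: "state_on X L"
  shows "daniell_outer X L X = 1"
proof (rule antisym)
  show "daniell_outer X L X \<le> 1"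
    using daniell_outer_le_single[OF L, of "\<lambda>_. 1" X] state_onD(4)[OF L] by simp
  show "1 \<le> daniell_outer X L X"
    unfolding daniell_outer_def
  proof (rule INF_greatest)
    fix f assume f: "f \<in> cover_seqs X X"
    have fc: "continuous_on X (f n)" and fnn: "\<And>x. x \<in> X \<Longrightarrow> 0 \<le> f n x" for n
      using f by (auto simp: cover_seqs_def)
    show "1 \<le> (\<Sum>n. ennreal (L (f n)))"
    proof (rule ennreal_le_epsilon)
      fix e0 :: real assume e0: "0 < e0"
      define e where "e = min e0 (1/2)"
      have e: "0 < e" "e < 1" "e \<le> e0" using e0 by (auto simp: e_def)
      obtain N where N: "\<And>x. x \<in> X \<Longrightarrow> 1 - e < (\<Sum>n<N. f n x)"
        using partial_sums_ge_on_compact[OF X f e(1,2)] by blast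
      have "1 - e = L (\<lambda>_. 1 - e)" using state_on_const[OF L] by simp
      also have "\<dots> \<le> L (\<lambda>x. \<Sum>n<N. f n x)"
        using N fc by (intro state_on_mono[OF L] continuous_on_sum) (auto intro: less_imp_le)
      also have "\<dots> = (\<Sum>n<N. L (f n))" by (rule state_on_sum[OF L]) (rule fc)
      finally have "ennreal (1 - e) \<le> ennreal (\<Sum>n<N. L (f n))" by (rule ennreal_leI)
      also have "\<dots> = (\<Sum>n<N. ennreal (L (f n)))"
        using state_onD(3)[OF L fc fnn] by (intro sum_ennreal[symmetric]) auto
      also have "\<dots> \<le> (\<Sum>n. ennreal (L (f n)))" by (intro sum_le_suminf) auto
      finally have "ennreal (1 - e) + ennreal e \<le> (\<Sum>n. ennreal (L (f n))) + ennreal e0"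
        using e by (intro add_mono ennreal_leI) auto
      moreover have "ennreal (1 - e) + ennreal e = 1"
        using e by (simp flip: ennreal_plus)
      ultimately show "1 \<le> (\<Sum>n. ennreal (L (f n))) + ennreal e0" by simp
    qed
  qed
qed

text \<open>
  No regularity is needed: when closed sets are zero sets of continuous functions, all open sets are
  measurable for the Daniell outer measure.
\<close>

lemma riesz_representation:
  fixes X :: "'a::topological_space set"
  assumes X: "compact X"
    and zero_set: "\<And>W. closedin (top_of_set X) W \<Longrightarrow>
      \<exists>h. continuous_on X h \<and> (\<forall>x\<in>X. 0 \<le> h x) \<and> W = {x \<in> X. h x = (0::real)}"
    and L: "state_on X L"
  shows "\<exists>\<mu>. space \<mu> = X \<and> sets \<mu> = sets (restrict_space borel X) \<and> emeasure \<mu> X = 1 \<and>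
    (\<forall>h::'a \<Rightarrow> real. continuous_on X h \<longrightarrow> integrable \<mu> h \<and> integral\<^sup>L \<mu> h = L h)"
proof -
  let ?o = "daniell_outer X L"
  define \<Lambda> where "\<Lambda> = lambda_system X (Pow X) ?o"
  have ms: "measure_space X \<Lambda> ?o"
    unfolding \<Lambda>_def by (rule sigma_algebra.caratheodory_lemma[OF sigma_algebra_Pow daniell_outer_space[OF L]])
  interpret \<Lambda>: sigma_algebra X \<Lambda> using ms by (simp add: measure_space_def)
  define N where "N = measure_of X \<Lambda> ?o"
  have spN: "space N = X" and seN: "sets N = \<Lambda>"
    using \<Lambda>.space_closed by (auto simp: N_def)
  have emN: "emeasure N A = ?o A" if "A \<in> \<Lambda>" for A
    unfolding N_def using ms that by (intro emeasure_measure_of_sigma) (auto simp: measure_space_def)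
  have op: "U \<in> \<Lambda>" if "openin (top_of_set X) U" for U
  proof -
    have "closedin (top_of_set X) (X - U)" using that by (simp add: openin_closedin_eq)
    then obtain h where h: "continuous_on X h" "\<And>x. x \<in> X \<Longrightarrow> 0 \<le> h x" "X - U = {x \<in> X. h x = (0::real)}"
      using zero_set by meson
    have "U = {x \<in> X. 0 < h x}"
      using h(2,3) openin_imp_subset[OF that] by (auto simp: less_le)
    then show ?thesis using cozero_in_lambda_system[OF L h(1,2)] by (simp add: \<Lambda>_def)
  qed
  have "(\<lambda>x. x) \<in> borel_measurable N"
  proof (rule borel_measurableI)
    fix S :: "'a set" assume "open S"
    then show "(\<lambda>x. x) -` S \<inter> space N \<in> sets N"
      unfolding spN seN by (intro op) (auto simp: openin_open)
  qed
  then have idm: "(\<lambda>x. x) \<in> measurable N (restrict_space borel X)"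
    by (intro measurable_restrict_space2) (auto simp: spN)
  define \<mu> where "\<mu> = distr N (restrict_space borel X) (\<lambda>x. x)"
  have sp: "space \<mu> = X" and se: "sets \<mu> = sets (restrict_space borel X)"
    by (auto simp: \<mu>_def space_restrict_space)
  have Xs: "X \<in> sets (restrict_space borel X)" by (metis sp se sets.top)
  have em: "emeasure \<mu> A = ?o A" if "A \<in> sets \<mu>" for A
  proof -
    have "A \<subseteq> X" using that sets.sets_into_space sp by blast
    then have "(\<lambda>x. x) -` A \<inter> space N = A" by (auto simp: spN)
    then have "A \<in> \<Lambda>" "emeasure \<mu> A = emeasure N A"
      using measurable_sets[OF idm, of A] that emeasure_distr[OF idm, of A]
      unfolding se seN[symmetric] by (auto simp: \<mu>_def)
    then show ?thesis using emN by simp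
  qed
  have tot: "emeasure \<mu> X = 1" using em Xs se daniell_outer_total[OF X L] by simp
  interpret prob_space_like: finite_measure \<mu>
    by standard (simp add: sp tot)
  have mX: "measure \<mu> X = 1" using tot by (simp add: measure_def)
  have meas: "h \<in> borel_measurable \<mu>" if "continuous_on X h" for h :: "'a \<Rightarrow> real"
    using borel_measurable_continuous_on_restrict[OF that] se
    by (simp cong: measurable_cong_sets)
  have bnd: "\<exists>B>0. \<forall>x\<in>X. \<bar>h x\<bar> \<le> B" if "continuous_on X h" for h :: "'a \<Rightarrow> real"
  proof -
    have "bounded (h ` X)" using compact_continuous_image[OF that X] compact_imp_bounded by blast
    then show ?thesis by (auto simp: bounded_pos)
  qed
  have int: "integrable \<mu> h" if h: "continuous_on X h" for h :: "'a \<Rightarrow> real"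
  proof -
    obtain B where "\<And>x. x \<in> X \<Longrightarrow> \<bar>h x\<bar> \<le> B" using bnd[OF h] by blast
    then show ?thesis
      using meas[OF h] by (intro prob_space_like.integrable_const_bound[where B=B]) (auto simp: sp)
  qed
  have le: "integral\<^sup>L \<mu> h \<le> L h"
    if h: "continuous_on X h" and h01: "\<And>x. x \<in> X \<Longrightarrow> 0 \<le> h x \<and> h x \<le> 1" for h :: "'a \<Rightarrow> real"
  proof -
    \<comment> \<open>The function \<open>(m+1) h\<close> is cut into slices \<open>g i\<close> of height 1, and \<open>g (i+1) > 0\<close> implies \<open>g i = 1\<close>.\<close>
    have bound: "real (Suc m) * integral\<^sup>L \<mu> h \<le> 1 + real (Suc m) * L h" for m :: nat
    proof -
      define g where "g i x = min (max (real (Suc m) * h x - real i) 0) 1" for i :: nat and x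
      have gc: "continuous_on X (g i)" for i
        unfolding g_def using h by (intro continuous_intros)
      have g01: "0 \<le> g i x" "g i x \<le> 1" for i x by (auto simp: g_def)
      have gsum: "(\<Sum>i<Suc m. g i x) = real (Suc m) * h x" if "x \<in> X" for x
        using sum_clamp[of "real (Suc m) * h x" "Suc m"] h01[OF that]
          mult_left_mono[of "h x" 1 "real (Suc m)"] by (simp add: g_def min_def)
      have step: "integral\<^sup>L \<mu> (g (Suc i)) \<le> L (g i)" for i
      proof -
        define A where "A = {x \<in> space \<mu>. 0 < g (Suc i) x}"
        have A: "A \<in> sets \<mu>" unfolding A_def using meas[OF gc] by measurable
        have A1: "1 \<le> g i x" if "x \<in> A" for x
          using that by (auto simp: A_def g_def)
        have "integral\<^sup>L \<mu> (g (Suc i)) \<le> integral\<^sup>L \<mu> (indicator A)"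
          using A g01 int[OF gc]
          by (intro integral_mono prob_space_like.integrable_const_bound[where B=1])
            (auto simp: A_def indicator_def not_less intro: antisym)
        also have "\<dots> = measure \<mu> A" using A sets.sets_into_space[OF A] by (simp add: Int_absorb1)
        also have "\<dots> \<le> L (g i)"
        proof -
          have "emeasure \<mu> A \<le> ennreal (L (g i))"
            using daniell_outer_le_single[OF L gc g01(1) A1] em[OF A] by simp
          then show ?thesis
            using state_onD(3)[OF L gc g01(1)] unfolding measure_def
            by (metis enn2real_leI)
        qed
        finally show ?thesis .
      qed
      have g0: "integral\<^sup>L \<mu> (g 0) \<le> 1"
      proof -
        have "integral\<^sup>L \<mu> (g 0) \<le> integral\<^sup>L \<mu> (\<lambda>_. 1)"
          using g01 int[OF gc] by (intro integral_mono) auto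
        then show ?thesis using mX by (simp add: sp)
      qed
      have "real (Suc m) * integral\<^sup>L \<mu> h = integral\<^sup>L \<mu> (\<lambda>x. \<Sum>i<Suc m. g i x)"
        unfolding integral_mult_right_zero[symmetric]
        by (rule Bochner_Integration.integral_cong[OF refl], subst gsum) (simp_all add: sp)
      also have "\<dots> = (\<Sum>i<Suc m. integral\<^sup>L \<mu> (g i))"
        using int[OF gc] by (intro Bochner_Integration.integral_sum) auto
      also have "\<dots> = integral\<^sup>L \<mu> (g 0) + (\<Sum>i<m. integral\<^sup>L \<mu> (g (Suc i)))"
        by (rule sum.lessThan_Suc_shift)
      also have "\<dots> \<le> 1 + (\<Sum>i<m. L (g i))" using g0 step by (intro add_mono sum_mono) auto
      also have "\<dots> \<le> 1 + (\<Sum>i<Suc m. L (g i))"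
        using state_onD(3)[OF L gc g01(1)] by simp
      also have "(\<Sum>i<Suc m. L (g i)) = L (\<lambda>x. \<Sum>i<Suc m. g i x)"
        using state_on_sum[OF L, of "{..<Suc m}" g] gc by simp
      also have "\<dots> = L (\<lambda>x. real (Suc m) * h x)"
        using gc gsum by (intro state_on_cong[OF L] continuous_on_sum) auto
      also have "\<dots> = real (Suc m) * L h" using state_onD(2)[OF L h] by simp
      finally show ?thesis by simp
    qed
    show ?thesis
    proof (rule field_le_epsilon)
      fix e :: real assume "0 < e"
      then obtain m where "inverse (real (Suc m)) < e" using reals_Archimedean by blast
      moreover have "integral\<^sup>L \<mu> h \<le> L h + inverse (real (Suc m))"
        using bound[of m] by (simp add: field_simps)
      ultimately show "integral\<^sup>L \<mu> h \<le> L h + e" by linarith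
    qed
  qed
  \<comment> \<open>The reverse inequality follows by passing to \<open>1 - h\<close>, since both sides are normalised.\<close>
  have eq01: "integral\<^sup>L \<mu> h = L h"
    if h: "continuous_on X h" and h01: "\<And>x. x \<in> X \<Longrightarrow> 0 \<le> h x \<and> h x \<le> 1" for h :: "'a \<Rightarrow> real"
  proof (rule antisym)
    have "integral\<^sup>L \<mu> (\<lambda>x. 1 - h x) \<le> L (\<lambda>x. 1 - h x)"
      using h h01 by (intro le continuous_intros) auto
    moreover have "L (\<lambda>x. 1 - h x) = 1 - L h"
      using state_on_diff[OF L _ h, of "\<lambda>_. 1"] state_onD(4)[OF L] by simp
    moreover have "integral\<^sup>L \<mu> (\<lambda>x. 1 - h x) = 1 - integral\<^sup>L \<mu> h"
      using int[OF h] mX by (simp add: sp)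
    ultimately show "L h \<le> integral\<^sup>L \<mu> h" by linarith
  qed (rule le[OF h h01])
  have eq: "integral\<^sup>L \<mu> h = L h" if h: "continuous_on X h" for h :: "'a \<Rightarrow> real"
  proof -
    obtain B where B: "B > 0" "\<And>x. x \<in> X \<Longrightarrow> \<bar>h x\<bar> \<le> B" using bnd[OF h] by blast
    let ?g = "\<lambda>x. inverse (2 * B) * (h x + B)"
    have hB: "continuous_on X (\<lambda>x. h x + B)" using h by (intro continuous_intros)
    have "integral\<^sup>L \<mu> ?g = L ?g"
    proof (rule eq01)
      fix x assume "x \<in> X"
      from B(2)[OF this] have "- B \<le> h x" "h x \<le> B" by auto
      then show "0 \<le> ?g x \<and> ?g x \<le> 1" using B(1) by (auto simp: field_simps)
    next
      show "continuous_on X ?g" using hB by (rule continuous_on_mult_left)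
    qed
    moreover have "L ?g = inverse (2 * B) * (L h + B)"
      unfolding state_onD(2)[OF L hB]
      using state_onD(1)[OF L h, of "\<lambda>_. B"] state_on_const[OF L] by simp
    moreover have "integral\<^sup>L \<mu> ?g = inverse (2 * B) * (integral\<^sup>L \<mu> h + B)"
      using int[OF h] mX by (simp add: sp)
    ultimately show ?thesis using B(1) by simp
  qed
  show ?thesis using sp se tot int eq by blast
qed

section \<open>The Hahn-Banach theorem for spaces of real functions\<close>

text \<open>
  A linear space of real functions.
\<close>

definition function_space :: "('a \<Rightarrow> real) set \<Rightarrow> bool" where
  "function_space V \<longleftrightarrow> (\<lambda>_. 0) \<in> V \<and> (\<forall>f\<in>V. \<forall>g\<in>V. (\<lambda>x. f x + g x) \<in> V) \<and>
     (\<forall>c. \<forall>f\<in>V. (\<lambda>x. c * f x) \<in> V)"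

text \<open>
  Sublinearity on \<open>V\<close>.  Homogeneity is required for positive factors only; the value at 0 is given
  separately.
\<close>

definition sublinear_on :: "('a \<Rightarrow> real) set \<Rightarrow> (('a \<Rightarrow> real) \<Rightarrow> real) \<Rightarrow> bool" where
  "sublinear_on V q \<longleftrightarrow> (\<forall>f\<in>V. \<forall>g\<in>V. q (\<lambda>x. f x + g x) \<le> q f + q g) \<and>
     (\<forall>c>0. \<forall>f\<in>V. q (\<lambda>x. c * f x) = c * q f) \<and> q (\<lambda>_. 0) = 0"

text \<open>
  Linearity on \<open>V\<close>, without any condition on the values outside \<open>V\<close>.
\<close>

definition linear_functional_on :: "('a \<Rightarrow> real) set \<Rightarrow> (('a \<Rightarrow> real) \<Rightarrow> real) \<Rightarrow> bool" where
  "linear_functional_on V L \<longleftrightarrow> (\<forall>f\<in>V. \<forall>g\<in>V. L (\<lambda>x. f x + g x) = L f + L g) \<and>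
     (\<forall>c. \<forall>f\<in>V. L (\<lambda>x. c * f x) = c * L f)"

lemma function_spaceD:
  assumes "function_space V"
  shows "(\<lambda>_. 0) \<in> V" "\<And>f g. f \<in> V \<Longrightarrow> g \<in> V \<Longrightarrow> (\<lambda>x. f x + g x) \<in> V"
    "\<And>c f. f \<in> V \<Longrightarrow> (\<lambda>x. c * f x) \<in> V" "\<And>f. f \<in> V \<Longrightarrow> (\<lambda>x. - f x) \<in> V"
proof -
  show "(\<lambda>_. 0) \<in> V" "\<And>f g. f \<in> V \<Longrightarrow> g \<in> V \<Longrightarrow> (\<lambda>x. f x + g x) \<in> V"
    and c: "\<And>c f. f \<in> V \<Longrightarrow> (\<lambda>x. c * f x) \<in> V"
    using assms by (auto simp: function_space_def)
  show "\<And>f. f \<in> V \<Longrightarrow> (\<lambda>x. - f x) \<in> V" using c[of _ "-1"] by simp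
qed

lemma sublinear_onD:
  assumes "sublinear_on V q"
  shows "\<And>f g. f \<in> V \<Longrightarrow> g \<in> V \<Longrightarrow> q (\<lambda>x. f x + g x) \<le> q f + q g"
    "\<And>c f. 0 < c \<Longrightarrow> f \<in> V \<Longrightarrow> q (\<lambda>x. c * f x) = c * q f" "q (\<lambda>_. 0) = 0"
  using assms by (auto simp: sublinear_on_def)

lemma sublinear_on_uminus:
  assumes V: "function_space V" and q: "sublinear_on V q" and f: "f \<in> V"
  shows "- q (\<lambda>x. - f x) \<le> q f"
  using sublinear_onD(1)[OF q f function_spaceD(4)[OF V f]] sublinear_onD(3)[OF q] by simp

text \<open>
  The infimum of a family of functionals is sublinear if the family is bounded below at each point and
  is subadditive and homogeneous as a whole, that is, after a change of the index.
\<close>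

lemma sublinear_on_INF:
  fixes q :: "'i \<Rightarrow> ('a \<Rightarrow> real) \<Rightarrow> real"
  assumes V: "function_space V" and I: "I \<noteq> {}"
    and bdd: "\<And>f. f \<in> V \<Longrightarrow> bdd_below ((\<lambda>i. q i f) ` I)"
    and add: "\<And>i j f g. i \<in> I \<Longrightarrow> j \<in> I \<Longrightarrow> f \<in> V \<Longrightarrow> g \<in> V \<Longrightarrow>
      \<exists>k\<in>I. q k (\<lambda>x. f x + g x) \<le> q i f + q j g"
    and scale: "\<And>i c f. i \<in> I \<Longrightarrow> 0 < c \<Longrightarrow> f \<in> V \<Longrightarrow> \<exists>k\<in>I. q k (\<lambda>x. c * f x) \<le> c * q i f"
    and zero: "\<And>i. i \<in> I \<Longrightarrow> 0 \<le> q i (\<lambda>_. 0)" "\<exists>i\<in>I. q i (\<lambda>_. 0) \<le> 0"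
  shows "sublinear_on V (\<lambda>f. INF i\<in>I. q i f)"
proof -
  let ?r = "\<lambda>f. INF i\<in>I. q i f"
  have low: "?r f \<le> q i f" if "i \<in> I" "f \<in> V" for i f
    using bdd[OF that(2)] that(1) by (rule cINF_lower)
  have appr: "\<exists>i\<in>I. q i f < t" if "f \<in> V" "?r f < t" for f t
    using cINF_less_iff[OF I bdd[OF that(1)]] that(2) by auto
  have add': "?r (\<lambda>x. f x + g x) \<le> ?r f + ?r g" if f: "f \<in> V" and g: "g \<in> V" for f g
  proof (rule field_le_epsilon)
    fix e :: real assume e: "0 < e"
    obtain i where i: "i \<in> I" "q i f < ?r f + e / 2" using appr[OF f, of "?r f + e / 2"] e by auto
    obtain j where j: "j \<in> I" "q j g < ?r g + e / 2" using appr[OF g, of "?r g + e / 2"] e by auto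
    obtain k where k: "k \<in> I" "q k (\<lambda>x. f x + g x) \<le> q i f + q j g" using add[OF i(1) j(1) f g] by auto
    show "?r (\<lambda>x. f x + g x) \<le> ?r f + ?r g + e"
      using low[OF k(1) function_spaceD(2)[OF V f g]] k(2) i(2) j(2) by simp
  qed
  have scale': "?r (\<lambda>x. c * f x) \<le> c * ?r f" if c: "0 < c" and f: "f \<in> V" for c f
  proof -
    have "inverse c * ?r (\<lambda>x. c * f x) \<le> ?r f"
    proof (rule cINF_greatest[OF I])
      fix i assume i: "i \<in> I"
      obtain k where k: "k \<in> I" "q k (\<lambda>x. c * f x) \<le> c * q i f" using scale[OF i c f] by auto
      have "?r (\<lambda>x. c * f x) \<le> c * q i f"
        using low[OF k(1) function_spaceD(3)[OF V f, of c]] k(2) by simp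
      then show "inverse c * ?r (\<lambda>x. c * f x) \<le> q i f" using c by (simp add: field_simps)
    qed
    then show ?thesis using c by (simp add: field_simps)
  qed
  have hom: "?r (\<lambda>x. c * f x) = c * ?r f" if c: "0 < c" and f: "f \<in> V" for c f
  proof (rule antisym)
    have "?r (\<lambda>x. inverse c * (c * f x)) \<le> inverse c * ?r (\<lambda>x. c * f x)"
      using scale'[of "inverse c" "\<lambda>x. c * f x"] c function_spaceD(3)[OF V f] by simp
    then show "c * ?r f \<le> ?r (\<lambda>x. c * f x)" using c by (simp add: field_simps)
  qed (rule scale'[OF c f])
  have "?r (\<lambda>_. 0) = 0"
  proof (rule antisym)
    obtain i where "i \<in> I" "q i (\<lambda>_. 0) \<le> 0" using zero(2) by auto
    then show "?r (\<lambda>_. 0) \<le> 0" using low[OF _ function_spaceD(1)[OF V], of i] by simp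
    show "0 \<le> ?r (\<lambda>_. 0)" using zero(1) by (intro cINF_greatest[OF I]) auto
  qed
  with add' hom show ?thesis by (simp add: sublinear_on_def)
qed

text \<open>A sublinear functional that is minimal among the sublinear functionals is linear.\<close>

lemma minimal_sublinear_linear:
  assumes V: "function_space V" and q: "sublinear_on V q"
    and min: "\<And>q' f. sublinear_on V q' \<Longrightarrow> (\<And>f. f \<in> V \<Longrightarrow> q' f \<le> q f) \<Longrightarrow> f \<in> V \<Longrightarrow> q' f = q f"
  shows "linear_functional_on V q"
proof -
  have add: "q (\<lambda>x. f x + g x) = q f + q g" if f: "f \<in> V" and g: "g \<in> V" for f g
  proof (rule antisym)
    show "q (\<lambda>x. f x + g x) \<le> q f + q g" by (rule sublinear_onD(1)[OF q f g])
    \<comment> \<open>Replacing \<open>q\<close> by the infimum of \<open>q (f + t g) - t q g\<close> over \<open>t \<ge> 0\<close> forces additivity in \<open>g\<close>.\<close>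
    define r where "r t f = q (\<lambda>x. f x + t * g x) - t * q g" for t :: real and f
    have inV: "(\<lambda>x. f x + t * g x) \<in> V" if "f \<in> V" for t f
      using function_spaceD(2)[OF V that function_spaceD(3)[OF V g, of t]] .
    have homg: "q (\<lambda>x. t * g x) = t * q g" if "0 \<le> t" for t
      using sublinear_onD(2)[OF q _ g, of t] sublinear_onD(3)[OF q] that by (cases "t = 0") auto
    have lower: "- q (\<lambda>x. - h x) \<le> r t h" if h: "h \<in> V" and t: "0 \<le> t" for h t
      using sublinear_onD(1)[OF q inV[OF h] function_spaceD(4)[OF V h], of t] homg[OF t]
      by (simp add: r_def)
    have sub: "sublinear_on V (\<lambda>f. INF t\<in>{0..}. r t f)"
    proof (rule sublinear_on_INF[OF V])
      show "bdd_below ((\<lambda>t. r t h) ` {0..})" if "h \<in> V" for h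
        using lower[OF that] by (intro bdd_belowI2[where m = "- q (\<lambda>x. - h x)"]) auto
    next
      fix s t :: real and h k assume *: "s \<in> {0..}" "t \<in> {0..}" "h \<in> V" "k \<in> V"
      have "r (s + t) (\<lambda>x. h x + k x) \<le> r s h + r t k"
        using sublinear_onD(1)[OF q inV[OF *(3), of s] inV[OF *(4), of t]]
        by (simp add: r_def algebra_simps)
      then show "\<exists>u\<in>{0..}. r u (\<lambda>x. h x + k x) \<le> r s h + r t k"
        using * by (intro bexI[of _ "s + t"]) auto
    next
      fix s c :: real and h assume *: "s \<in> {0..}" "0 < c" "h \<in> V"
      have "r (c * s) (\<lambda>x. c * h x) \<le> c * r s h"
        using sublinear_onD(2)[OF q *(2) inV[OF *(3), of s]] by (simp add: r_def algebra_simps)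
      then show "\<exists>u\<in>{0..}. r u (\<lambda>x. c * h x) \<le> c * r s h"
        using * by (intro bexI[of _ "c * s"]) auto
    qed (use homg in \<open>auto simp: r_def intro!: bexI[of _ 0]\<close>)
    have low: "(INF t\<in>{0..}. r t h) \<le> r s h" if "h \<in> V" "0 \<le> s" for h s
      using that lower[OF that(1)]
      by (intro cINF_lower bdd_belowI2[where m = "- q (\<lambda>x. - h x)"]) auto
    have "q f = (INF t\<in>{0..}. r t f)"
      using low[of _ 0] by (intro min[OF sub _ f, symmetric]) (simp add: r_def)
    also have "\<dots> \<le> r 1 f" using low[OF f, of 1] by simp
    finally show "q f + q g \<le> q (\<lambda>x. f x + g x)" by (simp add: r_def)
  qed
  have neg: "q (\<lambda>x. - f x) = - q f" if f: "f \<in> V" for f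
    using add[OF f function_spaceD(4)[OF V f]] sublinear_onD(3)[OF q] by simp
  have "q (\<lambda>x. c * f x) = c * q f" if f: "f \<in> V" for c f
  proof (cases c "0::real" rule: linorder_cases)
    case less
    then show ?thesis
      using sublinear_onD(2)[OF q _ f, of "- c"] neg[OF function_spaceD(3)[OF V f, of "- c"]] by simp
  qed (use sublinear_onD(2,3)[OF q] f in auto)
  with add show ?thesis by (simp add: linear_functional_on_def)
qed

text \<open>
  Zorn's lemma for the reverse pointwise order; the functionals are normalised to vanish outside \<open>V\<close> so
  that the order is antisymmetric.
\<close>

lemma exists_minimal_sublinear:
  assumes V: "function_space V" and p: "sublinear_on V p"
  shows "\<exists>q. sublinear_on V q \<and> (\<forall>f\<in>V. q f \<le> p f) \<and>
    (\<forall>q'. sublinear_on V q' \<longrightarrow> (\<forall>f\<in>V. q' f \<le> q f) \<longrightarrow> (\<forall>f\<in>V. q' f = q f))"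
proof -
  define A where "A = {q. sublinear_on V q \<and> (\<forall>f\<in>V. q f \<le> p f) \<and> (\<forall>f. f \<notin> V \<longrightarrow> q f = 0)}"
  let ?P = "\<lambda>a b. \<forall>f\<in>V. b f \<le> a f"
  have "\<exists>m\<in>A. \<forall>a\<in>A. ?P m a \<longrightarrow> a = m"
  proof (rule predicate_Zorn)
    show "partial_order_on A (relation_of ?P A)"
    proof (rule partial_order_on_relation_ofI)
      fix a b assume *: "a \<in> A" "b \<in> A" "?P a b" "?P b a"
      show "a = b"
      proof
        fix f show "a f = b f"
        proof (cases "f \<in> V")
          case True
          then show ?thesis using *(3,4) by (intro antisym) auto
        next
          case False
          then show ?thesis using *(1,2) by (simp add: A_def)
        qed
      qed
    qed (auto intro: order_trans)
  next
    fix C assume C: "C \<in> Chains (relation_of ?P A)"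
    have CA: "C \<subseteq> A" using C by (auto simp: Chains_def relation_of_def)
    have tot: "?P a b \<or> ?P b a" if "a \<in> C" "b \<in> C" for a b
      using C that by (auto simp: Chains_def relation_of_def)
    have restr: "sublinear_on V (\<lambda>f. if f \<in> V then q f else 0)" if "sublinear_on V q" for q
      using that function_spaceD[OF V] by (auto simp: sublinear_on_def)
    show "\<exists>u\<in>A. \<forall>a\<in>C. ?P a u"
    proof (cases "C = {}")
      case True
      have "(\<lambda>f. if f \<in> V then p f else 0) \<in> A" using restr[OF p] by (auto simp: A_def)
      with True show ?thesis by auto
    next
      case False
      have bdd: "bdd_below ((\<lambda>q. q f) ` C)" if f: "f \<in> V" for f
      proof (rule bdd_belowI2[where m = "- p (\<lambda>x. - f x)"])
        fix q assume "q \<in> C"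
        then have q: "sublinear_on V q" "\<And>f. f \<in> V \<Longrightarrow> q f \<le> p f" using CA by (auto simp: A_def)
        show "- p (\<lambda>x. - f x) \<le> q f"
          using sublinear_on_uminus[OF V q(1) f] q(2)[OF function_spaceD(4)[OF V f]] by linarith
      qed
      have sub: "sublinear_on V (\<lambda>f. INF q\<in>C. q f)"
      proof (rule sublinear_on_INF[OF V False bdd])
        fix a b f g assume *: "a \<in> C" "b \<in> C" "f \<in> V" "g \<in> V"
        have sa: "sublinear_on V a" and sb: "sublinear_on V b" using * CA by (auto simp: A_def)
        show "\<exists>k\<in>C. k (\<lambda>x. f x + g x) \<le> a f + b g"
        proof (cases "?P a b")
          case True
          then have "b (\<lambda>x. f x + g x) \<le> a f + b g"
            using sublinear_onD(1)[OF sb *(3,4)] *(3) by fastforce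
          then show ?thesis using * by blast
        next
          case False
          then have "a g \<le> b g" using tot * by blast
          then have "a (\<lambda>x. f x + g x) \<le> a f + b g"
            using sublinear_onD(1)[OF sa *(3,4)] by linarith
          then show ?thesis using * by blast
        qed
      next
        fix a c f assume *: "a \<in> C" "(0::real) < c" "f \<in> V"
        then have "a (\<lambda>x. c * f x) = c * a f" using CA by (auto simp: A_def sublinear_on_def)
        then show "\<exists>k\<in>C. k (\<lambda>x. c * f x) \<le> c * a f"
          using * by (intro bexI[of _ a]) auto
      next
        have z: "q (\<lambda>_. 0) = 0" if "q \<in> C" for q
          using that CA by (auto simp: A_def sublinear_on_def)
        show "0 \<le> q (\<lambda>_. 0)" if "q \<in> C" for q using z[OF that] by simp
        show "\<exists>i\<in>C. i (\<lambda>_. 0) \<le> 0" 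
        proof -
          obtain a where a: "a \<in> C" using False by blast
          then show ?thesis using z[OF a] by (intro bexI[of _ a]) auto
        qed
      qed
      let ?u = "\<lambda>f. if f \<in> V then INF q\<in>C. q f else 0"
      have le: "(INF q\<in>C. q f) \<le> q f" if "q \<in> C" "f \<in> V" for q f
        using bdd[OF that(2)] that(1) by (rule cINF_lower)
      have "(INF q\<in>C. q f) \<le> p f" if "f \<in> V" for f
      proof -
        obtain q where "q \<in> C" using False by blast
        then have "q f \<le> p f" using CA that by (auto simp: A_def)
        then show ?thesis using le[OF \<open>q \<in> C\<close> that] by linarith
      qed
      then have u: "?u \<in> A" using restr[OF sub] by (auto simp: A_def)
      have "\<forall>a\<in>C. ?P a ?u" using le by simp
      then show ?thesis using u by (rule bexI)
    qed
  qed
  then obtain m where m: "m \<in> A" "\<And>a. a \<in> A \<Longrightarrow> ?P m a \<Longrightarrow> a = m" by blast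
  have "\<forall>f\<in>V. q' f = m f" if q': "sublinear_on V q'" "\<forall>f\<in>V. q' f \<le> m f" for q'
  proof -
    have le: "m f \<le> p f" if "f \<in> V" for f using m(1) that by (auto simp: A_def)
    have "sublinear_on V (\<lambda>f. if f \<in> V then q' f else 0)"
      using q'(1) function_spaceD[OF V] by (auto simp: sublinear_on_def)
    then have "(\<lambda>f. if f \<in> V then q' f else 0) \<in> A"
      using q'(2) le by (auto simp: A_def intro: order_trans)
    from m(2)[OF this] q'(2) have eq: "(\<lambda>f. if f \<in> V then q' f else 0) = m" by simp
    show ?thesis using fun_cong[OF eq] by (metis (full_types))
  qed
  moreover have "sublinear_on V m" "\<forall>f\<in>V. m f \<le> p f" using m(1) by (auto simp: A_def)
  ultimately show ?thesis by blast
qed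

lemma hahn_banach_functions:
  assumes V: "function_space V" and M: "function_space M" "M \<subseteq> V"
    and p: "sublinear_on V p" and l: "linear_functional_on M l"
    and le: "\<And>m. m \<in> M \<Longrightarrow> l m \<le> p m"
  shows "\<exists>L. linear_functional_on V L \<and> (\<forall>f\<in>V. L f \<le> p f) \<and> (\<forall>m\<in>M. L m = l m)"
proof -
  have ladd: "l (\<lambda>x. f x + g x) = l f + l g" if "f \<in> M" "g \<in> M" for f g
    using l that by (auto simp: linear_functional_on_def)
  have lscale: "l (\<lambda>x. c * f x) = c * l f" if "f \<in> M" for c f
    using l that by (auto simp: linear_functional_on_def)
  have lneg: "l (\<lambda>x. - f x) = - l f" if "f \<in> M" for f
    using lscale[OF that, of "-1"] by simp
  have l0: "l (\<lambda>_. 0) = 0" using lscale[OF function_spaceD(1)[OF M(1)], of 0] by simp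
  have inV: "(\<lambda>x. f x + m x) \<in> V" if "f \<in> V" "m \<in> M" for f m
    using that M(2) function_spaceD(2)[OF V] by blast
  \<comment> \<open>A functional below the infimum of these agrees with \<open>l\<close> on \<open>M\<close>, as is seen at \<open>m\<close> and \<open>- m\<close>.\<close>
  define r where "r m f = p (\<lambda>x. f x + m x) - l m" for m f
  have lower: "- p (\<lambda>x. - f x) \<le> r m f" if f: "f \<in> V" and m: "m \<in> M" for f m
  proof -
    have "p (\<lambda>x. (f x + m x) + - f x) \<le> p (\<lambda>x. f x + m x) + p (\<lambda>x. - f x)"
      by (rule sublinear_onD(1)[OF p inV[OF f m] function_spaceD(4)[OF V f]])
    moreover have "(\<lambda>x. (f x + m x) + - f x) = m" by auto
    ultimately show ?thesis using le[OF m] by (simp add: r_def)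
  qed
  have bdd: "bdd_below ((\<lambda>m. r m f) ` M)" if "f \<in> V" for f
    using lower[OF that] by (intro bdd_belowI2[where m = "- p (\<lambda>x. - f x)"]) auto
  have ne: "M \<noteq> {}" using function_spaceD(1)[OF M(1)] by blast
  have sub: "sublinear_on V (\<lambda>f. INF m\<in>M. r m f)"
  proof (rule sublinear_on_INF[OF V ne bdd])
    fix m n f g assume *: "m \<in> M" "n \<in> M" "f \<in> V" "g \<in> V"
    have "r (\<lambda>x. m x + n x) (\<lambda>x. f x + g x) \<le> r m f + r n g"
      using sublinear_onD(1)[OF p inV[OF *(3,1)] inV[OF *(4,2)]] ladd[OF *(1,2)]
      by (simp add: r_def algebra_simps)
    then show "\<exists>k\<in>M. r k (\<lambda>x. f x + g x) \<le> r m f + r n g"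
      using function_spaceD(2)[OF M(1) *(1,2)] by (rule bexI)
  next
    fix m c f assume *: "m \<in> M" "(0::real) < c" "f \<in> V"
    have "r (\<lambda>x. c * m x) (\<lambda>x. c * f x) \<le> c * r m f"
      using sublinear_onD(2)[OF p *(2) inV[OF *(3,1)]] lscale[OF *(1)]
      by (simp add: r_def algebra_simps)
    then show "\<exists>k\<in>M. r k (\<lambda>x. c * f x) \<le> c * r m f"
      using function_spaceD(3)[OF M(1) *(1)] by (rule bexI)
  next
    show "0 \<le> r m (\<lambda>_. 0)" if "m \<in> M" for m using le[OF that] by (simp add: r_def)
    show "\<exists>m\<in>M. r m (\<lambda>_. 0) \<le> 0"
      using function_spaceD(1)[OF M(1)] l0 sublinear_onD(3)[OF p]
      by (intro bexI[of _ "\<lambda>_. 0"]) (auto simp: r_def)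
  qed
  from exists_minimal_sublinear[OF V sub] obtain L where L: "sublinear_on V L"
      "\<And>f. f \<in> V \<Longrightarrow> L f \<le> (INF m\<in>M. r m f)"
    and min: "\<And>q'. sublinear_on V q' \<Longrightarrow> \<forall>f\<in>V. q' f \<le> L f \<Longrightarrow> \<forall>f\<in>V. q' f = L f"
    by blast
  have lin: "linear_functional_on V L"
    using min by (intro minimal_sublinear_linear[OF V L(1)]) auto
  have Lr: "L f \<le> r m f" if "f \<in> V" "m \<in> M" for f m
    using L(2)[OF that(1)] cINF_lower[OF bdd[OF that(1)] that(2)] by linarith
  have "L f \<le> p f" if "f \<in> V" for f
    using Lr[OF that function_spaceD(1)[OF M(1)]] l0 by (simp add: r_def)
  moreover have "L m = l m" if m: "m \<in> M" for m
  proof -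
    have up: "L k \<le> l k" if k: "k \<in> M" for k
      using Lr[OF _ function_spaceD(4)[OF M(1) k], of k] k M(2) lneg[OF k] sublinear_onD(3)[OF p]
      by (auto simp: r_def)
    have "L (\<lambda>x. (-1) * m x) = (-1) * L m"
      using lin m M(2) unfolding linear_functional_on_def by blast
    then have "L (\<lambda>x. - m x) = - L m" by simp
    then show ?thesis using up[OF m] up[OF function_spaceD(4)[OF M(1) m]] lneg[OF m] by linarith
  qed
  ultimately show ?thesis using lin by blast
qed

section \<open>The Choquet boundary\<close>

text \<open>
  The property of a compact space used to construct measures on it: each closed subset is the zero
  set of a continuous function.
\<close>

definition perfectly_normal_on :: "'a::topological_space set \<Rightarrow> bool" where
  "perfectly_normal_on X \<longleftrightarrow> (\<forall>W. closedin (top_of_set X) W \<longrightarrow>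
     (\<exists>h. continuous_on X h \<and> (\<forall>x\<in>X. 0 \<le> h x) \<and> W = {x \<in> X. h x = (0::real)}))"

lemma representing_measure_of_state:
  fixes X :: "'a::topological_space set"
  assumes X: "compact X" "perfectly_normal_on X" and L: "state_on X L"
    and F: "\<And>f. f \<in> F \<Longrightarrow> continuous_on X f"
    and LF: "\<And>f. f \<in> F \<Longrightarrow> L (\<lambda>x. Re (f x)) = Re (f u) \<and> L (\<lambda>x. Im (f x)) = Im (f u)"
  shows "\<exists>\<mu>. representing_measure X F u \<mu> \<and> (\<forall>h. continuous_on X h \<longrightarrow> integral\<^sup>L \<mu> h = L h)"
proof -
  obtain \<mu> where \<mu>: "space \<mu> = X" "sets \<mu> = sets (restrict_space borel X)" "emeasure \<mu> X = 1"
    and int: "\<And>h::'a \<Rightarrow> real. continuous_on X h \<Longrightarrow> integrable \<mu> h \<and> integral\<^sup>L \<mu> h = L h"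
    using riesz_representation[OF X(1) _ L] X(2) unfolding perfectly_normal_on_def by auto
  have "integrable \<mu> f \<and> integral\<^sup>L \<mu> f = f u" if f: "f \<in> F" for f
  proof -
    have c: "continuous_on X (\<lambda>x. Re (f x))" "continuous_on X (\<lambda>x. Im (f x))"
      using F[OF f] by (auto intro!: continuous_intros)
    note i = int[OF c(1)] int[OF c(2)]
    have f_eq: "f = (\<lambda>x. complex_of_real (Re (f x)) + \<i> * complex_of_real (Im (f x)))"
      by (rule ext) (rule complex_eq)
    have "integrable \<mu> (\<lambda>x. complex_of_real (Re (f x)) + \<i> * complex_of_real (Im (f x)))"
      using i by (intro Bochner_Integration.integrable_add integrable_mult_right integrable_of_real) auto
    moreover have "integral\<^sup>L \<mu> (\<lambda>x. complex_of_real (Re (f x)) + \<i> * complex_of_real (Im (f x)))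
      = complex_of_real (Re (f u)) + \<i> * complex_of_real (Im (f u))"
      using i LF[OF f] by (subst Bochner_Integration.integral_add) auto
    ultimately show ?thesis using f_eq complex_eq[of "f u"] by metis
  qed
  then have "representing_measure X F u \<mu>" using \<mu> by (simp add: representing_measure_def)
  then show ?thesis using int by blast
qed

text \<open>
  At a point of the Choquet boundary, evaluation is the only state that extends evaluation on the
  function algebra.
\<close>

lemma state_at_choquet_point:
  fixes X :: "'a::topological_space set"
  assumes X: "compact X" "perfectly_normal_on X" and u: "u \<in> choquet_boundary X F"
    and F: "\<And>f. f \<in> F \<Longrightarrow> continuous_on X f" and L: "state_on X L"
    and LF: "\<And>f. f \<in> F \<Longrightarrow> L (\<lambda>x. Re (f x)) = Re (f u) \<and> L (\<lambda>x. Im (f x)) = Im (f u)"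
    and h: "continuous_on X h"
  shows "L h = h u"
proof -
  have uX: "u \<in> X" and uniq: "\<exists>!\<mu>. representing_measure X F u \<mu>"
    using u by (auto simp: choquet_boundary_def)
  have "state_on X (\<lambda>h. h u)" using uX by (auto simp: state_on_def)
  then obtain \<delta> where \<delta>: "representing_measure X F u \<delta>" "integral\<^sup>L \<delta> h = h u"
    using representing_measure_of_state[OF X _ F, of "\<lambda>h. h u" F u] h by blast
  obtain \<mu> where \<mu>: "representing_measure X F u \<mu>" "integral\<^sup>L \<mu> h = L h"
    using representing_measure_of_state[OF X L F LF] h by blast
  have "\<mu> = \<delta>" using uniq \<mu>(1) \<delta>(1) by blast
  then show ?thesis using \<mu>(2) \<delta>(2) by simp
qed

text \<open>
  Passing from the modulus to the real part: adding a large constant \<open>t\<close> to \<open>f\<close> makes the modulus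
  close to \<open>t + Re f\<close>.
\<close>

lemma Re_le_of_boundary:
  fixes X :: "'a::topological_space set"
  assumes X: "compact X" and E: "E \<subseteq> X" and u: "u \<in> X" and f: "continuous_on X f"
    and bd: "\<And>t::real. 0 < t \<Longrightarrow> \<exists>y\<in>E. \<forall>x\<in>X. cmod (f x + of_real t) \<le> cmod (f y + of_real t)"
    and b: "\<And>y. y \<in> E \<Longrightarrow> Re (f y) \<le> b"
  shows "Re (f u) \<le> b"
proof (rule field_le_epsilon)
  fix e :: real assume e: "0 < e"
  have "bounded (f ` X)" using compact_continuous_image[OF f X] compact_imp_bounded by blast
  then obtain M where M: "M > 0" "\<And>x. x \<in> X \<Longrightarrow> cmod (f x) \<le> M" by (auto simp: bounded_pos)
  \<comment> \<open>For this \<open>t\<close> the modulus of \<open>f y + t\<close> exceeds its real part by at most \<open>e\<close>.\<close>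
  define t where "t = M + M\<^sup>2 / e"
  have t: "0 < t" using M(1) e by (simp add: t_def add_pos_nonneg)
  obtain y where y: "y \<in> E" "\<And>x. x \<in> X \<Longrightarrow> cmod (f x + of_real t) \<le> cmod (f y + of_real t)"
    using bd[OF t] by blast
  have My: "cmod (f y) \<le> M" using M(2) y(1) E by blast
  have pos: "M\<^sup>2 / e \<le> t + Re (f y)" using abs_Re_le_cmod[of "f y"] My by (simp add: t_def)
  have p0: "0 < M\<^sup>2 / e" using M(1) e by simp
  have 1: "(cmod (f y + of_real t))\<^sup>2 = (t + Re (f y))\<^sup>2 + (Im (f y))\<^sup>2"
    by (simp add: cmod_power2 add.commute)
  have 2: "(Im (f y))\<^sup>2 \<le> M\<^sup>2"
    using abs_Im_le_cmod[of "f y"] My M(1) by (simp add: abs_le_square_iff[symmetric])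
  have 3: "M\<^sup>2 \<le> e * (t + Re (f y))" using pos e by (simp add: field_simps)
  have 4: "(t + Re (f y))\<^sup>2 + e * (t + Re (f y)) \<le> (t + Re (f y) + e)\<^sup>2"
    using mult_pos_pos[of e "t + Re (f y)"] pos p0 e by (simp add: power2_eq_square algebra_simps)
  have "(cmod (f y + of_real t))\<^sup>2 \<le> (t + Re (f y) + e)\<^sup>2" using 1 2 3 4 by linarith
  moreover have "0 \<le> t + Re (f y) + e" using pos p0 e by linarith
  ultimately have le: "cmod (f y + of_real t) \<le> t + Re (f y) + e" by (rule power2_le_imp_le)
  have "t + Re (f u) \<le> cmod (f u + of_real t)"
    using complex_Re_le_cmod[of "f u + of_real t"] by simp
  also have "\<dots> \<le> t + Re (f y) + e" using y(2)[OF u] le by linarith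
  finally show "Re (f u) \<le> b + e" using b[OF y(1)] by linarith
qed

lemma closedin_shilov_boundary: "closedin (top_of_set X) (shilov_boundary X F)"
proof -
  let ?K = "{E. closedin (top_of_set X) E \<and> (\<forall>f\<in>F. \<exists>y\<in>E. \<forall>x\<in>X. cmod (f x) \<le> cmod (f y))}"
  have "closedin (top_of_set X) (\<Inter>(insert X ?K))"
    by (intro closedin_Inter) auto
  then show ?thesis unfolding shilov_boundary_def by simp
qed

text \<open>
  Given a closed boundary \<open>E\<close>, a state that extends evaluation at \<open>u\<close> and is dominated by the supremum
  over \<open>E\<close> exists by the Hahn-Banach theorem.  By \<open>state_at_choquet_point\<close> it is evaluation at \<open>u\<close>;
  testing it on a function whose zero set is \<open>E\<close> gives \<open>u \<in> E\<close>.
\<close>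

lemma choquet_subset_shilov:
  fixes X :: "'a::topological_space set"
  assumes X: "compact X" "perfectly_normal_on X"
    and F: "\<And>f. f \<in> F \<Longrightarrow> continuous_on X f"
    and const: "\<And>c. \<exists>h\<in>F. \<forall>x\<in>X. h x = c"
    and add: "\<And>f g. f \<in> F \<Longrightarrow> g \<in> F \<Longrightarrow> \<exists>h\<in>F. \<forall>x\<in>X. h x = f x + g x"
    and scale: "\<And>c f. f \<in> F \<Longrightarrow> \<exists>h\<in>F. \<forall>x\<in>X. h x = c * f x"
  shows "choquet_boundary X F \<subseteq> shilov_boundary X F"
proof
  fix u assume u: "u \<in> choquet_boundary X F"
  then have uX: "u \<in> X" by (simp add: choquet_boundary_def)
  have "u \<in> E" if clE: "closedin (top_of_set X) E"
    and bd: "\<forall>f\<in>F. \<exists>y\<in>E. \<forall>x\<in>X. cmod (f x) \<le> cmod (f y)" for E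
  proof -
    have EX: "E \<subseteq> X" using clE closedin_imp_subset by blast
    have ne: "E \<noteq> {}" using const[of 0] bd by blast
    define V where "V = {h::'a \<Rightarrow> real. continuous_on X h}"
    define M where "M = {m \<in> V. \<exists>f\<in>F. \<forall>x\<in>X. m x = Re (f x)}"
    define p where "p h = (SUP x\<in>E. h x)" for h :: "'a \<Rightarrow> real"
    have V: "function_space V"
      unfolding function_space_def V_def by (auto intro!: continuous_intros)
    have M: "function_space M"
      unfolding function_space_def
    proof (intro conjI ballI allI)
      obtain f where f: "f \<in> F" "\<forall>x\<in>X. f x = 0" using const by blast
      then have "\<exists>f\<in>F. \<forall>x\<in>X. 0 = Re (f x)" by (intro bexI[of _ f]) auto
      then show "(\<lambda>_. 0) \<in> M" using function_spaceD(1)[OF V] by (auto simp: M_def)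
    next
      fix m n assume mn: "m \<in> M" "n \<in> M"
      then obtain f g where "f \<in> F" "g \<in> F" and fg: "\<forall>x\<in>X. m x = Re (f x)" "\<forall>x\<in>X. n x = Re (g x)"
        by (auto simp: M_def)
      then obtain k where "k \<in> F" "\<forall>x\<in>X. k x = f x + g x" using add by blast
      then have "\<exists>f\<in>F. \<forall>x\<in>X. m x + n x = Re (f x)" using fg by (intro bexI[of _ k]) auto
      then show "(\<lambda>x. m x + n x) \<in> M" using mn function_spaceD(2)[OF V] by (auto simp: M_def)
    next
      fix c m assume m: "m \<in> M"
      then obtain f where "f \<in> F" and f: "\<forall>x\<in>X. m x = Re (f x)" by (auto simp: M_def)
      then obtain k where "k \<in> F" "\<forall>x\<in>X. k x = of_real c * f x" using scale by blast
      then have "\<exists>f\<in>F. \<forall>x\<in>X. c * m x = Re (f x)" using f by (intro bexI[of _ k]) auto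
      then show "(\<lambda>x. c * m x) \<in> M" using m function_spaceD(3)[OF V] by (auto simp: M_def)
    qed
    have bddE: "bdd_above (h ` E)" if "h \<in> V" for h
    proof -
      have "bounded (h ` X)"
        using that compact_continuous_image[OF _ X(1)] compact_imp_bounded by (auto simp: V_def)
      then show ?thesis using EX by (meson bounded_imp_bdd_above bounded_subset image_mono)
    qed
    have p_upper: "h x \<le> p h" if "h \<in> V" "x \<in> E" for h x
      unfolding p_def using that(2) bddE[OF that(1)] by (rule cSUP_upper)
    have p_least: "p h \<le> c" if "\<And>x. x \<in> E \<Longrightarrow> h x \<le> c" for h c
      unfolding p_def using ne that by (rule cSUP_least)
    have p: "sublinear_on V p"
      unfolding sublinear_on_def
    proof (intro conjI ballI allI impI)
      show "p (\<lambda>x. f x + g x) \<le> p f + p g" if "f \<in> V" "g \<in> V" for f g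
        using p_upper that by (intro p_least add_mono)
      show "p (\<lambda>x. c * f x) = c * p f" if c: "0 < c" and f: "f \<in> V" for c f
      proof (rule antisym)
        show "p (\<lambda>x. c * f x) \<le> c * p f"
          using p_upper[OF f] c by (intro p_least) simp
        have "p f \<le> p (\<lambda>x. c * f x) / c"
        proof (rule p_least)
          fix x assume "x \<in> E"
          from p_upper[OF function_spaceD(3)[OF V f] this, of c]
          show "f x \<le> p (\<lambda>x. c * f x) / c" using c by (simp add: field_simps)
        qed
        then show "c * p f \<le> p (\<lambda>x. c * f x)" using c by (simp add: field_simps)
      qed
      show "p (\<lambda>_. 0) = 0" using ne by (simp add: p_def)
    qed
    have le: "m u \<le> p m" if m: "m \<in> M" for m
    proof -
      obtain f where f: "f \<in> F" "\<forall>x\<in>X. m x = Re (f x)" using m by (auto simp: M_def)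
      have "Re (f u) \<le> p m"
      proof (rule Re_le_of_boundary[OF X(1) EX uX F[OF f(1)]])
        fix t :: real
        obtain c where c: "c \<in> F" "\<forall>x\<in>X. c x = of_real t" using const by blast
        obtain k where k: "k \<in> F" "\<forall>x\<in>X. k x = f x + c x" using add[OF f(1) c(1)] by blast
        obtain y where "y \<in> E" "\<forall>x\<in>X. cmod (k x) \<le> cmod (k y)" using bd k(1) by blast
        then show "\<exists>y\<in>E. \<forall>x\<in>X. cmod (f x + of_real t) \<le> cmod (f y + of_real t)"
          using k(2) c(2) EX by (intro bexI[of _ y]) auto
      next
        fix y assume "y \<in> E"
        then show "Re (f y) \<le> p m" using p_upper[of m y] f(2) m EX by (auto simp: M_def)
      qed
      then show ?thesis using f(2) uX by simp
    qed
    have "linear_functional_on M (\<lambda>m. m u)" by (simp add: linear_functional_on_def)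
    from hahn_banach_functions[OF V M _ p this le] obtain L
      where L: "linear_functional_on V L" "\<And>f. f \<in> V \<Longrightarrow> L f \<le> p f" "\<And>m. m \<in> M \<Longrightarrow> L m = m u"
      by (auto simp: M_def)
    have "state_on X L"
      unfolding state_on_def
    proof (intro conjI allI impI)
      show "L (\<lambda>_. 1) = 1"
      proof -
        obtain f where f: "f \<in> F" "\<forall>x\<in>X. f x = 1" using const by blast
        then have "\<exists>f\<in>F. \<forall>x\<in>X. 1 = Re (f x)" by (intro bexI[of _ f]) auto
        then have "(\<lambda>_. 1) \<in> M" by (simp add: M_def V_def)
        then show ?thesis using L(3) by simp
      qed
      fix f :: "'a \<Rightarrow> real" assume f: "continuous_on X f" and nn: "\<forall>x\<in>X. 0 \<le> f x"
      have "L (\<lambda>x. (-1) * f x) = (-1) * L f"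
        using L(1) f unfolding linear_functional_on_def V_def by blast
      moreover have "L (\<lambda>x. (-1) * f x) \<le> p (\<lambda>x. (-1) * f x)"
        using f by (intro L(2)) (auto simp: V_def intro!: continuous_intros)
      moreover have "p (\<lambda>x. (-1) * f x) \<le> 0" using nn EX by (intro p_least) auto
      ultimately show "0 \<le> L f" by simp
    qed (use L(1) in \<open>auto simp: linear_functional_on_def V_def\<close>)
    moreover have "L (\<lambda>x. Re (f x)) = Re (f u) \<and> L (\<lambda>x. Im (f x)) = Im (f u)" if f: "f \<in> F" for f
    proof -
      obtain k where k: "k \<in> F" "\<forall>x\<in>X. k x = - \<i> * f x" using scale[OF f] by blast
      have c: "continuous_on X (\<lambda>x. Re (f x))" "continuous_on X (\<lambda>x. Im (f x))"
        using F[OF f] by (auto intro!: continuous_intros)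
      have "\<exists>k\<in>F. \<forall>x\<in>X. Im (f x) = Re (k x)" using k by (intro bexI[of _ k]) auto
      then have "(\<lambda>x. Re (f x)) \<in> M" "(\<lambda>x. Im (f x)) \<in> M"
        unfolding M_def V_def using c f by auto
      then show ?thesis using L(3) by blast
    qed
    ultimately have Lh: "L h = h u" if "continuous_on X h" for h
      using state_at_choquet_point[OF X u F _ _ that] by blast
    obtain h where h: "continuous_on X h" "\<forall>x\<in>X. 0 \<le> h x" "E = {x \<in> X. h x = (0::real)}"
      using X(2) clE unfolding perfectly_normal_on_def by blast
    have "h u \<le> p h" using Lh[OF h(1)] L(2)[of h] h(1) by (simp add: V_def)
    also have "p h \<le> 0" using h(3) by (intro p_least) auto
    finally show "u \<in> E" using h uX by (auto intro: antisym)
  qed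
  then show "u \<in> shilov_boundary X F" using uX by (auto simp: shilov_boundary_def)
qed

section \<open>Complex matrices\<close>

lemma mat_star_nth [simp]: "mat_star A $ i $ j = cnj (A $ j $ i)"
  by (simp add: mat_star_def)

lemma mat_star_star [simp]: "mat_star (mat_star A) = A"
  by (simp add: vec_eq_iff)

lemma mat_star_add: "mat_star (A + B) = mat_star A + mat_star B"
  by (simp add: vec_eq_iff)

lemma mat_star_mult: "mat_star (A ** B) = mat_star B ** mat_star A"
  by (simp add: vec_eq_iff matrix_matrix_mult_def mult.commute)

lemma mat_star_mat [simp]: "mat_star (mat c) = mat (cnj c)"
  by (simp add: vec_eq_iff mat_def)

lemma mat_scale_nth: "(mat c ** A) $ i $ j = c * A $ i $ j"
  by (simp add: matrix_matrix_mult_def mat_def if_distrib if_distribR sum.delta cong: if_cong)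

lemma mat_mult_nth: "(A ** mat c) $ i $ j = A $ i $ j * c"
  for A :: "'a::semiring_1^'n^'m"
  by (simp add: matrix_matrix_mult_def mat_def if_distrib if_distribR sum.delta' cong: if_cong)

lemma mat_commute: "mat c ** A = A ** mat c" for A :: "complex^'n^'n"
  by (simp add: vec_eq_iff mat_scale_nth mat_mult_nth mult.commute)

lemma mat_mult_mat: "mat a ** mat b = (mat (a * b) :: complex^'n^'n)"
  by (simp add: vec_eq_iff mat_scale_nth) (simp add: mat_def)

lemma mat_scale_scale: "mat a ** (mat b ** A) = mat (a * b) ** A" for A :: "complex^'n^'n"
  by (simp add: vec_eq_iff mat_scale_nth)

lemma mat_scale_mult_right: "A ** (mat c ** B) = mat c ** (A ** B)" for A B :: "complex^'n^'n"
  by (metis mat_commute matrix_mul_assoc)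

lemma mat_zero [simp]: "mat 0 = (0 :: complex^'n^'n)"
  by (simp add: vec_eq_iff mat_def)

lemma mat_add: "mat (a + b) = (mat a + mat b :: complex^'n^'n)"
  by (simp add: vec_eq_iff mat_def)

lemma mat_minus_one: "mat (-1) ** A = - A" for A :: "complex^'n^'n"
  by (simp add: vec_eq_iff mat_scale_nth)

lemma matrix_mult_minus: "A ** - B = - (A ** B)" "- A ** B = - (A ** B)"
  for A B :: "complex^'n^'n"
  by (simp_all add: vec_eq_iff matrix_matrix_mult_def sum_negf)

lemma mat_star_scale: "mat_star (mat c ** A) = mat (cnj c) ** mat_star A" for A :: "complex^'n^'n"
  by (simp only: mat_star_mult mat_star_mat mat_commute)

lemma mat_scale_vec: "(mat c ** A) *v v = c *s (A *v v)" for A :: "complex^'n^'n"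
  by (simp add: vec_eq_iff matrix_vector_mult_def mat_scale_nth sum_distrib_left mult.assoc)

lemma matrix_add_rdistrib: "(A + B) ** C = A ** C + B ** C" for A B C :: "complex^'n^'n"
  by (simp add: vec_eq_iff matrix_matrix_mult_def sum.distrib distrib_right)

lemma mat_scale_add_left: "mat (a + b) ** A = mat a ** A + mat b ** A" for A :: "complex^'n^'n"
  by (simp add: mat_add matrix_add_rdistrib)

lemma norm_vector_scale: "norm (c *s v) = cmod c * norm v" for v :: "complex^'n"
proof -
  have "L2_set (\<lambda>i. cmod c * norm (v $ i)) UNIV = cmod c * L2_set (\<lambda>i. norm (v $ i)) UNIV"
    by (intro L2_set_right_distrib[symmetric]) simp
  then show ?thesis by (simp add: norm_vec_def norm_mult)
qed

lemma sum_mat_scale: "(\<Sum>t\<in>T. mat (c t) ** C) = mat (\<Sum>t\<in>T. c t) ** C" for C :: "complex^'n^'n"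
  by (induction T rule: infinite_finite_induct) (simp_all add: mat_scale_add_left)

lemma mat_scale_diff: "mat c ** (C - D) = mat c ** C - mat c ** D" for C D :: "complex^'n^'n"
  by (simp add: vec_eq_iff mat_scale_nth algebra_simps)

lemma mat_diff: "mat (a - b) = (mat a - mat b :: complex^'n^'n)"
  by (simp add: vec_eq_iff mat_def)

subsection \<open>The inner product\<close>

lemma cinner_add_left: "cinner (v + w) x = cinner v x + cinner w x"
  by (simp add: cinner_def sum.distrib algebra_simps)

lemma cinner_add_right: "cinner x (v + w) = cinner x v + cinner x w"
  by (simp add: cinner_def sum.distrib algebra_simps)

lemma cinner_scale_left: "cinner (c *s v) w = c * cinner v w"
  by (simp add: cinner_def sum_distrib_left mult.assoc)

lemma cinner_scale_right: "cinner v (c *s w) = cnj c * cinner v w"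
  by (simp add: cinner_def sum_distrib_left algebra_simps)

lemma cinner_zero [simp]: "cinner 0 w = 0" "cinner v 0 = 0"
  by (simp_all add: cinner_def)

lemma cinner_self: "cinner v v = of_real ((norm v)\<^sup>2)"
proof -
  have "(norm v)\<^sup>2 = (\<Sum>i\<in>UNIV. (cmod (v $ i))\<^sup>2)"
    by (simp add: norm_vec_def L2_set_def sum_nonneg)
  then show ?thesis by (simp add: cinner_def complex_norm_square[symmetric])
qed

lemma cinner_mat_star: "cinner (mat_star A *v v) w = cinner v (A *v w)"
proof -
  have "cinner (mat_star A *v v) w = (\<Sum>i\<in>UNIV. \<Sum>j\<in>UNIV. cnj (A $ j $ i) * v $ j * cnj (w $ i))"
    by (simp add: cinner_def matrix_vector_mult_def sum_distrib_right)
  also have "\<dots> = (\<Sum>j\<in>UNIV. \<Sum>i\<in>UNIV. cnj (A $ j $ i) * v $ j * cnj (w $ i))"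
    by (rule sum.swap)
  also have "\<dots> = cinner v (A *v w)"
    by (simp add: cinner_def matrix_vector_mult_def sum_distrib_left algebra_simps)
  finally show ?thesis .
qed

lemma norm_cinner_le: "cmod (cinner v w) \<le> norm v * norm w"
proof -
  have "cmod (cinner v w) \<le> (\<Sum>i\<in>UNIV. cmod (v $ i) * cmod (w $ i))"
    unfolding cinner_def by (rule order_trans[OF norm_sum]) (simp add: norm_mult)
  also have "\<dots> = (\<Sum>i\<in>UNIV. \<bar>cmod (v $ i)\<bar> * \<bar>cmod (w $ i)\<bar>)" by simp
  also have "\<dots> \<le> L2_set (\<lambda>i. cmod (v $ i)) UNIV * L2_set (\<lambda>i. cmod (w $ i)) UNIV"
    by (rule L2_set_mult_ineq)
  finally show ?thesis by (simp add: norm_vec_def)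
qed

lemma cinner_eq_zero_iff: "(\<forall>v w. cinner (T *v v) w = 0) \<longleftrightarrow> T = 0" for T :: "complex^'n^'n"
proof
  assume *: "\<forall>v w. cinner (T *v v) w = 0"
  have "T *v v = 0" for v
    using *[rule_format, of v "T *v v"] by (simp add: cinner_self)
  then show "T = 0" by (simp add: matrix_eq)
qed simp

subsection \<open>The operator norm\<close>

text \<open>
  The norm of a matrix as an operator on the Hermitian space; the norm of the type \<^typ>\<open>complex^'n^'n\<close>
  is the Hilbert-Schmidt norm.
\<close>

definition opnorm :: "complex^'n^'n \<Rightarrow> real" where
  "opnorm A = onorm (\<lambda>v. A *v v)"

lemma bounded_linear_mat: "bounded_linear (\<lambda>v. A *v v)" for A :: "complex^'n^'n"
  using matrix_vector_mul_bounded_linear by blast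

lemma opnorm_bound: "norm (A *v v) \<le> opnorm A * norm v"
  unfolding opnorm_def by (rule onorm[OF bounded_linear_mat])

lemma opnorm_le: "(\<And>v. norm (A *v v) \<le> b * norm v) \<Longrightarrow> opnorm A \<le> b"
  unfolding opnorm_def by (rule onorm_le)

lemma opnorm_nonneg: "0 \<le> opnorm A"
  unfolding opnorm_def by (rule onorm_pos_le[OF bounded_linear_mat])

lemma opnorm_add: "opnorm (A + B) \<le> opnorm A + opnorm B"
proof (rule opnorm_le)
  fix v
  have "norm ((A + B) *v v) \<le> norm (A *v v) + norm (B *v v)"
    by (simp add: matrix_vector_mult_add_rdistrib norm_triangle_ineq)
  also have "\<dots> \<le> opnorm A * norm v + opnorm B * norm v"
    by (intro add_mono opnorm_bound)
  finally show "norm ((A + B) *v v) \<le> (opnorm A + opnorm B) * norm v" by (simp add: distrib_right)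
qed

lemma opnorm_mult: "opnorm (A ** B) \<le> opnorm A * opnorm B"
proof (rule opnorm_le)
  fix v
  have "norm ((A ** B) *v v) \<le> opnorm A * norm (B *v v)"
    by (simp add: opnorm_bound flip: matrix_vector_mul_assoc)
  also have "\<dots> \<le> opnorm A * (opnorm B * norm v)"
    by (intro mult_left_mono opnorm_bound opnorm_nonneg)
  finally show "norm ((A ** B) *v v) \<le> opnorm A * opnorm B * norm v" by (simp add: mult.assoc)
qed

lemma opnorm_zero [simp]: "opnorm (0 :: complex^'n^'n) = 0"
  using opnorm_le[of "0::complex^'n^'n" 0] opnorm_nonneg[of "0::complex^'n^'n"] by simp

lemma opnorm_scale: "opnorm (mat c ** A) = cmod c * opnorm A"
proof (cases "c = 0")
  case False
  have le: "opnorm (mat c ** A) \<le> cmod c * opnorm A" for c and A :: "complex^'n^'n"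
  proof (rule opnorm_le)
    fix v
    show "norm ((mat c ** A) *v v) \<le> cmod c * opnorm A * norm v"
      using mult_left_mono[OF opnorm_bound[of A v], of "cmod c"]
      by (simp add: mat_scale_vec norm_vector_scale mult.assoc)
  qed
  have "opnorm (mat (inverse c) ** (mat c ** A)) \<le> cmod (inverse c) * opnorm (mat c ** A)"
    by (rule le)
  then have "cmod c * opnorm A \<le> opnorm (mat c ** A)"
    using False by (simp add: mat_scale_scale norm_divide field_simps)
  then show ?thesis using le[of c A] by simp
qed simp

lemma opnorm_star_le: "opnorm (mat_star A) \<le> opnorm A"
proof (rule opnorm_le)
  fix v
  let ?w = "mat_star A *v v"
  have "(norm ?w)\<^sup>2 = cmod (cinner ?w ?w)" by (simp only: cinner_self norm_of_real) simp
  also have "\<dots> = cmod (cinner v (A *v ?w))" by (simp add: cinner_mat_star)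
  also have "\<dots> \<le> norm v * norm (A *v ?w)" by (rule norm_cinner_le)
  also have "\<dots> \<le> norm v * (opnorm A * norm ?w)" by (intro mult_left_mono opnorm_bound) simp
  finally show "norm ?w \<le> opnorm A * norm v"
    by (cases "norm ?w = 0") (auto simp: power2_eq_square opnorm_nonneg algebra_simps)
qed

lemma opnorm_star: "opnorm (mat_star A) = opnorm A"
  using opnorm_star_le[of A] opnorm_star_le[of "mat_star A"] by simp

lemma opnorm_star_mult: "opnorm (mat_star A ** A) = (opnorm A)\<^sup>2"
proof (rule antisym)
  show "opnorm (mat_star A ** A) \<le> (opnorm A)\<^sup>2"
    using opnorm_mult[of "mat_star A" A] by (simp add: opnorm_star power2_eq_square)
  have "opnorm A \<le> sqrt (opnorm (mat_star A ** A))"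
  proof (rule opnorm_le)
    fix v
    have "(norm (A *v v))\<^sup>2 = cmod (cinner (A *v v) (A *v v))" by (simp only: cinner_self norm_of_real) simp
    also have "\<dots> = cmod (cinner ((mat_star A ** A) *v v) v)"
      by (simp add: cinner_mat_star flip: matrix_vector_mul_assoc)
    also have "\<dots> \<le> norm ((mat_star A ** A) *v v) * norm v" by (rule norm_cinner_le)
    also have "\<dots> \<le> (opnorm (mat_star A ** A) * norm v) * norm v"
      by (intro mult_right_mono opnorm_bound) simp
    also have "\<dots> = (sqrt (opnorm (mat_star A ** A)) * norm v)\<^sup>2"
      by (simp add: power_mult_distrib opnorm_nonneg power2_eq_square)
    finally show "norm (A *v v) \<le> sqrt (opnorm (mat_star A ** A)) * norm v"
      by (rule power2_le_imp_le) (simp add: opnorm_nonneg)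
  qed
  then show "(opnorm A)\<^sup>2 \<le> opnorm (mat_star A ** A)"
    by (metis opnorm_nonneg real_sqrt_le_iff real_sqrt_pow2 power_mono)
qed

lemma opnorm_one: "opnorm (mat 1 :: complex^'n^'n) = 1"
proof -
  have "opnorm (mat 1 :: complex^'n^'n) = (opnorm (mat 1 :: complex^'n^'n))\<^sup>2"
    using opnorm_star_mult[of "mat 1 :: complex^'n^'n"] by simp
  moreover have "opnorm (mat 1 :: complex^'n^'n) \<noteq> 0"
  proof
    assume "opnorm (mat 1 :: complex^'n^'n) = 0"
    then have "norm (axis undefined 1 :: complex^'n) \<le> 0"
      using opnorm_bound[of "mat 1" "axis undefined 1 :: complex^'n"] by simp
    then show False by simp
  qed
  ultimately have "opnorm (mat 1 :: complex^'n^'n) = 1" by (simp add: power2_eq_square)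
  then show ?thesis .
qed

lemma opnorm_mat: "opnorm (mat c :: complex^'n^'n) = cmod c"
  using opnorm_scale[of c "mat 1 :: complex^'n^'n"] by (simp add: opnorm_one)

lemma opnorm_sum: "opnorm (\<Sum>t\<in>T. C t) \<le> (\<Sum>t\<in>T. opnorm (C t))"
proof (induction T rule: infinite_finite_induct)
  case (insert t T)
  then show ?case using opnorm_add[of "C t" "\<Sum>t\<in>T. C t"] by simp
qed simp_all

lemma norm_entry_le_opnorm: "cmod (A $ i $ j) \<le> opnorm A"
proof -
  have "cmod (A $ i $ j) = cmod ((A *v axis j 1) $ i)"
    by (simp add: matrix_vector_mult_def axis_def if_distrib cong: if_cong)
  also have "\<dots> \<le> norm (A *v axis j 1)" by (rule Finite_Cartesian_Product.norm_nth_le)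
  also have "\<dots> \<le> opnorm A" using opnorm_bound[of A "axis j 1"] by simp
  finally show ?thesis .
qed

lemma norm_le_opnorm: "norm A \<le> real (CARD('n) * CARD('n)) * opnorm A" for A :: "complex^'n^'n"
proof -
  have "norm A \<le> (\<Sum>i\<in>UNIV. norm (A $ i))" by (simp add: norm_vec_def L2_set_le_sum)
  also have "\<dots> \<le> (\<Sum>i\<in>(UNIV::'n set). \<Sum>j\<in>(UNIV::'n set). cmod (A $ i $ j))"
    by (intro sum_mono) (simp add: norm_vec_def L2_set_le_sum)
  also have "\<dots> \<le> (\<Sum>i\<in>(UNIV::'n set). \<Sum>j\<in>(UNIV::'n set). opnorm A)"
    by (intro sum_mono norm_entry_le_opnorm)
  finally show ?thesis by simp
qed

lemma opnorm_eq_0: "opnorm A = 0 \<longleftrightarrow> A = 0"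
  using norm_le_opnorm[of A] by auto

lemma norm_mat_vec_le: "norm (A *v v) \<le> norm A * norm v" for A :: "complex^'n^'n"
proof -
  have "cmod ((A *v v) $ i) \<le> norm (A $ i) * norm v" for i
  proof -
    have "(A *v v) $ i = cinner (A $ i) (\<chi> j. cnj (v $ j))"
      by (simp add: matrix_vector_mult_def cinner_def)
    moreover have "norm (\<chi> j. cnj (v $ j)) = norm v" by (simp add: norm_vec_def)
    ultimately show ?thesis using norm_cinner_le[of "A $ i" "\<chi> j. cnj (v $ j)"] by simp
  qed
  then have "norm (A *v v) \<le> L2_set (\<lambda>i. norm (A $ i) * norm v) UNIV"
    unfolding norm_vec_def[of "A *v v"] by (intro L2_set_mono) auto
  also have "\<dots> = norm A * norm v"
    unfolding norm_vec_def[of A] by (simp add: L2_set_left_distrib)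
  finally show ?thesis .
qed

lemma opnorm_minus_commute: "opnorm (C - D) = opnorm (D - C)"
  using opnorm_scale[of "-1" "C - D"] by (simp add: mat_minus_one)

lemma opnorm_le_norm: "opnorm A \<le> norm A"
  by (rule opnorm_le) (rule norm_mat_vec_le)

lemma opnorm_diff_le: "\<bar>opnorm A - opnorm B\<bar> \<le> opnorm (A - B)"
proof -
  have "opnorm (B - A) = opnorm (A - B)" using opnorm_scale[of "-1" "A - B"] by (simp add: mat_minus_one)
  then show ?thesis using opnorm_add[of "A - B" B] opnorm_add[of "B - A" A] by simp
qed

lemma continuous_on_opnorm [continuous_intros]:
  assumes "continuous_on S f" shows "continuous_on S (\<lambda>x. opnorm (f x))"
proof -
  have "1-lipschitz_on UNIV (opnorm :: complex^'n^'n \<Rightarrow> real)"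
    using order_trans[OF opnorm_diff_le opnorm_le_norm]
    by (intro lipschitz_onI) (auto simp: dist_norm)
  then have "continuous_on UNIV (opnorm :: complex^'n^'n \<Rightarrow> real)"
    by (rule lipschitz_on_continuous_on)
  then show ?thesis using assms by (rule continuous_on_compose2) auto
qed

lemma continuous_on_matrix_mult [continuous_intros]:
  fixes f g :: "'a::topological_space \<Rightarrow> complex^'n^'n"
  assumes "continuous_on S f" "continuous_on S g"
  shows "continuous_on S (\<lambda>x. f x ** g x)"
  unfolding matrix_matrix_mult_def using assms by (auto intro!: continuous_intros)

lemma continuous_on_mat_star [continuous_intros]:
  fixes f :: "'a::topological_space \<Rightarrow> complex^'n^'n"
  assumes "continuous_on S f"
  shows "continuous_on S (\<lambda>x. mat_star (f x))"
  unfolding mat_star_def using assms by (auto intro!: continuous_intros)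

lemma continuous_on_mat [continuous_intros]:
  assumes "continuous_on S f"
  shows "continuous_on S (\<lambda>x. mat (f x) :: complex^'n^'n)"
proof -
  have "continuous_on S (\<lambda>x. if i = j then f x else 0)" for i j :: 'n
    using assms by (cases "i = j") auto
  then show ?thesis unfolding mat_def by (intro continuous_intros)
qed

subsection \<open>Conjugation by unitary matrices\<close>

lemma matrix_inv_unique:
  fixes A B :: "complex^'n^'n"
  assumes "A ** B = mat 1" "B ** A = mat 1"
  shows "matrix_inv A = B"
proof -
  have "A ** matrix_inv A = mat 1 \<and> matrix_inv A ** A = mat 1"
    unfolding matrix_inv_def by (rule someI_ex) (use assms in blast)
  then have right: "A ** matrix_inv A = mat 1" by simp
  have "matrix_inv A = (B ** A) ** matrix_inv A" using assms(2) by simp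
  also have "\<dots> = B ** (A ** matrix_inv A)" by (rule matrix_mul_assoc[symmetric])
  finally show ?thesis using right by simp
qed

lemma unitary_mat_inv: "unitary_mat k \<Longrightarrow> matrix_inv k = mat_star k"
  unfolding unitary_mat_def by (intro matrix_inv_unique) auto

lemma invertible_matrix_inv_right: "invertible k \<Longrightarrow> k ** matrix_inv k = mat 1"
  for k :: "complex^'n^'n"
  unfolding invertible_def matrix_inv_def by (rule someI2_ex) auto

lemma unitary_mat_invertible: "unitary_mat k \<Longrightarrow> invertible k"
  unfolding unitary_mat_def invertible_def by blast

lemma unitary_mat_one [simp]: "unitary_mat (mat 1)"
  by (simp add: unitary_mat_def)

lemma unitary_mat_star: "unitary_mat k \<Longrightarrow> unitary_mat (mat_star k)"
  by (simp add: unitary_mat_def)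

lemma unitary_mat_mult: "unitary_mat k \<Longrightarrow> unitary_mat l \<Longrightarrow> unitary_mat (k ** l)"
proof -
  assume k: "unitary_mat k" and l: "unitary_mat l"
  have "mat_star (k ** l) ** (k ** l) = mat_star l ** (mat_star k ** k) ** l"
    by (simp add: mat_star_mult matrix_mul_assoc)
  moreover have "(k ** l) ** mat_star (k ** l) = k ** (l ** mat_star l) ** mat_star k"
    by (simp add: mat_star_mult matrix_mul_assoc)
  ultimately show ?thesis using k l by (simp add: unitary_mat_def)
qed

lemma mat_conj_unitary: "unitary_mat k \<Longrightarrow> mat_conj A k = mat_star k ** A ** k"
  by (simp add: mat_conj_def unitary_mat_inv)

lemma opnorm_unitary: "unitary_mat k \<Longrightarrow> opnorm k = 1"
proof -
  assume "unitary_mat k"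
  then have "(opnorm k)\<^sup>2 = 1" using opnorm_star_mult[of k] by (simp add: unitary_mat_def opnorm_one)
  then show ?thesis using opnorm_nonneg[of k] by (simp add: power2_eq_1_iff)
qed

lemma mat_conj_one [simp]: "mat_conj A (mat 1) = A"
  by (simp add: mat_conj_unitary)

lemma mat_conj_conj: "unitary_mat k \<Longrightarrow> unitary_mat l \<Longrightarrow> mat_conj (mat_conj A k) l = mat_conj A (k ** l)"
  by (simp add: mat_conj_unitary unitary_mat_mult mat_star_mult matrix_mul_assoc)

lemma mat_conj_add: "unitary_mat k \<Longrightarrow> mat_conj (A + B) k = mat_conj A k + mat_conj B k"
  by (simp add: mat_conj_unitary matrix_add_ldistrib matrix_add_rdistrib)

lemma mat_conj_mult_invertible: "invertible k \<Longrightarrow> mat_conj (A ** B) k = mat_conj A k ** mat_conj B k"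
proof -
  assume k: "invertible k"
  have "mat_conj A k ** mat_conj B k = matrix_inv k ** A ** (k ** matrix_inv k) ** B ** k"
    by (simp add: mat_conj_def matrix_mul_assoc)
  then show ?thesis using k by (simp add: mat_conj_def invertible_matrix_inv_right matrix_mul_assoc)
qed

lemma mat_conj_mult: "unitary_mat k \<Longrightarrow> mat_conj (A ** B) k = mat_conj A k ** mat_conj B k"
  by (simp add: mat_conj_mult_invertible unitary_mat_invertible)

lemma mat_conj_mat: "unitary_mat k \<Longrightarrow> mat_conj (mat c) k = mat c"
proof -
  assume k: "unitary_mat k"
  have "mat_star k ** mat c ** k = mat c ** (mat_star k ** k)"
    by (simp only: mat_commute matrix_mul_assoc[symmetric])
  then show ?thesis using k by (simp add: mat_conj_unitary unitary_mat_def)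
qed

lemma mat_conj_star: "unitary_mat k \<Longrightarrow> mat_conj (mat_star A) k = mat_star (mat_conj A k)"
  by (simp add: mat_conj_unitary mat_star_mult matrix_mul_assoc)

lemma opnorm_conj: "unitary_mat k \<Longrightarrow> opnorm (mat_conj A k) = opnorm A"
proof -
  have le: "opnorm (mat_conj A k) \<le> opnorm A" if k: "unitary_mat k" for A k :: "complex^'n^'n"
  proof -
    have "opnorm (mat_conj A k) \<le> opnorm (mat_star k) * opnorm A * opnorm k"
      unfolding mat_conj_unitary[OF k]
      by (intro order_trans[OF opnorm_mult] mult_right_mono opnorm_mult opnorm_nonneg)
    then show ?thesis by (simp add: opnorm_star opnorm_unitary[OF k])
  qed
  assume k: "unitary_mat k"
  have "mat_conj (mat_conj A k) (mat_star k) = A"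
    using k by (simp add: mat_conj_conj unitary_mat_star) (simp add: unitary_mat_def)
  then show ?thesis using le[OF k, of A] le[OF unitary_mat_star[OF k], of "mat_conj A k"] by simp
qed

lemma tuple_conj_nth: "tuple_conj z k $ i = mat_conj (z $ i) k"
  by (simp add: tuple_conj_def)

lemma tuple_conj_one [simp]: "tuple_conj z (mat 1) = z"
  by (simp add: vec_eq_iff[of "tuple_conj z (mat 1)" z] tuple_conj_nth)

lemma tuple_conj_conj:
  "unitary_mat k \<Longrightarrow> unitary_mat l \<Longrightarrow> tuple_conj (tuple_conj z k) l = tuple_conj z (k ** l)"
  by (simp add: vec_eq_iff[of "tuple_conj (tuple_conj z k) l"] tuple_conj_nth mat_conj_conj)

lemma compact_unitary: "compact {k :: complex^'n^'n. unitary_mat k}"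
  unfolding compact_eq_bounded_closed
proof
  show "bounded {k :: complex^'n^'n. unitary_mat k}"
    unfolding bounded_iff
  proof (intro exI ballI)
    fix k :: "complex^'n^'n" assume "k \<in> {k. unitary_mat k}"
    then show "norm k \<le> real (CARD('n) * CARD('n))"
      using norm_le_opnorm[of k] by (simp add: opnorm_unitary)
  qed
  have "closed ({k :: complex^'n^'n. mat_star k ** k = mat 1} \<inter> {k. k ** mat_star k = mat 1})"
    by (intro closed_Int closed_Collect_eq continuous_intros)
  then show "closed {k :: complex^'n^'n. unitary_mat k}"
    by (simp add: unitary_mat_def Collect_conj_eq)
qed

lemma mat_conj_scale: "unitary_mat k \<Longrightarrow> mat c ** mat_conj A k = mat_conj (mat c ** A) k"
  by (simp add: mat_conj_mult mat_conj_mat)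

text \<open>
  A matrix divided by the square root of its operator norm.  The convention \<open>inverse 0 = 0\<close> gives the
  value 0 at 0, where the map is continuous because \<open>\<parallel>root_part C\<parallel> = \<parallel>C\<parallel>\<^sup>1\<^sup>/\<^sup>2\<close>.
\<close>

definition root_part :: "complex^'n^'n \<Rightarrow> complex^'n^'n" where
  "root_part C = mat (complex_of_real (inverse (sqrt (opnorm C)))) ** C"

lemma root_part_mult: "mat (complex_of_real (sqrt (opnorm C))) ** root_part C = C"
proof (cases "C = 0")
  case False
  then have "opnorm C \<noteq> 0" by (simp add: opnorm_eq_0)
  then show ?thesis by (simp add: root_part_def mat_scale_scale flip: of_real_mult)
qed (simp add: root_part_def)

lemma opnorm_root_part: "opnorm (root_part C) = sqrt (opnorm C)"
proof (cases "C = 0")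
  case False
  then have "0 < opnorm C" using opnorm_nonneg[of C] opnorm_eq_0[of C] by linarith
  then have "inverse (sqrt (opnorm C)) * opnorm C = sqrt (opnorm C)"
    by (simp add: field_simps)
  then show ?thesis
    unfolding root_part_def opnorm_scale norm_of_real by (simp add: opnorm_nonneg)
qed (simp add: root_part_def)

lemma root_part_conj: "unitary_mat k \<Longrightarrow> root_part (mat_conj C k) = mat_conj (root_part C) k"
  by (simp add: root_part_def opnorm_conj mat_conj_mult mat_conj_mat)

lemma continuous_on_root_part: "continuous_on UNIV (root_part :: complex^'n^'n \<Rightarrow> complex^'n^'n)"
proof -
  have opc: "continuous_on UNIV (opnorm :: complex^'n^'n \<Rightarrow> real)"
    using continuous_on_opnorm[OF continuous_on_id] by simp
  have away: "continuous_on (- {0}) (root_part :: complex^'n^'n \<Rightarrow> complex^'n^'n)"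
    unfolding root_part_def
    by (intro continuous_on_matrix_mult continuous_on_mat continuous_on_of_real continuous_on_inverse
        continuous_on_real_sqrt continuous_on_opnorm continuous_on_id) (auto simp: opnorm_eq_0)
  have "isCont root_part C" for C :: "complex^'n^'n"
  proof (cases "C = 0")
    case False
    then show ?thesis using away by (simp add: continuous_on_eq_continuous_at open_Compl)
  next
    case True
    let ?K = "real (CARD('n) * CARD('n))"
    have "isCont (\<lambda>C :: complex^'n^'n. ?K * sqrt (opnorm C)) 0"
      using opc by (intro continuous_intros) (simp add: continuous_on_eq_continuous_at)
    then have "((\<lambda>C :: complex^'n^'n. ?K * sqrt (opnorm C)) \<longlongrightarrow> 0) (at 0)"
      by (simp add: isCont_def)
    then have "((root_part :: complex^'n^'n \<Rightarrow> complex^'n^'n) \<longlongrightarrow> 0) (at 0)"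
    proof (rule Lim_null_comparison[rotated])
      show "\<forall>\<^sub>F C :: complex^'n^'n in at 0. norm (root_part C) \<le> ?K * sqrt (opnorm C)"
        by (intro always_eventually allI order_trans[OF norm_le_opnorm]) (simp add: opnorm_root_part)
    qed
    then show ?thesis using True by (simp add: isCont_def root_part_def)
  qed
  then show ?thesis by (simp add: continuous_at_imp_continuous_on)
qed

text \<open>
  A function of a complex variable that is affine over the reals and takes only nonnegative real values
  is constant.
\<close>

lemma linear_nonneg_imp_zero:
  fixes a b r :: complex
  assumes "\<And>t. cnj t * a + t * b + r \<in> \<real>\<^sub>\<ge>\<^sub>0"
  shows "a = 0"
proof -
  have zero: "c = 0" if "\<And>t::real. of_real t * c + r \<in> \<real>\<^sub>\<ge>\<^sub>0" for c :: complex
  proof -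
    have re: "0 \<le> t * Re c + Re r" and im: "t * Im c + Im r = 0" for t
      using that[of t] by (auto simp: complex_nonneg_Reals_iff)
    have "Im c = 0" using im[of 0] im[of 1] by simp
    moreover have "Re c = 0"
    proof (rule ccontr)
      assume "Re c \<noteq> 0"
      then have "- (Re r + 1) / Re c * Re c + Re r = -1" by simp
      then show False using re[of "- (Re r + 1) / Re c"] by linarith
    qed
    ultimately show ?thesis by (simp add: complex_eq_iff)
  qed
  have "a + b = 0"
  proof (rule zero)
    fix t :: real show "of_real t * (a + b) + r \<in> \<real>\<^sub>\<ge>\<^sub>0"
      using assms[of "of_real t"] by (simp add: algebra_simps)
  qed
  moreover have "- \<i> * a + \<i> * b = 0"
  proof (rule zero)
    fix t :: real
    have "cnj (of_real t * \<i>) * a + of_real t * \<i> * b + r = of_real t * (- \<i> * a + \<i> * b) + r"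
      by (simp add: algebra_simps)
    then show "of_real t * (- \<i> * a + \<i> * b) + r \<in> \<real>\<^sub>\<ge>\<^sub>0" using assms[of "of_real t * \<i>"] by simp
  qed
  then have "\<i> * (b - a) = 0" by (simp add: algebra_simps)
  then have "b = a" by simp
  ultimately show ?thesis by simp
qed

section \<open>Invariants and equivariant functions\<close>

lemma poly_functions_continuous: "p \<in> poly_functions \<Longrightarrow> continuous_on S p"
  by (induction rule: poly_functions.induct) (auto intro!: continuous_intros)

lemma invariants_continuous: "p \<in> invariants \<Longrightarrow> continuous_on S p"
  unfolding invariants_def by (simp add: poly_functions_continuous)

lemma invariants_const: "(\<lambda>_. c) \<in> invariants"
  unfolding invariants_def by (simp add: poly_functions.const)

lemma invariants_add: "p \<in> invariants \<Longrightarrow> q \<in> invariants \<Longrightarrow> (\<lambda>z. p z + q z) \<in> invariants"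
  unfolding invariants_def by (simp add: poly_functions.add)

lemma invariants_mult: "p \<in> invariants \<Longrightarrow> q \<in> invariants \<Longrightarrow> (\<lambda>z. p z * q z) \<in> invariants"
  unfolding invariants_def by (simp add: poly_functions.mult)

lemma invariants_conj: "p \<in> invariants \<Longrightarrow> unitary_mat k \<Longrightarrow> p (tuple_conj z k) = p z"
  unfolding invariants_def by (simp add: unitary_mat_invertible)

lemma quot_map_apply: "p \<in> invariants \<Longrightarrow> quot_map z p = p z"
  by (simp add: quot_map_def)

lemma quot_map_conj: "unitary_mat k \<Longrightarrow> quot_map (tuple_conj z k) = quot_map z"
  unfolding quot_map_def by (rule restrict_ext) (simp add: invariants_conj)

lemma continuous_on_quot_map: "continuous_on S quot_map"
proof (rule continuous_on_coordinatewise_then_product)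
  fix p
  show "continuous_on S (\<lambda>z. quot_map z p)"
    by (cases "p \<in> invariants") (simp_all add: quot_map_def invariants_continuous)
qed

lemma fun_subalgebra_continuous:
  assumes "\<phi> \<in> fun_subalgebra F" and "\<And>f. f \<in> F \<Longrightarrow> continuous_on S f"
  shows "continuous_on S \<phi>"
  using assms by (induction rule: fun_subalgebra.induct) (auto intro!: continuous_intros)

lemma fun_subalgebra_equivariant:
  assumes "\<phi> \<in> fun_subalgebra F" and "unitary_mat k"
    and "\<And>f z. f \<in> F \<Longrightarrow> f (tuple_conj z k) = mat_conj (f z) k"
  shows "\<phi> (tuple_conj z k) = mat_conj (\<phi> z) k"
  using assms by (induction arbitrary: z rule: fun_subalgebra.induct)
    (simp_all add: mat_conj_add mat_conj_mult mat_conj_mat)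

lemma generic_matrices_continuous: "\<phi> \<in> generic_matrices \<Longrightarrow> continuous_on S \<phi>"
  unfolding generic_matrices_def
  by (erule fun_subalgebra_continuous) (auto intro!: continuous_intros)

lemma generic_matrices_equivariant:
  "\<phi> \<in> generic_matrices \<Longrightarrow> unitary_mat k \<Longrightarrow> \<phi> (tuple_conj z k) = mat_conj (\<phi> z) k"
  unfolding generic_matrices_def
  by (erule fun_subalgebra_equivariant) (auto simp: tuple_conj_nth)

lemma trace_algebra_continuous:
  fixes \<phi> :: "complex^'n^'n^'d \<Rightarrow> complex^'n^'n"
  assumes "\<phi> \<in> trace_algebra" shows "continuous_on S \<phi>"
  using assms unfolding trace_algebra_def
proof (rule fun_subalgebra_continuous)
  fix f :: "complex^'n^'n^'d \<Rightarrow> complex^'n^'n"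
  assume "f \<in> generic_matrices \<union> (\<lambda>p z. mat (p z)) ` invariants"
  then show "continuous_on S f"
  proof
    assume "f \<in> (\<lambda>p z. mat (p z)) ` invariants"
    then obtain p where "p \<in> invariants" "f = (\<lambda>z. mat (p z))" by blast
    then show ?thesis by (simp add: continuous_on_mat invariants_continuous)
  qed (rule generic_matrices_continuous)
qed

lemma trace_algebra_equivariant:
  "\<phi> \<in> trace_algebra \<Longrightarrow> unitary_mat k \<Longrightarrow> \<phi> (tuple_conj z k) = mat_conj (\<phi> z) k"
  unfolding trace_algebra_def
  by (erule fun_subalgebra_equivariant)
    (auto simp: generic_matrices_equivariant invariants_conj mat_conj_mat)

lemma generic_in_trace_algebra: "\<phi> \<in> generic_matrices \<Longrightarrow> \<phi> \<in> trace_algebra"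
  unfolding trace_algebra_def by (rule fun_subalgebra.gen) simp

lemma invariant_in_trace_algebra: "p \<in> invariants \<Longrightarrow> (\<lambda>z. mat (p z)) \<in> trace_algebra"
  unfolding trace_algebra_def by (rule fun_subalgebra.gen, rule UnI2) (rule imageI)

lemma generic_matrices_onto:
  assumes "z \<in> gen_tuples" shows "\<exists>\<phi>\<in>generic_matrices. \<phi> z = A"
proof -
  have "A \<in> mat_subalgebra (range (\<lambda>i. z $ i))" using assms by (simp add: gen_tuples_def)
  then show ?thesis
  proof (induction rule: mat_subalgebra.induct)
    case (gen A)
    then obtain i where "A = z $ i" by blast
    then show ?case
      unfolding generic_matrices_def by (intro bexI[of _ "\<lambda>z. z $ i"] fun_subalgebra.gen) auto
  next
    case one
    then show ?case unfolding generic_matrices_def by (intro bexI[OF _ fun_subalgebra.one]) simp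
  next
    case (add A B)
    then obtain \<phi> \<psi> where "\<phi> \<in> generic_matrices" "\<phi> z = A" "\<psi> \<in> generic_matrices" "\<psi> z = B" by blast
    then show ?case
      unfolding generic_matrices_def by (intro bexI[OF _ fun_subalgebra.add[of \<phi> _ \<psi>]]) auto
  next
    case (mult A B)
    then obtain \<phi> \<psi> where "\<phi> \<in> generic_matrices" "\<phi> z = A" "\<psi> \<in> generic_matrices" "\<psi> z = B" by blast
    then show ?case
      unfolding generic_matrices_def by (intro bexI[OF _ fun_subalgebra.mult[of \<phi> _ \<psi>]]) auto
  next
    case (scale A c)
    then obtain \<phi> where "\<phi> \<in> generic_matrices" "\<phi> z = A" by blast
    then show ?case
      unfolding generic_matrices_def by (intro bexI[OF _ fun_subalgebra.scale[of \<phi> _ c]]) auto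
  qed
qed

text \<open>
  The stabiliser of a generating tuple acts trivially on all matrices, since each matrix is the value
  of an equivariant function at that tuple.
\<close>

lemma stabiliser_trivial:
  assumes z: "z \<in> gen_tuples" and k: "unitary_mat k" and eq: "tuple_conj z k = z"
  shows "mat_conj A k = A"
proof -
  obtain \<phi> where "\<phi> \<in> generic_matrices" "\<phi> z = A" using generic_matrices_onto[OF z] by blast
  then show ?thesis using generic_matrices_equivariant[OF _ k, of \<phi> z] eq by simp
qed

subsection \<open>Metrisability of the quotient\<close>

text \<open>
  Countably many invariants separate the points of the quotient: the sets of pairs of tuples separated
  by one invariant are open, so countably many of them have the same union.  This embeds compact subsets
  of the quotient, a subset of an uncountable product, into a metric space.
\<close>

lemma quot_embedding:
  "\<exists>j :: ('d::finite, 'n::finite) quot_point \<Rightarrow> nat \<Rightarrow> complex.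
     continuous_on UNIV j \<and> inj_on j (range quot_map)"
proof -
  define U where "U p = {x :: (complex^'n^'n^'d) \<times> (complex^'n^'n^'d). p (fst x) \<noteq> p (snd x)}"
    for p :: "complex^'n^'n^'d \<Rightarrow> complex"
  have "open S" if S: "S \<in> U ` invariants" for S
  proof -
    obtain p where p: "p \<in> invariants" "S = U p" using S by blast
    have c: "continuous_on UNIV (\<lambda>x :: (complex^'n^'n^'d) \<times> (complex^'n^'n^'d). p (fst x))"
        "continuous_on UNIV (\<lambda>x :: (complex^'n^'n^'d) \<times> (complex^'n^'n^'d). p (snd x))"
      by (rule continuous_on_compose2[OF invariants_continuous[OF p(1), of UNIV]];
          auto intro!: continuous_intros)+
    show ?thesis unfolding p(2) U_def by (rule open_Collect_neq[OF c])
  qed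
  from Lindelof[OF this] obtain \<F> where \<F>: "\<F> \<subseteq> U ` invariants" "countable \<F>" "\<Union>\<F> = \<Union>(U ` invariants)"
    by metis
  then obtain C where C: "C \<subseteq> invariants" "countable C" "\<F> = U ` C"
    by (metis countable_subset_image)
  define C' where "C' = insert (\<lambda>_. 0) C"
  have C': "countable C'" "C' \<noteq> {}" using C(2) by (auto simp: C'_def)
  define j where "j x n = x (from_nat_into C' n)" for x :: "('d, 'n) quot_point" and n
  have "continuous_on UNIV j"
    unfolding j_def by (intro continuous_on_coordinatewise_then_product continuous_on_product_coordinates)
  moreover have "inj_on j (range quot_map)"
  proof (rule inj_onI, rule ccontr)
    fix x y :: "('d, 'n) quot_point"
    assume x: "x \<in> range quot_map" and y: "y \<in> range quot_map" and eq: "j x = j y" and ne: "x \<noteq> y"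
    obtain z w where zw: "x = quot_map z" "y = quot_map w" using x y by blast
    obtain p where "x p \<noteq> y p" using ne by blast
    then have "p \<in> invariants" "p z \<noteq> p w" by (auto simp: zw quot_map_def split: if_splits)
    then have "(z, w) \<in> \<Union>(U ` invariants)" by (auto simp: U_def)
    then have "(z, w) \<in> \<Union>(U ` C)" using \<F>(3) C(3) by simp
    then obtain q where q: "q \<in> C" "q z \<noteq> q w" by (auto simp: U_def)
    then obtain n where "from_nat_into C' n = q"
      using from_nat_into_surj[OF C'(1)] by (auto simp: C'_def)
    then have "x q = y q" using fun_cong[OF eq, of n] by (simp add: j_def)
    then show False using q C(1) by (auto simp: zw quot_map_apply)
  qed
  ultimately show ?thesis by blast
qed

lemma perfectly_normal_of_embedding:
  fixes j :: "'a::topological_space \<Rightarrow> 'b::metric_space"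
  assumes X: "compact X" and j: "continuous_on X j" "inj_on j X"
  shows "perfectly_normal_on X"
  unfolding perfectly_normal_on_def
proof (intro allI impI)
  fix W assume W: "closedin (top_of_set X) W"
  show "\<exists>h. continuous_on X h \<and> (\<forall>x\<in>X. 0 \<le> h x) \<and> W = {x \<in> X. h x = (0::real)}"
  proof (cases "W = {}")
    case True
    then show ?thesis by (intro exI[of _ "\<lambda>_. 1"]) simp
  next
    case False
    have WX: "W \<subseteq> X" using closedin_imp_subset[OF W] .
    have "compact W" using W X closedin_compact by blast
    then have "closed (j ` W)"
      using compact_continuous_image[OF continuous_on_subset[OF j(1) WX]] compact_imp_closed by blast
    then have 0: "infdist (j x) (j ` W) = 0 \<longleftrightarrow> j x \<in> j ` W" for x
      using in_closed_iff_infdist_zero False by blast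
    have "W = {x \<in> X. infdist (j x) (j ` W) = 0}"
      using 0 WX inj_on_image_mem_iff[OF j(2) _ WX] by auto
    then show ?thesis
      using j(1) by (intro exI[of _ "\<lambda>x. infdist (j x) (j ` W)"])
        (auto intro!: continuous_intros infdist_nonneg)
  qed
qed

text \<open>
  The Stone-Weierstrass theorem for compact sets that embed into a Hausdorff space.
\<close>

lemma Stone_Weierstrass_of_embedding:
  fixes j :: "'a::topological_space \<Rightarrow> 'b::t2_space" and f :: "'a \<Rightarrow> real"
  assumes E: "compact E" and j: "continuous_on E j" "inj_on j E"
    and R: "\<And>r. r \<in> R \<Longrightarrow> continuous_on E r" "\<And>c. (\<lambda>_. c) \<in> R"
      "\<And>r s. r \<in> R \<Longrightarrow> s \<in> R \<Longrightarrow> (\<lambda>x. r x + s x) \<in> R" "\<And>r s. r \<in> R \<Longrightarrow> s \<in> R \<Longrightarrow> (\<lambda>x. r x * s x) \<in> R"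
      "\<And>x y. x \<in> E \<Longrightarrow> y \<in> E \<Longrightarrow> x \<noteq> y \<Longrightarrow> \<exists>r\<in>R. r x \<noteq> r y"
    and f: "continuous_on E f" and e: "0 < e"
  shows "\<exists>r\<in>R. \<forall>x\<in>E. \<bar>f x - r x\<bar> < e"
proof -
  define i where "i = the_inv_into E j"
  have ij: "i (j x) = x" if "x \<in> E" for x
    unfolding i_def using the_inv_into_f_f[OF j(2) that] .
  have ic: "continuous_on (j ` E) i" using ij by (intro continuous_on_inv[OF j(1) E]) auto
  have comp: "continuous_on (j ` E) (\<lambda>y. r (i y))" if "continuous_on E r" for r :: "'a \<Rightarrow> real"
    using that ic by (rule continuous_on_compose2) (auto simp: ij)
  define R' where "R' = {r'. \<exists>r\<in>R. \<forall>x\<in>E. r' (j x) = r x}"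
  have "\<exists>r'. r' \<in> R' \<and> (\<forall>y\<in>j ` E. \<bar>f (i y) - r' y\<bar> < e)"
  proof (rule Stone_Weierstrass_HOL)
    show "compact (j ` E)" by (rule compact_continuous_image[OF j(1) E])
    show "(\<lambda>_. c) \<in> R'" for c unfolding R'_def using R(2)[of c] by (auto intro!: bexI[of _ "\<lambda>_. c"])
    show "continuous_on (j ` E) r'" if r': "r' \<in> R'" for r'
    proof -
      obtain r where r: "r \<in> R" "\<forall>x\<in>E. r' (j x) = r x" using r' by (auto simp: R'_def)
      show ?thesis
        using comp[OF R(1)[OF r(1)]] by (rule continuous_on_eq) (use r(2) ij in auto)
    qed
    show "(\<lambda>y. r' y + s' y) \<in> R'" if rs: "r' \<in> R' \<and> s' \<in> R'" for r' s'
    proof -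
      obtain r s where "r \<in> R" "\<forall>x\<in>E. r' (j x) = r x" "s \<in> R" "\<forall>x\<in>E. s' (j x) = s x"
        using rs by (auto simp: R'_def)
      then show ?thesis unfolding R'_def using R(3)[of r s] by (auto intro!: bexI[of _ "\<lambda>x. r x + s x"])
    qed
    show "(\<lambda>y. r' y * s' y) \<in> R'" if rs: "r' \<in> R' \<and> s' \<in> R'" for r' s'
    proof -
      obtain r s where "r \<in> R" "\<forall>x\<in>E. r' (j x) = r x" "s \<in> R" "\<forall>x\<in>E. s' (j x) = s x"
        using rs by (auto simp: R'_def)
      then show ?thesis unfolding R'_def using R(4)[of r s] by (auto intro!: bexI[of _ "\<lambda>x. r x * s x"])
    qed
    show "\<exists>r'. r' \<in> R' \<and> r' x \<noteq> r' y" if xy: "x \<in> j ` E \<and> y \<in> j ` E \<and> x \<noteq> y" for x y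
    proof -
      obtain a b where ab: "a \<in> E" "b \<in> E" "x = j a" "y = j b" using xy by blast
      moreover have "a \<noteq> b" using xy ab(3,4) by auto
      ultimately obtain r where "r \<in> R" "r a \<noteq> r b" using R(5) by blast
      then show ?thesis
        using ab ij by (intro exI[of _ "\<lambda>y. r (i y)"]) (auto simp: R'_def)
    qed
    show "continuous_on (j ` E) (\<lambda>y. f (i y))" by (rule comp[OF f])
  qed (rule e)
  then obtain r' where r': "r' \<in> R'" "\<forall>y\<in>j ` E. \<bar>f (i y) - r' y\<bar> < e" by blast
  then obtain r where "r \<in> R" "\<forall>x\<in>E. r' (j x) = r x" by (auto simp: R'_def)
  then show ?thesis using r'(2) ij by (intro bexI[of _ r]) auto
qed

subsection \<open>The function algebra of invariants\<close>

lemma invariant_function_algebra_of_invariant: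
  "p \<in> invariants \<Longrightarrow> (\<lambda>x\<in>X. x p) \<in> invariant_function_algebra X"
proof -
  assume p: "p \<in> invariants"
  have "continuous_on X (\<lambda>x. x p)"
    by (rule continuous_on_subset[OF continuous_on_product_coordinates]) simp
  then show ?thesis
    using p unfolding invariant_function_algebra_def by (auto intro!: bexI[of _ p])
qed

lemma invariant_function_algebra_continuous:
  "f \<in> invariant_function_algebra X \<Longrightarrow> continuous_on X f"
  by (simp add: invariant_function_algebra_def)

lemma quot_choquet_subset_shilov:
  fixes X :: "('d::finite, 'n::finite) quot_point set"
  assumes X: "compact X" "perfectly_normal_on X" and XQ: "X \<subseteq> range quot_map"
  shows "choquet_boundary X (invariant_function_algebra X) \<subseteq> shilov_boundary X (invariant_function_algebra X)"
proof (rule choquet_subset_shilov[OF X invariant_function_algebra_continuous])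
  have ap: "x p = p z" if "x = quot_map z" "p \<in> invariants" for x z and p :: "complex^'n^'n^'d \<Rightarrow> complex"
    using that by (simp add: quot_map_apply)
  show "\<exists>h\<in>invariant_function_algebra X. \<forall>x\<in>X. h x = c" for c
    using XQ by (intro bexI[OF _ invariant_function_algebra_of_invariant[OF invariants_const[of c]]])
      (auto simp: ap invariants_const)
  show "\<exists>h\<in>invariant_function_algebra X. \<forall>x\<in>X. h x = f x + g x"
    if f: "f \<in> invariant_function_algebra X" and g: "g \<in> invariant_function_algebra X" for f g
  proof (intro bexI[of _ "\<lambda>x\<in>X. f x + g x"])
    have "\<exists>r\<in>invariants. \<forall>x\<in>X. cmod (f x + g x - x r) < e" if e: "0 < e" for e
    proof -
      obtain p where p: "p \<in> invariants" "\<forall>x\<in>X. cmod (f x - x p) < e / 2"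
        using f e unfolding invariant_function_algebra_def by (auto dest!: spec[of _ "e / 2"])
      obtain q where q: "q \<in> invariants" "\<forall>x\<in>X. cmod (g x - x q) < e / 2"
        using g e unfolding invariant_function_algebra_def by (auto dest!: spec[of _ "e / 2"])
      have "cmod (f x + g x - x (\<lambda>z. p z + q z)) < e" if x: "x \<in> X" for x
      proof -
        obtain z where z: "x = quot_map z" using XQ x by blast
        have "f x + g x - x (\<lambda>z. p z + q z) = (f x - x p) + (g x - x q)"
          by (simp add: ap[OF z p(1)] ap[OF z q(1)] ap[OF z invariants_add[OF p(1) q(1)]])
        then have "cmod (f x + g x - x (\<lambda>z. p z + q z)) = cmod ((f x - x p) + (g x - x q))" by (rule arg_cong)
        moreover have "cmod (f x - x p) < e / 2" "cmod (g x - x q) < e / 2" using p(2) q(2) x by auto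
        ultimately show ?thesis using norm_triangle_ineq[of "f x - x p" "g x - x q"] by linarith
      qed
      then show ?thesis using invariants_add[OF p(1) q(1)] by blast
    qed
    moreover have "continuous_on X (\<lambda>x. f x + g x)"
      using f g by (intro continuous_on_add) (simp_all add: invariant_function_algebra_def)
    ultimately show "(\<lambda>x\<in>X. f x + g x) \<in> invariant_function_algebra X"
      by (simp add: invariant_function_algebra_def continuous_on_restrict)
  qed simp
  show "\<exists>h\<in>invariant_function_algebra X. \<forall>x\<in>X. h x = c * f x"
    if f: "f \<in> invariant_function_algebra X" for f c
  proof (intro bexI[of _ "\<lambda>x\<in>X. c * f x"])
    have "\<exists>r\<in>invariants. \<forall>x\<in>X. cmod (c * f x - x r) < e" if e: "0 < e" for e
    proof -
      have e': "0 < e / (cmod c + 1)" using e by (simp add: add_nonneg_pos)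
      obtain p where p: "p \<in> invariants" "\<forall>x\<in>X. cmod (f x - x p) < e / (cmod c + 1)"
        using f e' unfolding invariant_function_algebra_def by auto
      have r: "(\<lambda>z. c * p z) \<in> invariants" by (rule invariants_mult[OF invariants_const p(1)])
      have "cmod (c * f x - x (\<lambda>z. c * p z)) < e" if x: "x \<in> X" for x
      proof -
        obtain z where z: "x = quot_map z" using XQ x by blast
        have "c * f x - x (\<lambda>z. c * p z) = c * (f x - x p)"
          by (simp add: ap[OF z p(1)] ap[OF z r] algebra_simps)
        then have "cmod (c * f x - x (\<lambda>z. c * p z)) = cmod c * cmod (f x - x p)"
          by (simp add: norm_mult)
        also have "\<dots> \<le> cmod c * (e / (cmod c + 1))"
          using p(2) x by (intro mult_left_mono) (auto intro: less_imp_le)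
        also have "\<dots> < e"
        proof -
          have p: "0 < cmod c + 1" by (simp add: add_nonneg_pos)
          have "cmod c * e < e * (cmod c + 1)" using e by (simp add: algebra_simps)
          then show ?thesis using p by (simp add: pos_divide_less_eq)
        qed
        finally show ?thesis .
      qed
      then show ?thesis using r by blast
    qed
    moreover have "continuous_on X (\<lambda>x. c * f x)"
      using f by (intro continuous_on_mult_left) (simp add: invariant_function_algebra_def)
    ultimately show "(\<lambda>x\<in>X. c * f x) \<in> invariant_function_algebra X"
      by (simp add: invariant_function_algebra_def continuous_on_restrict)
  qed simp
qed

section \<open>The associated bundle\<close>

lemma mem_bundle_pt: "(w, C) \<in> bundle_pt z A \<longleftrightarrow> (\<exists>k. unitary_mat k \<and> w = tuple_conj z k \<and> C = mat_conj A k)"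
  by (auto simp: bundle_pt_def)

lemma bundle_pt_self: "(z, A) \<in> bundle_pt z A"
  unfolding mem_bundle_pt by (intro exI[of _ "mat 1"]) simp

lemma unitary_mat_cancel: "unitary_mat k \<Longrightarrow> k ** mat_star k = mat 1" "unitary_mat k \<Longrightarrow> mat_star k ** k = mat 1"
  by (simp_all add: unitary_mat_def)

lemma bundle_pt_conj:
  assumes k: "unitary_mat k"
  shows "bundle_pt (tuple_conj z k) (mat_conj A k) = bundle_pt z A"
proof (rule Set.set_eqI, simp only: split_paired_all)
  fix w C
  show "(w, C) \<in> bundle_pt (tuple_conj z k) (mat_conj A k) \<longleftrightarrow> (w, C) \<in> bundle_pt z A"
  proof
    assume "(w, C) \<in> bundle_pt (tuple_conj z k) (mat_conj A k)"
    then obtain l where "unitary_mat l" "w = tuple_conj z (k ** l)" "C = mat_conj A (k ** l)"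
      using k by (auto simp: mem_bundle_pt tuple_conj_conj mat_conj_conj)
    then show "(w, C) \<in> bundle_pt z A"
      unfolding mem_bundle_pt using unitary_mat_mult[OF k] by blast
  next
    assume "(w, C) \<in> bundle_pt z A"
    then obtain l where l: "unitary_mat l" "w = tuple_conj z l" "C = mat_conj A l"
      by (auto simp: mem_bundle_pt)
    have "k ** (mat_star k ** l) = l" using k by (simp add: matrix_mul_assoc unitary_mat_cancel)
    then have "w = tuple_conj (tuple_conj z k) (mat_star k ** l)" "C = mat_conj (mat_conj A k) (mat_star k ** l)"
      using k l by (simp_all add: tuple_conj_conj mat_conj_conj unitary_mat_mult unitary_mat_star)
    then show "(w, C) \<in> bundle_pt (tuple_conj z k) (mat_conj A k)"
      unfolding mem_bundle_pt using unitary_mat_mult[OF unitary_mat_star[OF k] l(1)] by blast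
  qed
qed

lemma bundle_pt_eq_iff:
  "bundle_pt z A = bundle_pt w C \<longleftrightarrow> (\<exists>k. unitary_mat k \<and> w = tuple_conj z k \<and> C = mat_conj A k)"
proof
  assume "bundle_pt z A = bundle_pt w C"
  then have "(w, C) \<in> bundle_pt z A" by (simp add: bundle_pt_self)
  then show "\<exists>k. unitary_mat k \<and> w = tuple_conj z k \<and> C = mat_conj A k" by (simp add: mem_bundle_pt)
qed (auto simp: bundle_pt_conj)

text \<open>
  For a generating tuple \<open>z\<close>, the matrix component of the bundle point \<open>[z, A]\<close> is determined by the first
  component, so fibrewise operations are well defined.
\<close>

lemma same_translate:
  assumes z: "z \<in> gen_tuples" and k: "unitary_mat k" and l: "unitary_mat l"
    and eq: "tuple_conj z k = tuple_conj z l"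
  shows "mat_conj A k = mat_conj A l"
proof -
  have u: "unitary_mat (k ** mat_star l)" by (rule unitary_mat_mult[OF k unitary_mat_star[OF l]])
  have "tuple_conj z (k ** mat_star l) = tuple_conj (tuple_conj z l) (mat_star l)"
    using k l by (simp add: tuple_conj_conj[symmetric] unitary_mat_star eq)
  also have "\<dots> = z" using l by (simp add: tuple_conj_conj unitary_mat_star unitary_mat_cancel)
  finally have "mat_conj A (k ** mat_star l) = A" by (rule stabiliser_trivial[OF z u])
  then have "mat_conj (mat_conj A (k ** mat_star l)) l = mat_conj A l" by simp
  moreover have "k ** mat_star l ** l = k"
    using l by (simp add: matrix_mul_assoc[symmetric] unitary_mat_cancel)
  ultimately show ?thesis using mat_conj_conj[OF u l] by simp
qed

lemma bundle_pt_inj: "z \<in> gen_tuples \<Longrightarrow> bundle_pt z A = bundle_pt z C \<longleftrightarrow> A = C"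
  unfolding bundle_pt_eq_iff using stabiliser_trivial by (metis mat_conj_one tuple_conj_one unitary_mat_one)

lemma bundle_proj_pt: "bundle_proj (bundle_pt z A) = quot_map z"
  unfolding bundle_proj_def
proof (rule the_equality)
  fix u assume "\<exists>w C. bundle_pt z A = bundle_pt w C \<and> u = quot_map w"
  then show "u = quot_map z" by (auto simp: bundle_pt_eq_iff quot_map_conj)
qed blast

lemma fibre_norm_pt: "fibre_norm (bundle_pt z A) = opnorm A"
  unfolding fibre_norm_def opnorm_def[symmetric]
proof (rule the_equality)
  fix r assume "\<exists>w C. bundle_pt z A = bundle_pt w C \<and> r = opnorm C"
  then show "r = opnorm A" by (auto simp: bundle_pt_eq_iff opnorm_conj)
qed blast

lemma fibre_op1_pt:
  assumes "\<And>k. unitary_mat k \<Longrightarrow> h (mat_conj A k) = mat_conj (h A) k"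
  shows "fibre_op1 h (bundle_pt z A) = bundle_pt z (h A)"
  using assms unfolding fibre_op1_def by (auto simp: mem_bundle_pt) metis

lemma fibre_op2_pt:
  assumes z: "z \<in> gen_tuples"
    and h: "\<And>k. unitary_mat k \<Longrightarrow> h (mat_conj A k) (mat_conj C k) = mat_conj (h A C) k"
  shows "fibre_op2 h (bundle_pt z A) (bundle_pt z C) = bundle_pt z (h A C)"
proof (rule Set.set_eqI, simp only: split_paired_all)
  fix w D
  show "(w, D) \<in> fibre_op2 h (bundle_pt z A) (bundle_pt z C) \<longleftrightarrow> (w, D) \<in> bundle_pt z (h A C)"
  proof
    assume "(w, D) \<in> fibre_op2 h (bundle_pt z A) (bundle_pt z C)"
    then obtain k l where kl: "unitary_mat k" "unitary_mat l" "w = tuple_conj z k" "w = tuple_conj z l"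
      and D: "D = h (mat_conj A k) (mat_conj C l)"
      by (auto simp: fibre_op2_def mem_bundle_pt)
    have "mat_conj C l = mat_conj C k" using same_translate[OF z kl(2,1)] kl(3,4) by simp
    then show "(w, D) \<in> bundle_pt z (h A C)" using kl D h by (auto simp: mem_bundle_pt)
  next
    assume "(w, D) \<in> bundle_pt z (h A C)"
    then obtain k where k: "unitary_mat k" "w = tuple_conj z k" "D = h (mat_conj A k) (mat_conj C k)"
      using h by (auto simp: mem_bundle_pt)
    then show "(w, D) \<in> fibre_op2 h (bundle_pt z A) (bundle_pt z C)"
      unfolding fibre_op2_def by (auto simp: mem_bundle_pt)
  qed
qed

lemma topspace_bundle_topology: "topspace (bundle_topology P) = bundle_space P"
proof -
  have "{(z, A). (z, A) \<in> P \<times> UNIV \<and> bundle_pt z A \<in> bundle_space P} = P \<times> UNIV"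
    by (auto simp: bundle_space_def)
  then have "openin (bundle_topology P) (bundle_space P)" by (simp add: openin_bundle_topology)
  then have "bundle_space P \<subseteq> topspace (bundle_topology P)" by (rule openin_subset)
  moreover have "topspace (bundle_topology P) \<subseteq> bundle_space P"
    using openin_topspace[of "bundle_topology P"] openin_bundle_topology[of P "topspace (bundle_topology P)"]
    by (rule conjunct1[OF iffD1, rotated])
  ultimately show ?thesis by (rule antisym[rotated])
qed

lemma continuous_map_bundle_pt:
  "continuous_map (top_of_set (P \<times> UNIV)) (bundle_topology P) (\<lambda>x. bundle_pt (fst x) (snd x))"
  unfolding continuous_map_def
proof (intro conjI allI impI)
  show "(\<lambda>x. bundle_pt (fst x) (snd x)) \<in> topspace (top_of_set (P \<times> UNIV)) \<rightarrow> topspace (bundle_topology P)"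
    by (auto simp: topspace_bundle_topology bundle_space_def)
  fix U assume "openin (bundle_topology P) U"
  then have "openin (top_of_set (P \<times> UNIV)) {(z, A) \<in> P \<times> UNIV. bundle_pt z A \<in> U}"
    by (simp add: openin_bundle_topology)
  moreover have "{(z, A) \<in> P \<times> UNIV. bundle_pt z A \<in> U} =
      {x \<in> topspace (top_of_set (P \<times> UNIV)). bundle_pt (fst x) (snd x) \<in> U}"
    by auto
  ultimately show "openin (top_of_set (P \<times> UNIV))
      {x \<in> topspace (top_of_set (P \<times> UNIV)). bundle_pt (fst x) (snd x) \<in> U}" by simp
qed

lemma continuous_tuple_conj:
  assumes f: "continuous_on S f" and g: "continuous_on S g" and u: "\<And>x. x \<in> S \<Longrightarrow> unitary_mat (g x)"
  shows "continuous_on S (\<lambda>x. tuple_conj (f x) (g x))"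
proof -
  have "continuous_on S (\<lambda>x. \<chi> i. mat_star (g x) ** f x $ i ** g x)"
    using f g by (intro continuous_intros)
  then show ?thesis
    by (rule continuous_on_eq) (simp add: tuple_conj_def mat_conj_unitary u)
qed

lemma continuous_mat_conj:
  fixes f g :: "'a::topological_space \<Rightarrow> complex^'n^'n"
  assumes f: "continuous_on S f" and g: "continuous_on S g" and u: "\<And>x. x \<in> S \<Longrightarrow> unitary_mat (g x)"
  shows "continuous_on S (\<lambda>x. mat_conj (f x) (g x))"
proof -
  have "continuous_on S (\<lambda>x. mat_star (g x) ** f x ** g x)"
    using f g by (intro continuous_intros)
  then show ?thesis
    by (rule continuous_on_eq) (simp add: mat_conj_unitary u)
qed

text \<open>
  Basic neighbourhoods of \<open>[z, A]\<close>: the saturations of product neighbourhoods of \<open>(z, A)\<close>.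
\<close>

lemma openin_bundle_tube:
  "openin (bundle_topology P) {bundle_pt w C |w C. w \<in> P \<and>
     (\<exists>k. unitary_mat k \<and> dist (tuple_conj w k) z < e \<and> dist (mat_conj C k) A < e)}"
  (is "openin _ ?U")
proof -
  let ?T = "\<lambda>k. {x. dist (tuple_conj (fst x) k) z < e \<and> dist (mat_conj (snd x) k) A < e}"
  have o: "open (?T k)" if "unitary_mat k" for k
  proof -
    have "open ({x. dist (tuple_conj (fst x) k) z < e} \<inter> {x. dist (mat_conj (snd x) k) A < e})"
      using that by (intro open_Int open_Collect_less continuous_intros continuous_tuple_conj continuous_mat_conj) auto
    then show ?thesis by (simp add: Collect_conj_eq)
  qed
  have "{(w, C) \<in> P \<times> UNIV. bundle_pt w C \<in> ?U} = (P \<times> UNIV) \<inter> (\<Union>k\<in>{k. unitary_mat k}. ?T k)"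
  proof (rule Set.set_eqI, simp only: split_paired_all)
    fix w C
    have "(\<exists>k. unitary_mat k \<and> dist (tuple_conj w k) z < e \<and> dist (mat_conj C k) A < e)"
      if wC: "w \<in> P" "bundle_pt w C \<in> ?U"
    proof -
      obtain w' C' k where eq: "bundle_pt w C = bundle_pt w' C'" and k: "unitary_mat k"
        "dist (tuple_conj w' k) z < e" "dist (mat_conj C' k) A < e" using wC by blast
      obtain l where "unitary_mat l" "w' = tuple_conj w l" "C' = mat_conj C l"
        using eq unfolding bundle_pt_eq_iff by blast
      then show ?thesis
        using k by (intro exI[of _ "l ** k"]) (simp add: tuple_conj_conj mat_conj_conj unitary_mat_mult)
    qed
    then show "(w, C) \<in> {(w, C) \<in> P \<times> UNIV. bundle_pt w C \<in> ?U} \<longleftrightarrow>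
        (w, C) \<in> (P \<times> UNIV) \<inter> (\<Union>k\<in>{k. unitary_mat k}. ?T k)" by auto
  qed
  moreover have "openin (top_of_set (P \<times> UNIV)) ((P \<times> UNIV) \<inter> (\<Union>k\<in>{k. unitary_mat k}. ?T k))"
    using o by (intro openin_open_Int open_UN) auto
  ultimately show ?thesis
    unfolding openin_bundle_topology by (auto simp: bundle_space_def)
qed

subsection \<open>Sections as equivariant maps\<close>

text \<open>
  A reduction \<open>P\<close> over the set \<open>quot_map ` P\<close> together with a nonempty closed subset \<open>E\<close> of the base over
  which sections are taken.
\<close>

locale bundle_sections =
  fixes P :: "(complex^'n::finite^'n^'d::finite) set" and E :: "('d, 'n) quot_point set"
  assumes reduction: "bundle_reduction (quot_map ` P) P"
    and E_closed: "closedin (top_of_set (quot_map ` P)) E" and E_ne: "E \<noteq> {}"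
begin

text \<open>
  The part of \<open>P\<close> over \<open>E\<close>.
\<close>

definition PE :: "(complex^'n^'n^'d) set" where
  "PE = {z \<in> P. quot_map z \<in> E}"

text \<open>
  The equivariant continuous maps on \<open>PE\<close>; their values elsewhere are arbitrary, so that sections
  correspond to them up to equality on \<open>PE\<close> (\<open>induced_section_eq_iff\<close>).
\<close>

definition equivariant_maps :: "(complex^'n^'n^'d \<Rightarrow> complex^'n^'n) set" where
  "equivariant_maps = {F. continuous_on PE F \<and>
     (\<forall>z\<in>PE. \<forall>k. unitary_mat k \<longrightarrow> F (tuple_conj z k) = mat_conj (F z) k)}"

lemma P_gen: "z \<in> P \<Longrightarrow> z \<in> gen_tuples"
  and compact_P: "compact P"
  and P_conj: "z \<in> P \<Longrightarrow> unitary_mat k \<Longrightarrow> tuple_conj z k \<in> P"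
  and P_quotient: "quotient_map (top_of_set P) (top_of_set (quot_map ` P)) quot_map"
  and P_orbit: "z \<in> P \<Longrightarrow> w \<in> P \<Longrightarrow> quot_map z = quot_map w \<Longrightarrow> \<exists>k. unitary_mat k \<and> w = tuple_conj z k"
  using reduction unfolding bundle_reduction_def by blast+

lemma E_subset: "E \<subseteq> quot_map ` P"
  using closedin_imp_subset[OF E_closed] .

lemma PE_P: "z \<in> PE \<Longrightarrow> z \<in> P" and PE_E: "z \<in> PE \<Longrightarrow> quot_map z \<in> E"
  and PE_gen: "z \<in> PE \<Longrightarrow> z \<in> gen_tuples"
  using P_gen by (auto simp: PE_def)

lemma E_obtain: assumes "u \<in> E" obtains z where "z \<in> PE" "quot_map z = u"
  using E_subset assms by (auto simp: PE_def)

lemma PE_ne: "PE \<noteq> {}"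
  using E_ne E_subset by (auto simp: PE_def)

lemma PE_conj: "z \<in> PE \<Longrightarrow> unitary_mat k \<Longrightarrow> tuple_conj z k \<in> PE"
  by (simp add: PE_def P_conj quot_map_conj)

lemma PE_quotient: "quotient_map (top_of_set PE) (top_of_set E) quot_map"
proof -
  have "quotient_map (subtopology (top_of_set P) PE) (subtopology (top_of_set (quot_map ` P)) E) quot_map"
    using E_closed by (intro quotient_map_restriction[OF P_quotient]) (auto simp: PE_def)
  then show ?thesis
    using E_subset by (simp add: subtopology_subtopology PE_def Int_absorb1 Collect_conj_eq Int_assoc[symmetric])
qed

lemma compact_PE: "compact PE"
proof -
  have "closedin (top_of_set P) (P \<inter> quot_map -` E)"
    by (rule continuous_closedin_preimage_gen[OF continuous_on_quot_map _ E_closed]) auto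
  moreover have "P \<inter> quot_map -` E = PE" by (auto simp: PE_def)
  ultimately show ?thesis using closedin_compact[OF compact_P] by simp
qed

lemma equivariant_mapsD:
  assumes "F \<in> equivariant_maps"
  shows "continuous_on PE F" "\<And>z k. z \<in> PE \<Longrightarrow> unitary_mat k \<Longrightarrow> F (tuple_conj z k) = mat_conj (F z) k"
  using assms by (auto simp: equivariant_maps_def)

lemma induced_section_at:
  assumes F: "F \<in> equivariant_maps" and z: "z \<in> PE"
  shows "induced_section P E F (quot_map z) = bundle_pt z (F z)"
proof -
  have "(THE x. \<exists>w\<in>P. quot_map w = quot_map z \<and> x = bundle_pt w (F w)) = bundle_pt z (F z)"
  proof (rule the_equality)
    fix x assume "\<exists>w\<in>P. quot_map w = quot_map z \<and> x = bundle_pt w (F w)"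
    then obtain w where w: "w \<in> P" "quot_map w = quot_map z" "x = bundle_pt w (F w)" by blast
    then obtain k where k: "unitary_mat k" "w = tuple_conj z k" using P_orbit PE_P[OF z] by metis
    then show "x = bundle_pt z (F z)"
      using w(3) equivariant_mapsD(2)[OF F z k(1)] bundle_pt_conj[OF k(1)] by simp
  qed (use PE_P[OF z] in blast)
  then show ?thesis using PE_E[OF z] by (simp add: induced_section_def)
qed

lemma induced_section_extensional: "induced_section P E F \<in> extensional E"
  by (simp add: induced_section_def)

lemma induced_section_eq_iff:
  assumes F: "F \<in> equivariant_maps" and G: "G \<in> equivariant_maps"
  shows "induced_section P E F = induced_section P E G \<longleftrightarrow> (\<forall>z\<in>PE. F z = G z)"
proof
  assume "induced_section P E F = induced_section P E G"
  then have "bundle_pt z (F z) = bundle_pt z (G z)" if "z \<in> PE" for z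
    using induced_section_at[OF F that] induced_section_at[OF G that] by simp
  then show "\<forall>z\<in>PE. F z = G z" using bundle_pt_inj PE_gen by blast
next
  assume eq: "\<forall>z\<in>PE. F z = G z"
  show "induced_section P E F = induced_section P E G"
  proof (rule extensionalityI[OF induced_section_extensional induced_section_extensional])
    fix u assume "u \<in> E"
    then obtain z where z: "z \<in> PE" "quot_map z = u" by (rule E_obtain)
    then show "induced_section P E F u = induced_section P E G u"
      using induced_section_at[OF F z(1)] induced_section_at[OF G z(1)] eq by simp
  qed
qed

lemma section_of_equivariant_map:
  assumes F: "F \<in> equivariant_maps"
  shows "induced_section P E F \<in> carrier (section_algebra P E)"
proof -
  have "continuous_map (top_of_set PE) (top_of_set (P \<times> UNIV)) (\<lambda>z. (z, F z))"
    using equivariant_mapsD(1)[OF F] PE_P by (auto intro!: continuous_intros)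
  then have "continuous_map (top_of_set PE) (bundle_topology P)
      ((\<lambda>x. bundle_pt (fst x) (snd x)) \<circ> (\<lambda>z. (z, F z)))"
    using continuous_map_bundle_pt by (rule continuous_map_compose)
  then have "continuous_map (top_of_set PE) (bundle_topology P) (induced_section P E F \<circ> quot_map)"
    by (rule continuous_map_eq) (simp add: induced_section_at[OF F])
  then have "continuous_map (top_of_set E) (bundle_topology P) (induced_section P E F)"
    using PE_quotient continuous_compose_quotient_map by blast
  moreover have "bundle_proj (induced_section P E F u) = u" if u: "u \<in> E" for u
  proof -
    obtain z where "z \<in> PE" "quot_map z = u" using u by (rule E_obtain)
    then show ?thesis using induced_section_at[OF F] by (metis bundle_proj_pt)
  qed
  ultimately show ?thesis
    by (simp add: section_algebra_def induced_section_extensional)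
qed

lemma eval_rep_pt: "z \<in> gen_tuples \<Longrightarrow> \<sigma> u = bundle_pt z A \<Longrightarrow> eval_rep z u \<sigma> = A"
  unfolding eval_rep_def by (rule the_equality) (auto simp: bundle_pt_inj)

lemma eval_rep_induced: "F \<in> equivariant_maps \<Longrightarrow> z \<in> PE \<Longrightarrow> eval_rep z (quot_map z) (induced_section P E F) = F z"
  by (rule eval_rep_pt) (auto simp: PE_gen induced_section_at)

text \<open>
  Continuity of the equivariant map of a section: if \<open>[x,F x]\<close> is close to \<open>[z,F z]\<close> then some
  translate \<open>(x k, F x k)\<close> is close to \<open>(z, F z)\<close>; by compactness of the unitary group the translating
  elements accumulate at stabilisers of \<open>z\<close>, which act trivially.
\<close>

lemma equivariant_map_of_section:
  assumes \<sigma>: "\<sigma> \<in> carrier (section_algebra P E)"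
  obtains F where "F \<in> equivariant_maps" "\<sigma> = induced_section P E F"
proof -
  have ext: "\<sigma> \<in> extensional E" and cont: "continuous_map (top_of_set E) (bundle_topology P) \<sigma>"
    and proj: "\<And>u. u \<in> E \<Longrightarrow> bundle_proj (\<sigma> u) = u"
    using \<sigma> by (auto simp: section_algebra_def)
  define F where "F z = eval_rep z (quot_map z) \<sigma>" for z
  have F: "\<sigma> (quot_map z) = bundle_pt z (F z)" if z: "z \<in> PE" for z
  proof -
    have "\<sigma> (quot_map z) \<in> bundle_space P"
      using cont PE_E[OF z] unfolding continuous_map_def topspace_bundle_topology by auto
    then obtain w A where w: "w \<in> P" "\<sigma> (quot_map z) = bundle_pt w A" by (auto simp: bundle_space_def)
    then have "quot_map w = quot_map z" using proj[OF PE_E[OF z]] by (simp add: bundle_proj_pt)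
    then obtain k where k: "unitary_mat k" "z = tuple_conj w k" using P_orbit[OF w(1) PE_P[OF z]] by blast
    then have "\<sigma> (quot_map z) = bundle_pt z (mat_conj A k)" using w(2) bundle_pt_conj[OF k(1), of w A] by simp
    then show ?thesis using eval_rep_pt[of z \<sigma>, OF PE_gen[OF z]] by (simp add: F_def)
  qed
  have eqv: "F (tuple_conj z k) = mat_conj (F z) k" if z: "z \<in> PE" and k: "unitary_mat k" for z k
  proof -
    have "bundle_pt (tuple_conj z k) (F (tuple_conj z k)) = bundle_pt (tuple_conj z k) (mat_conj (F z) k)"
      using F[OF PE_conj[OF z k]] F[OF z] bundle_pt_conj[OF k, of z "F z"] quot_map_conj[OF k, of z] by simp
    then show ?thesis using bundle_pt_inj[OF PE_gen[OF PE_conj[OF z k]]] by simp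
  qed
  have "continuous_on PE F"
  proof (rule ccontr)
    assume "\<not> continuous_on PE F"
    then obtain z e where z: "z \<in> PE" and e: "e > 0"
      and far: "\<And>d. 0 < d \<Longrightarrow> \<exists>x\<in>PE. dist x z < d \<and> e \<le> dist (F x) (F z)"
      unfolding continuous_on_iff by (meson not_less)
    have "\<exists>x k. x \<in> PE \<and> e \<le> dist (F x) (F z) \<and> unitary_mat k \<and> dist x z < inverse (Suc n) \<and>
        dist (tuple_conj x k) z < inverse (Suc n) \<and> dist (mat_conj (F x) k) (F z) < inverse (Suc n)" for n
    proof -
      let ?r = "inverse (real (Suc n))"
      define U where "U = {bundle_pt w C |w C. w \<in> P \<and>
        (\<exists>k. unitary_mat k \<and> dist (tuple_conj w k) z < ?r \<and> dist (mat_conj C k) (F z) < ?r)}"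
      define V where "V = {x \<in> topspace (top_of_set PE). (\<sigma> \<circ> quot_map) x \<in> U}"
      have "continuous_map (top_of_set PE) (bundle_topology P) (\<sigma> \<circ> quot_map)"
        using quotient_imp_continuous_map[OF PE_quotient] cont by (rule continuous_map_compose)
      moreover have "openin (bundle_topology P) U" unfolding U_def by (rule openin_bundle_tube)
      ultimately have "openin (top_of_set PE) V"
        unfolding V_def by (rule openin_continuous_map_preimage)
      then have V: "\<forall>x\<in>V. \<exists>d>0. \<forall>y\<in>PE. dist y x < d \<longrightarrow> y \<in> V"
        unfolding openin_euclidean_subtopology_iff by (rule conjunct2)
      have "\<exists>k. unitary_mat k \<and> dist (tuple_conj z k) z < ?r \<and> dist (mat_conj (F z) k) (F z) < ?r"
        by (intro exI[of _ "mat 1"]) simp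
      then have "\<sigma> (quot_map z) \<in> U" unfolding F[OF z] U_def using PE_P[OF z] by blast
      then have "z \<in> V" using z by (simp add: V_def)
      then obtain d where d: "d > 0" "\<And>x. x \<in> PE \<Longrightarrow> dist x z < d \<Longrightarrow> x \<in> V" using V by blast
      obtain x where x: "x \<in> PE" "dist x z < min d ?r" "e \<le> dist (F x) (F z)"
        using far[of "min d ?r"] d(1) by auto
      have "bundle_pt x (F x) \<in> U" using d(2)[OF x(1)] x(2) F[OF x(1)] by (simp add: V_def)
      then obtain w C k where eq: "bundle_pt x (F x) = bundle_pt w C" and k: "unitary_mat k"
        "dist (tuple_conj w k) z < ?r" "dist (mat_conj C k) (F z) < ?r"
        unfolding U_def by blast
      obtain l where l: "unitary_mat l" "w = tuple_conj x l" "C = mat_conj (F x) l"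
        using eq unfolding bundle_pt_eq_iff by blast
      then show ?thesis
        using k x by (intro exI[of _ x] exI[of _ "l ** k"])
          (simp add: tuple_conj_conj mat_conj_conj unitary_mat_mult)
    qed
    then have "\<forall>n. \<exists>y. fst y \<in> PE \<and> e \<le> dist (F (fst y)) (F z) \<and> unitary_mat (snd y) \<and>
        dist (fst y) z < inverse (Suc n) \<and> dist (tuple_conj (fst y) (snd y)) z < inverse (Suc n) \<and>
        dist (mat_conj (F (fst y)) (snd y)) (F z) < inverse (Suc n)"
      by (simp only: split_paired_Ex fst_conv snd_conv simp_thms)
    from choice[OF this] obtain f where f: "\<forall>n. fst (f n) \<in> PE \<and> e \<le> dist (F (fst (f n))) (F z) \<and>
        unitary_mat (snd (f n)) \<and> dist (fst (f n)) z < inverse (Suc n) \<and>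
        dist (tuple_conj (fst (f n)) (snd (f n))) z < inverse (Suc n) \<and>
        dist (mat_conj (F (fst (f n))) (snd (f n))) (F z) < inverse (Suc n)" ..
    define x where "x n = fst (f n)" for n
    define k where "k n = snd (f n)" for n
    have x: "\<And>n. x n \<in> PE" "\<And>n. e \<le> dist (F (x n)) (F z)" and k: "\<And>n. unitary_mat (k n)"
      and lim: "\<And>n. dist (x n) z < inverse (Suc n)" "\<And>n. dist (tuple_conj (x n) (k n)) z < inverse (Suc n)"
        "\<And>n. dist (mat_conj (F (x n)) (k n)) (F z) < inverse (Suc n)"
      using f unfolding x_def k_def by blast+
    have tends: "X \<longlonglongrightarrow> l" if "\<And>n. dist (X n) l < inverse (Suc n)" for X :: "nat \<Rightarrow> 'b::metric_space" and l
    proof (rule iffD2[OF tendsto_dist_iff], rule real_tendsto_sandwich[OF _ _ tendsto_const LIMSEQ_inverse_real_of_nat])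
      show "\<forall>\<^sub>F n in sequentially. dist (X n) l \<le> inverse (real (Suc n))"
        by (rule always_eventually, rule allI, rule less_imp_le, rule that)
    qed simp
    have "\<forall>n. k n \<in> {k. unitary_mat k}" using k by simp
    then obtain k0 r where k0: "unitary_mat k0" and r: "strict_mono r" "(k \<circ> r) \<longlonglongrightarrow> k0"
      using compact_unitary unfolding compact_def by blast
    have xr: "(\<lambda>n. x (r n)) \<longlonglongrightarrow> z"
      using LIMSEQ_subseq_LIMSEQ[OF tends[OF lim(1)] r(1)] by (simp add: comp_def)
    have kr: "(\<lambda>n. k (r n)) \<longlonglongrightarrow> k0" using r(2) by (simp add: comp_def)
    have ct: "continuous_on ((UNIV :: (complex^'n^'n^'d) set) \<times> {k. unitary_mat k}) (\<lambda>y. tuple_conj (fst y) (snd y))"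
      by (intro continuous_tuple_conj continuous_intros) auto
    have cm: "continuous_on ((UNIV :: (complex^'n^'n) set) \<times> {k. unitary_mat k}) (\<lambda>y. mat_conj (fst y) (snd y))"
      by (intro continuous_mat_conj continuous_intros) auto
    have "(\<lambda>n. tuple_conj (x (r n)) (k (r n))) \<longlonglongrightarrow> tuple_conj z k0"
      using continuous_on_tendsto_compose[OF ct tendsto_Pair[OF xr kr]] k k0 by simp
    moreover have "(\<lambda>n. tuple_conj (x (r n)) (k (r n))) \<longlonglongrightarrow> z"
      using LIMSEQ_subseq_LIMSEQ[OF tends[OF lim(2)] r(1)] by (simp add: comp_def)
    ultimately have stab: "tuple_conj z k0 = z" using LIMSEQ_unique by blast
    have fix0: "mat_conj A (mat_star k0) = A" for A
    proof -
      have "mat_conj (mat_conj A k0) (mat_star k0) = A"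
        using k0 by (simp add: mat_conj_conj unitary_mat_star unitary_mat_cancel)
      then show ?thesis using stabiliser_trivial[OF PE_gen[OF z] k0 stab] by simp
    qed
    have l1: "(\<lambda>n. mat_conj (F (x (r n))) (k (r n))) \<longlonglongrightarrow> F z"
      using LIMSEQ_subseq_LIMSEQ[OF tends[OF lim(3)] r(1)] by (simp add: comp_def)
    have l2: "(\<lambda>n. mat_star (k (r n))) \<longlonglongrightarrow> mat_star k0"
      using continuous_on_tendsto_compose[OF continuous_on_mat_star[OF continuous_on_id[of UNIV]] kr] by simp
    have "(\<lambda>n. mat_conj (mat_conj (F (x (r n))) (k (r n))) (mat_star (k (r n)))) \<longlonglongrightarrow> mat_conj (F z) (mat_star k0)"
      using continuous_on_tendsto_compose[OF cm tendsto_Pair[OF l1 l2]] k k0 by (simp add: unitary_mat_star)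
    then have "(\<lambda>n. F (x (r n))) \<longlonglongrightarrow> F z"
      using k by (simp add: fix0 mat_conj_conj unitary_mat_star unitary_mat_cancel)
    then have "(\<lambda>n. dist (F (x (r n))) (F z)) \<longlonglongrightarrow> 0"
      by (rule iffD1[OF tendsto_dist_iff])
    then have "e \<le> 0" using x(2) by (intro LIMSEQ_le_const) auto
    then show False using e by simp
  qed
  with eqv have Fm: "F \<in> equivariant_maps" by (simp add: equivariant_maps_def)
  have "\<sigma> = induced_section P E F"
  proof (rule extensionalityI[OF ext induced_section_extensional])
    fix u assume "u \<in> E"
    then obtain z where z: "z \<in> PE" "quot_map z = u" by (rule E_obtain)
    then show "\<sigma> u = induced_section P E F u"
      using induced_section_at[OF Fm z(1)] F[OF z(1)] by simp
  qed
  with Fm show thesis by (rule that)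
qed

section \<open>The algebra of sections\<close>

abbreviation section_of :: "(complex^'n^'n^'d \<Rightarrow> complex^'n^'n) \<Rightarrow> ('d, 'n) quot_point \<Rightarrow> ('d, 'n) bundle_point" where
  "section_of F \<equiv> induced_section P E F"

abbreviation B :: "(('d, 'n) quot_point \<Rightarrow> ('d, 'n) bundle_point) star_alg" where
  "B \<equiv> section_algebra P E"

lemma equivariant_mapsI:
  "continuous_on PE F \<Longrightarrow> (\<And>z k. z \<in> PE \<Longrightarrow> unitary_mat k \<Longrightarrow> F (tuple_conj z k) = mat_conj (F z) k) \<Longrightarrow>
    F \<in> equivariant_maps"
  by (simp add: equivariant_maps_def)

lemma equivariant_const: "(\<lambda>_. mat c) \<in> equivariant_maps"
  by (rule equivariant_mapsI) (simp_all add: mat_conj_mat)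

lemma equivariant_zero: "(\<lambda>_. 0) \<in> equivariant_maps"
  using equivariant_const[of 0] by simp

lemma equivariant_add:
  "F \<in> equivariant_maps \<Longrightarrow> G \<in> equivariant_maps \<Longrightarrow> (\<lambda>z. F z + G z) \<in> equivariant_maps"
  by (intro equivariant_mapsI continuous_on_add)
    (simp_all add: equivariant_mapsD mat_conj_add)

lemma equivariant_mult:
  "F \<in> equivariant_maps \<Longrightarrow> G \<in> equivariant_maps \<Longrightarrow> (\<lambda>z. F z ** G z) \<in> equivariant_maps"
  by (intro equivariant_mapsI continuous_on_matrix_mult)
    (simp_all add: equivariant_mapsD mat_conj_mult)

lemma equivariant_scale: "F \<in> equivariant_maps \<Longrightarrow> (\<lambda>z. mat c ** F z) \<in> equivariant_maps"
  by (rule equivariant_mult[OF equivariant_const])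

lemma equivariant_star: "F \<in> equivariant_maps \<Longrightarrow> (\<lambda>z. mat_star (F z)) \<in> equivariant_maps"
  by (intro equivariant_mapsI continuous_on_mat_star)
    (simp_all add: equivariant_mapsD mat_conj_star)

lemma equivariant_uminus: "F \<in> equivariant_maps \<Longrightarrow> (\<lambda>z. - F z) \<in> equivariant_maps"
  using equivariant_scale[of F "-1"] by (simp add: mat_minus_one)

lemma equivariant_diff:
  "F \<in> equivariant_maps \<Longrightarrow> G \<in> equivariant_maps \<Longrightarrow> (\<lambda>z. F z - G z) \<in> equivariant_maps"
  using equivariant_add[OF _ equivariant_uminus, of F G] by simp

lemma equivariant_scalar:
  assumes "continuous_on E f" shows "(\<lambda>z. mat (f (quot_map z))) \<in> equivariant_maps"
proof (rule equivariant_mapsI)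
  have "continuous_on PE (\<lambda>z. f (quot_map z))"
    using assms by (rule continuous_on_compose2[OF _ continuous_on_quot_map]) (auto simp: PE_E)
  then show "continuous_on PE (\<lambda>z. mat (f (quot_map z)))" by (rule continuous_on_mat)
qed (simp add: quot_map_conj mat_conj_mat)

lemma equivariant_trace: "\<phi> \<in> trace_algebra \<Longrightarrow> \<phi> \<in> equivariant_maps"
  by (intro equivariant_mapsI trace_algebra_continuous trace_algebra_equivariant)

lemma carrierE:
  assumes "x \<in> carrier B" obtains F where "F \<in> equivariant_maps" "x = section_of F"
  using assms by (rule equivariant_map_of_section)

lemma fibrewise_op1:
  assumes F: "F \<in> equivariant_maps" and hF: "(\<lambda>z. h (F z)) \<in> equivariant_maps"
    and h: "\<And>A k. unitary_mat k \<Longrightarrow> h (mat_conj A k) = mat_conj (h A) k"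
  shows "(\<lambda>u\<in>E. fibre_op1 h (section_of F u)) = section_of (\<lambda>z. h (F z))"
proof (rule extensionalityI[OF restrict_extensional induced_section_extensional])
  fix u assume u: "u \<in> E"
  then obtain z where "z \<in> PE" "quot_map z = u" by (rule E_obtain)
  then show "(\<lambda>u\<in>E. fibre_op1 h (section_of F u)) u = section_of (\<lambda>z. h (F z)) u"
    using induced_section_at[OF F] induced_section_at[OF hF] u h by (auto simp: fibre_op1_pt)
qed

lemma fibrewise_op2:
  assumes F: "F \<in> equivariant_maps" and G: "G \<in> equivariant_maps"
    and hF: "(\<lambda>z. h (F z) (G z)) \<in> equivariant_maps"
    and h: "\<And>A C k. unitary_mat k \<Longrightarrow> h (mat_conj A k) (mat_conj C k) = mat_conj (h A C) k"
  shows "(\<lambda>u\<in>E. fibre_op2 h (section_of F u) (section_of G u)) = section_of (\<lambda>z. h (F z) (G z))"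
proof (rule extensionalityI[OF restrict_extensional induced_section_extensional])
  fix u assume u: "u \<in> E"
  then obtain z where "z \<in> PE" "quot_map z = u" by (rule E_obtain)
  then show "(\<lambda>u\<in>E. fibre_op2 h (section_of F u) (section_of G u)) u = section_of (\<lambda>z. h (F z) (G z)) u"
    using induced_section_at[OF F] induced_section_at[OF G] induced_section_at[OF hF] u h
    by (auto simp: fibre_op2_pt PE_gen)
qed

lemma section_add:
  "F \<in> equivariant_maps \<Longrightarrow> G \<in> equivariant_maps \<Longrightarrow>
    section_of F \<oplus>\<^bsub>B\<^esub> section_of G = section_of (\<lambda>z. F z + G z)"
  by (simp add: section_algebra_def fibrewise_op2 equivariant_add mat_conj_add)

lemma section_mult:
  "F \<in> equivariant_maps \<Longrightarrow> G \<in> equivariant_maps \<Longrightarrow>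
    section_of F \<otimes>\<^bsub>B\<^esub> section_of G = section_of (\<lambda>z. F z ** G z)"
  by (simp add: section_algebra_def fibrewise_op2 equivariant_mult mat_conj_mult)

lemma section_scale:
  "F \<in> equivariant_maps \<Longrightarrow> scale B c (section_of F) = section_of (\<lambda>z. mat c ** F z)"
  by (simp add: section_algebra_def fibrewise_op1 equivariant_scale mat_conj_scale)

lemma section_star:
  "F \<in> equivariant_maps \<Longrightarrow> star B (section_of F) = section_of (\<lambda>z. mat_star (F z))"
  by (simp add: section_algebra_def fibrewise_op1 equivariant_star mat_conj_star)

lemma section_one: "\<one>\<^bsub>B\<^esub> = section_of (\<lambda>_. mat 1)" and section_zero: "\<zero>\<^bsub>B\<^esub> = section_of (\<lambda>_. 0)"
  by (simp_all add: section_algebra_def)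

lemmas section_closed = section_of_equivariant_map

lemma section_ring: "ring B"
proof (rule ringI)
  show "abelian_group B"
  proof (rule abelian_groupI)
    show "\<zero>\<^bsub>B\<^esub> \<in> carrier B" unfolding section_zero by (rule section_closed[OF equivariant_zero])
  next
    fix x y assume "x \<in> carrier B" "y \<in> carrier B"
    then obtain F G where "F \<in> equivariant_maps" "G \<in> equivariant_maps" "x = section_of F" "y = section_of G"
      by (metis carrierE)
    then show "x \<oplus>\<^bsub>B\<^esub> y \<in> carrier B" "x \<oplus>\<^bsub>B\<^esub> y = y \<oplus>\<^bsub>B\<^esub> x"
      by (simp_all add: section_add section_closed equivariant_add add.commute)
  next
    fix x y z assume "x \<in> carrier B" "y \<in> carrier B" "z \<in> carrier B"
    then obtain F G H where "F \<in> equivariant_maps" "G \<in> equivariant_maps" "H \<in> equivariant_maps"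
      "x = section_of F" "y = section_of G" "z = section_of H"
      by (metis carrierE)
    then show "x \<oplus>\<^bsub>B\<^esub> y \<oplus>\<^bsub>B\<^esub> z = x \<oplus>\<^bsub>B\<^esub> (y \<oplus>\<^bsub>B\<^esub> z)"
      by (simp add: section_add equivariant_add add.assoc)
  next
    fix x assume "x \<in> carrier B"
    then obtain F where F: "F \<in> equivariant_maps" "x = section_of F" by (rule carrierE)
    then show "\<zero>\<^bsub>B\<^esub> \<oplus>\<^bsub>B\<^esub> x = x"
      by (simp add: section_add section_zero equivariant_zero)
    have "section_of (\<lambda>z. - F z) \<oplus>\<^bsub>B\<^esub> x = \<zero>\<^bsub>B\<^esub>"
      using F by (simp add: section_add section_zero equivariant_uminus)
    then show "\<exists>y\<in>carrier B. y \<oplus>\<^bsub>B\<^esub> x = \<zero>\<^bsub>B\<^esub>"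
      using section_closed[OF equivariant_uminus[OF F(1)]] by blast
  qed
  show "monoid B"
  proof (rule monoidI)
    show "\<one>\<^bsub>B\<^esub> \<in> carrier B" unfolding section_one by (rule section_closed[OF equivariant_const])
  next
    fix x y assume "x \<in> carrier B" "y \<in> carrier B"
    then obtain F G where "F \<in> equivariant_maps" "G \<in> equivariant_maps" "x = section_of F" "y = section_of G"
      by (metis carrierE)
    then show "x \<otimes>\<^bsub>B\<^esub> y \<in> carrier B"
      by (simp add: section_mult section_closed equivariant_mult)
  next
    fix x y z assume "x \<in> carrier B" "y \<in> carrier B" "z \<in> carrier B"
    then obtain F G H where "F \<in> equivariant_maps" "G \<in> equivariant_maps" "H \<in> equivariant_maps"
      "x = section_of F" "y = section_of G" "z = section_of H"
      by (metis carrierE)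
    then show "x \<otimes>\<^bsub>B\<^esub> y \<otimes>\<^bsub>B\<^esub> z = x \<otimes>\<^bsub>B\<^esub> (y \<otimes>\<^bsub>B\<^esub> z)"
      by (simp add: section_mult equivariant_mult matrix_mul_assoc)
  next
    fix x assume "x \<in> carrier B"
    then obtain F where F: "F \<in> equivariant_maps" "x = section_of F" by (rule carrierE)
    then show "\<one>\<^bsub>B\<^esub> \<otimes>\<^bsub>B\<^esub> x = x" "x \<otimes>\<^bsub>B\<^esub> \<one>\<^bsub>B\<^esub> = x"
      by (simp_all add: section_mult section_one equivariant_const)
  qed
next
  fix x y z assume "x \<in> carrier B" "y \<in> carrier B" "z \<in> carrier B"
  then obtain F G H where "F \<in> equivariant_maps" "G \<in> equivariant_maps" "H \<in> equivariant_maps"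
    "x = section_of F" "y = section_of G" "z = section_of H"
    by (metis carrierE)
  then show "(x \<oplus>\<^bsub>B\<^esub> y) \<otimes>\<^bsub>B\<^esub> z = x \<otimes>\<^bsub>B\<^esub> z \<oplus>\<^bsub>B\<^esub> y \<otimes>\<^bsub>B\<^esub> z"
    "z \<otimes>\<^bsub>B\<^esub> (x \<oplus>\<^bsub>B\<^esub> y) = z \<otimes>\<^bsub>B\<^esub> x \<oplus>\<^bsub>B\<^esub> z \<otimes>\<^bsub>B\<^esub> y"
    by (simp_all add: section_mult section_add equivariant_mult equivariant_add
        matrix_add_ldistrib matrix_add_rdistrib)
qed

lemma section_minus:
  assumes "F \<in> equivariant_maps" "G \<in> equivariant_maps"
  shows "section_of F \<ominus>\<^bsub>B\<^esub> section_of G = section_of (\<lambda>z. F z - G z)"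
proof -
  interpret ring B by (rule section_ring)
  have "section_of (\<lambda>z. - G z) \<oplus>\<^bsub>B\<^esub> section_of G = \<zero>\<^bsub>B\<^esub>"
    using assms by (simp add: section_add section_zero equivariant_uminus)
  then have "\<ominus>\<^bsub>B\<^esub> section_of G = section_of (\<lambda>z. - G z)"
    using assms by (intro minus_equality) (simp_all add: section_closed equivariant_uminus)
  then show ?thesis
    using assms by (simp add: a_minus_def section_add equivariant_uminus)
qed

subsection \<open>The norm of a section\<close>

lemma cnorm_section:
  assumes F: "F \<in> equivariant_maps"
  shows "cnorm B (section_of F) = (SUP z\<in>PE. opnorm (F z))"
proof -
  have "(\<lambda>u. fibre_norm (section_of F u)) ` E = (\<lambda>z. opnorm (F z)) ` PE"
  proof (intro equalityI subsetI)
    fix r assume "r \<in> (\<lambda>u. fibre_norm (section_of F u)) ` E"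
    then obtain u where u: "u \<in> E" "r = fibre_norm (section_of F u)" by blast
    then obtain z where "z \<in> PE" "quot_map z = u" using E_obtain by blast
    then show "r \<in> (\<lambda>z. opnorm (F z)) ` PE"
      using u(2) induced_section_at[OF F] by (auto simp: fibre_norm_pt)
  next
    fix r assume "r \<in> (\<lambda>z. opnorm (F z)) ` PE"
    then obtain z where z: "z \<in> PE" "r = opnorm (F z)" by blast
    then have "r = fibre_norm (section_of F (quot_map z))"
      using induced_section_at[OF F] by (simp add: fibre_norm_pt)
    then show "r \<in> (\<lambda>u. fibre_norm (section_of F u)) ` E" using PE_E[OF z(1)] by blast
  qed
  then show ?thesis by (simp add: section_algebra_def)
qed

lemma bdd_above_opnorm:
  assumes "F \<in> equivariant_maps" shows "bdd_above ((\<lambda>z. opnorm (F z)) ` PE)"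
  using compact_continuous_image[OF continuous_on_opnorm[OF equivariant_mapsD(1)[OF assms]] compact_PE]
  by (intro bounded_imp_bdd_above compact_imp_bounded)

lemma opnorm_le_cnorm: "F \<in> equivariant_maps \<Longrightarrow> z \<in> PE \<Longrightarrow> opnorm (F z) \<le> cnorm B (section_of F)"
  unfolding cnorm_section by (rule cSUP_upper[OF _ bdd_above_opnorm])

lemma cnorm_leI:
  "F \<in> equivariant_maps \<Longrightarrow> (\<And>z. z \<in> PE \<Longrightarrow> opnorm (F z) \<le> c) \<Longrightarrow> cnorm B (section_of F) \<le> c"
  unfolding cnorm_section using PE_ne by (intro cSUP_least)

lemma cnorm_section_nonneg: "F \<in> equivariant_maps \<Longrightarrow> 0 \<le> cnorm B (section_of F)"
proof -
  assume F: "F \<in> equivariant_maps"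
  obtain z where "z \<in> PE" using PE_ne by blast
  then show ?thesis using opnorm_le_cnorm[OF F] opnorm_nonneg order_trans by blast
qed

lemma cnorm_section_scale:
  assumes F: "F \<in> equivariant_maps"
  shows "cnorm B (section_of (\<lambda>z. mat c ** F z)) = cmod c * cnorm B (section_of F)"
proof -
  have le: "cnorm B (section_of (\<lambda>z. mat c ** F z)) \<le> cmod c * cnorm B (section_of F)"
    if F: "F \<in> equivariant_maps" for c F
    by (rule cnorm_leI[OF equivariant_scale[OF F]])
      (simp add: opnorm_scale mult_left_mono opnorm_le_cnorm F)
  show ?thesis
  proof (cases "c = 0")
    case True
    then show ?thesis using le[OF F, of c] cnorm_section_nonneg[OF equivariant_scale[OF F, of c]] by simp
  next
    case False
    have "cnorm B (section_of (\<lambda>z. mat (inverse c) ** (mat c ** F z))) \<le> cmod (inverse c) * cnorm B (section_of (\<lambda>z. mat c ** F z))"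
      by (rule le[OF equivariant_scale[OF F]])
    then have "cmod c * cnorm B (section_of F) \<le> cnorm B (section_of (\<lambda>z. mat c ** F z))"
      using False by (simp add: mat_scale_scale norm_divide field_simps)
    then show ?thesis using le[OF F, of c] by simp
  qed
qed

lemma section_complete:
  assumes X: "\<And>i. X i \<in> carrier B"
    and cauchy: "\<forall>e>0. \<exists>N. \<forall>i\<ge>N. \<forall>j\<ge>N. cnorm B (X i \<ominus>\<^bsub>B\<^esub> X j) < e"
  shows "\<exists>x\<in>carrier B. (\<lambda>i::nat. cnorm B (X i \<ominus>\<^bsub>B\<^esub> x)) \<longlonglongrightarrow> 0"
proof -
  have "\<forall>i. \<exists>F. F \<in> equivariant_maps \<and> X i = section_of F" using X carrierE by blast
  from choice[OF this] obtain F where F: "\<And>i. F i \<in> equivariant_maps" and XF: "\<And>i. X i = section_of (F i)"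
    by blast
  have uc: "uniformly_Cauchy_on PE F"
  proof (rule uniformly_Cauchy_onI)
    fix e :: real assume e: "0 < e"
    let ?K = "real (CARD('n) * CARD('n))"
    have K: "0 < ?K" by simp
    obtain N where N: "\<And>i j. i \<ge> N \<Longrightarrow> j \<ge> N \<Longrightarrow> cnorm B (X i \<ominus>\<^bsub>B\<^esub> X j) < e / ?K"
      using cauchy e K by (meson divide_pos_pos)
    show "\<exists>M. \<forall>x\<in>PE. \<forall>m\<ge>M. \<forall>n\<ge>M. dist (F m x) (F n x) < e"
    proof (intro exI[of _ N] ballI allI impI)
      fix z m n assume *: "z \<in> PE" "N \<le> m" "N \<le> n"
      have "norm (F m z - F n z) \<le> ?K * opnorm (F m z - F n z)" by (rule norm_le_opnorm)
      also have "opnorm (F m z - F n z) < e / ?K"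
        using opnorm_le_cnorm[OF equivariant_diff[OF F[of m] F[of n]] *(1)] N[OF *(2,3)]
        by (simp add: XF section_minus F)
      then have "?K * opnorm (F m z - F n z) < e" using K by (simp add: field_simps)
      finally show "dist (F m z) (F n z) < e" by (simp add: dist_norm)
    qed
  qed
  then obtain G where G: "uniform_limit PE F G sequentially"
    using Cauchy_uniformly_convergent uniformly_convergent_on_def by blast
  have pw: "(\<lambda>i. F i z) \<longlonglongrightarrow> G z" if "z \<in> PE" for z
    using tendsto_uniform_limitI[OF G that] .
  have Gm: "G \<in> equivariant_maps"
  proof (rule equivariant_mapsI)
    show "continuous_on PE G"
      using F by (intro uniform_limit_theorem[OF _ G]) (auto simp: equivariant_mapsD)
    fix z and k :: "complex^'n^'n" assume z: "z \<in> PE" and k: "unitary_mat k"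
    have "continuous_on UNIV (\<lambda>A::complex^'n^'n. mat_conj A k)"
      using k by (intro continuous_mat_conj continuous_intros) auto
    then have "(\<lambda>i. mat_conj (F i z) k) \<longlonglongrightarrow> mat_conj (G z) k"
      by (rule continuous_on_tendsto_compose[OF _ pw[OF z]]) simp_all
    then show "G (tuple_conj z k) = mat_conj (G z) k"
      using pw[OF PE_conj[OF z k]] LIMSEQ_unique by (simp add: equivariant_mapsD(2)[OF F z k])
  qed
  have "(\<lambda>i. cnorm B (X i \<ominus>\<^bsub>B\<^esub> section_of G)) \<longlonglongrightarrow> 0"
  proof (rule LIMSEQ_I)
    fix e :: real assume e: "0 < e"
    then have "\<forall>\<^sub>F i in sequentially. \<forall>z\<in>PE. dist (F i z) (G z) < e / 2"
      using uniform_limitD[OF G, of "e / 2"] by simp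
    then obtain N where N: "\<And>i z. i \<ge> N \<Longrightarrow> z \<in> PE \<Longrightarrow> dist (F i z) (G z) < e / 2"
      unfolding eventually_sequentially by blast
    show "\<exists>N. \<forall>i\<ge>N. norm (cnorm B (X i \<ominus>\<^bsub>B\<^esub> section_of G) - 0) < e"
    proof (intro exI[of _ N] allI impI)
      fix i assume i: "N \<le> i"
      note D = equivariant_diff[OF F[of i] Gm]
      have "cnorm B (section_of (\<lambda>z. F i z - G z)) \<le> e / 2"
      proof (rule cnorm_leI[OF D])
        fix z assume "z \<in> PE"
        from N[OF i this] show "opnorm (F i z - G z) \<le> e / 2"
          using opnorm_le_norm[of "F i z - G z"] by (simp add: dist_norm)
      qed
      then show "norm (cnorm B (X i \<ominus>\<^bsub>B\<^esub> section_of G) - 0) < e"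
        using e cnorm_section_nonneg[OF D] by (simp add: XF section_minus F Gm)
    qed
  qed
  then show ?thesis using section_closed[OF Gm] by blast
qed

lemma section_cstar_algebra: "unital_cstar_algebra B"
proof (intro unital_cstar_algebra.intro unital_cstar_algebra_axioms.intro)
  show "ring B" by (rule section_ring)
next
  fix x c assume "x \<in> carrier B"
  then obtain F where F: "F \<in> equivariant_maps" "x = section_of F" by (rule carrierE)
  show "scale B c x \<in> carrier B" using F by (simp add: section_scale section_closed equivariant_scale)
next
  fix x y c assume "x \<in> carrier B" "y \<in> carrier B"
  then obtain F G where F: "F \<in> equivariant_maps" "G \<in> equivariant_maps" "x = section_of F" "y = section_of G"
    by (metis carrierE)
  show "scale B c (x \<oplus>\<^bsub>B\<^esub> y) = scale B c x \<oplus>\<^bsub>B\<^esub> scale B c y"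
    using F by (simp add: section_scale section_add equivariant_scale equivariant_add matrix_add_ldistrib)
next
  fix x c d assume "x \<in> carrier B"
  then obtain F where F: "F \<in> equivariant_maps" "x = section_of F" by (rule carrierE)
  show "scale B (c + d) x = scale B c x \<oplus>\<^bsub>B\<^esub> scale B d x"
    using F by (simp add: section_scale section_add equivariant_scale mat_scale_add_left)
next
  fix x c d assume "x \<in> carrier B"
  then obtain F where F: "F \<in> equivariant_maps" "x = section_of F" by (rule carrierE)
  show "scale B c (scale B d x) = scale B (c * d) x"
    using F by (simp add: section_scale equivariant_scale mat_scale_scale)
next
  fix x assume "x \<in> carrier B"
  then obtain F where F: "F \<in> equivariant_maps" "x = section_of F" by (rule carrierE)
  show "scale B 1 x = x" using F by (simp add: section_scale)
next
  fix x y c assume "x \<in> carrier B" "y \<in> carrier B"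
  then obtain F G where F: "F \<in> equivariant_maps" "G \<in> equivariant_maps" "x = section_of F" "y = section_of G"
    by (metis carrierE)
  show "scale B c x \<otimes>\<^bsub>B\<^esub> y = scale B c (x \<otimes>\<^bsub>B\<^esub> y)"
    using F by (simp add: section_scale section_mult equivariant_scale equivariant_mult matrix_mul_assoc)
next
  fix x y c assume "x \<in> carrier B" "y \<in> carrier B"
  then obtain F G where F: "F \<in> equivariant_maps" "G \<in> equivariant_maps" "x = section_of F" "y = section_of G"
    by (metis carrierE)
  show "x \<otimes>\<^bsub>B\<^esub> scale B c y = scale B c (x \<otimes>\<^bsub>B\<^esub> y)"
    using F by (simp add: section_scale section_mult equivariant_scale equivariant_mult mat_scale_mult_right)
next
  fix x assume "x \<in> carrier B"
  then obtain F where F: "F \<in> equivariant_maps" "x = section_of F" by (rule carrierE)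
  show "star B x \<in> carrier B" "star B (star B x) = x"
    using F by (simp_all add: section_star section_closed equivariant_star)
next
  fix x y assume "x \<in> carrier B" "y \<in> carrier B"
  then obtain F G where F: "F \<in> equivariant_maps" "G \<in> equivariant_maps" "x = section_of F" "y = section_of G"
    by (metis carrierE)
  show "star B (x \<oplus>\<^bsub>B\<^esub> y) = star B x \<oplus>\<^bsub>B\<^esub> star B y"
    using F by (simp add: section_star section_add equivariant_star equivariant_add mat_star_add)
next
  fix x c assume "x \<in> carrier B"
  then obtain F where F: "F \<in> equivariant_maps" "x = section_of F" by (rule carrierE)
  show "star B (scale B c x) = scale B (cnj c) (star B x)"
    using F by (simp add: section_star section_scale equivariant_star equivariant_scale mat_star_scale)
next
  fix x y assume "x \<in> carrier B" "y \<in> carrier B"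
  then obtain F G where F: "F \<in> equivariant_maps" "G \<in> equivariant_maps" "x = section_of F" "y = section_of G"
    by (metis carrierE)
  show "star B (x \<otimes>\<^bsub>B\<^esub> y) = star B y \<otimes>\<^bsub>B\<^esub> star B x"
    using F by (simp add: section_star section_mult equivariant_star equivariant_mult mat_star_mult)
next
  fix x assume "x \<in> carrier B"
  then obtain F where F: "F \<in> equivariant_maps" "x = section_of F" by (rule carrierE)
  show "0 \<le> cnorm B x" using F by (simp add: cnorm_section_nonneg)
  show "(cnorm B x = 0) = (x = \<zero>\<^bsub>B\<^esub>)"
  proof
    assume "cnorm B x = 0"
    then have "F z = 0" if "z \<in> PE" for z
      using opnorm_le_cnorm[OF F(1) that] opnorm_nonneg[of "F z"] F(2) by (simp add: opnorm_eq_0)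
    then show "x = \<zero>\<^bsub>B\<^esub>"
      using F by (simp add: section_zero induced_section_eq_iff equivariant_zero)
  next
    assume "x = \<zero>\<^bsub>B\<^esub>"
    then show "cnorm B x = 0"
      using cnorm_leI[OF equivariant_zero, of 0] cnorm_section_nonneg[OF equivariant_zero]
      by (simp add: section_zero)
  qed
next
  fix x y assume "x \<in> carrier B" "y \<in> carrier B"
  then obtain F G where F: "F \<in> equivariant_maps" "G \<in> equivariant_maps" "x = section_of F" "y = section_of G"
    by (metis carrierE)
  have "cnorm B (section_of (\<lambda>z. F z + G z)) \<le> cnorm B x + cnorm B y"
  proof (rule cnorm_leI[OF equivariant_add[OF F(1,2)]])
    fix z assume z: "z \<in> PE"
    show "opnorm (F z + G z) \<le> cnorm B x + cnorm B y"
      using opnorm_add[of "F z" "G z"] opnorm_le_cnorm[OF F(1) z] opnorm_le_cnorm[OF F(2) z] F(3,4) by simp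
  qed
  then show "cnorm B (x \<oplus>\<^bsub>B\<^esub> y) \<le> cnorm B x + cnorm B y" using F by (simp add: section_add)
next
  fix x c assume "x \<in> carrier B"
  then obtain F where F: "F \<in> equivariant_maps" "x = section_of F" by (rule carrierE)
  show "cnorm B (scale B c x) = cmod c * cnorm B x"
    using F by (simp add: section_scale cnorm_section_scale)
next
  fix x y assume "x \<in> carrier B" "y \<in> carrier B"
  then obtain F G where F: "F \<in> equivariant_maps" "G \<in> equivariant_maps" "x = section_of F" "y = section_of G"
    by (metis carrierE)
  have "cnorm B (section_of (\<lambda>z. F z ** G z)) \<le> cnorm B x * cnorm B y"
  proof (rule cnorm_leI[OF equivariant_mult[OF F(1,2)]])
    fix z assume z: "z \<in> PE"
    have "opnorm (F z) * opnorm (G z) \<le> cnorm B x * cnorm B y"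
      using opnorm_le_cnorm[OF F(1) z] opnorm_le_cnorm[OF F(2) z] F(3,4)
      by (intro mult_mono opnorm_nonneg) (simp_all add: cnorm_section_nonneg F)
    then show "opnorm (F z ** G z) \<le> cnorm B x * cnorm B y"
      using opnorm_mult order_trans by blast
  qed
  then show "cnorm B (x \<otimes>\<^bsub>B\<^esub> y) \<le> cnorm B x * cnorm B y" using F by (simp add: section_mult)
next
  fix x assume "x \<in> carrier B"
  then obtain F where F: "F \<in> equivariant_maps" "x = section_of F" by (rule carrierE)
  note M = equivariant_mult[OF equivariant_star[OF F(1)] F(1)]
  have "cnorm B (section_of (\<lambda>z. mat_star (F z) ** F z)) = (cnorm B x)\<^sup>2"
  proof (rule antisym)
    show "cnorm B (section_of (\<lambda>z. mat_star (F z) ** F z)) \<le> (cnorm B x)\<^sup>2"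
      using opnorm_le_cnorm[OF F(1)] F(2)
      by (intro cnorm_leI[OF M]) (simp add: opnorm_star_mult power_mono opnorm_nonneg)
    have "cnorm B x \<le> sqrt (cnorm B (section_of (\<lambda>z. mat_star (F z) ** F z)))"
      unfolding F(2)
    proof (rule cnorm_leI[OF F(1)])
      fix z assume "z \<in> PE"
      from opnorm_le_cnorm[OF M this]
      show "opnorm (F z) \<le> sqrt (cnorm B (section_of (\<lambda>z. mat_star (F z) ** F z)))"
        by (simp add: opnorm_star_mult real_le_rsqrt)
    qed
    then have "(cnorm B x)\<^sup>2 \<le> (sqrt (cnorm B (section_of (\<lambda>z. mat_star (F z) ** F z))))\<^sup>2"
      using cnorm_section_nonneg[OF F(1)] F(2) by (intro power_mono) auto
    then show "(cnorm B x)\<^sup>2 \<le> cnorm B (section_of (\<lambda>z. mat_star (F z) ** F z))"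
      using cnorm_section_nonneg[OF M] by simp
  qed
  then show "cnorm B (star B x \<otimes>\<^bsub>B\<^esub> x) = (cnorm B x)\<^sup>2"
    using F by (simp add: section_star section_mult equivariant_star)
next
  fix X :: "nat \<Rightarrow> ('d, 'n) quot_point \<Rightarrow> ('d, 'n) bundle_point"
  assume "\<And>i. X i \<in> carrier B" "\<forall>e>0. \<exists>N. \<forall>i\<ge>N. \<forall>j\<ge>N. cnorm B (X i \<ominus>\<^bsub>B\<^esub> X j) < e"
  then show "\<exists>x\<in>carrier B. (\<lambda>i. cnorm B (X i \<ominus>\<^bsub>B\<^esub> x)) \<longlonglongrightarrow> 0" by (rule section_complete)
qed

section \<open>The tracial function algebra\<close>

abbreviation A :: "(('d, 'n) quot_point \<Rightarrow> ('d, 'n) bundle_point) set" where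
  "A \<equiv> tracial_function_algebra P E"

text \<open>Norm closures of sets of sections, in terms of uniform approximation over \<open>PE\<close>.\<close>

lemma norm_closure_iff:
  assumes F: "F \<in> equivariant_maps" and S: "S \<subseteq> equivariant_maps"
  shows "section_of F \<in> norm_closure B (section_of ` S) \<longleftrightarrow>
    (\<forall>e>0. \<exists>G\<in>S. \<forall>z\<in>PE. opnorm (F z - G z) \<le> e)"
proof
  assume *: "section_of F \<in> norm_closure B (section_of ` S)"
  show "\<forall>e>0. \<exists>G\<in>S. \<forall>z\<in>PE. opnorm (F z - G z) \<le> e"
  proof (intro allI impI)
    fix e :: real assume "0 < e"
    with * obtain G where G: "G \<in> S" "cnorm B (section_of F \<ominus>\<^bsub>B\<^esub> section_of G) < e"
      unfolding norm_closure_def by blast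
    have Gm: "G \<in> equivariant_maps" using G(1) S by blast
    have "opnorm (F z - G z) \<le> e" if "z \<in> PE" for z
      using opnorm_le_cnorm[OF equivariant_diff[OF F Gm] that] G(2) by (simp add: section_minus F Gm)
    then show "\<exists>G\<in>S. \<forall>z\<in>PE. opnorm (F z - G z) \<le> e" using G(1) by blast
  qed
next
  assume *: "\<forall>e>0. \<exists>G\<in>S. \<forall>z\<in>PE. opnorm (F z - G z) \<le> e"
  have "\<exists>a\<in>section_of ` S. cnorm B (section_of F \<ominus>\<^bsub>B\<^esub> a) < e" if e: "0 < e" for e
  proof -
    obtain G where G: "G \<in> S" "\<And>z. z \<in> PE \<Longrightarrow> opnorm (F z - G z) \<le> e / 2"
      using * e by (meson half_gt_zero)
    have Gm: "G \<in> equivariant_maps" using G(1) S by blast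
    have "cnorm B (section_of F \<ominus>\<^bsub>B\<^esub> section_of G) \<le> e / 2"
      unfolding section_minus[OF F Gm] using G(2) by (rule cnorm_leI[OF equivariant_diff[OF F Gm]])
    then show ?thesis using G(1) e by (intro bexI[of _ "section_of G"]) auto
  qed
  then show "section_of F \<in> norm_closure B (section_of ` S)"
    using section_closed[OF F] by (simp add: norm_closure_def)
qed

lemma mem_tracial_iff:
  "F \<in> equivariant_maps \<Longrightarrow>
    section_of F \<in> A \<longleftrightarrow> (\<forall>e>0. \<exists>\<phi>\<in>trace_algebra. \<forall>z\<in>PE. opnorm (F z - \<phi> z) \<le> e)"
  unfolding tracial_function_algebra_def by (rule norm_closure_iff) (auto intro: equivariant_trace)

lemma trace_in_tracial: "\<phi> \<in> trace_algebra \<Longrightarrow> section_of \<phi> \<in> A"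
  unfolding mem_tracial_iff[OF equivariant_trace] by (auto intro!: bexI[of _ \<phi>])

lemma trace_algebra_ops:
  "(\<lambda>_. mat 1) \<in> trace_algebra"
  "\<phi> \<in> trace_algebra \<Longrightarrow> \<psi> \<in> trace_algebra \<Longrightarrow> (\<lambda>z. \<phi> z + \<psi> z) \<in> trace_algebra"
  "\<phi> \<in> trace_algebra \<Longrightarrow> \<psi> \<in> trace_algebra \<Longrightarrow> (\<lambda>z. \<phi> z ** \<psi> z) \<in> trace_algebra"
  "\<phi> \<in> trace_algebra \<Longrightarrow> (\<lambda>z. mat c ** \<phi> z) \<in> trace_algebra"
  unfolding trace_algebra_def by (fact fun_subalgebra.intros)+

lemma tracial_subset: "A \<subseteq> carrier B"
  by (auto simp: tracial_function_algebra_def norm_closure_def)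

lemma tracial_closed_subalgebra: "closed_unital_subalgebra B A"
  unfolding closed_unital_subalgebra_def
proof (intro conjI ballI allI)
  show "A \<subseteq> carrier B" by (rule tracial_subset)
  show "\<one>\<^bsub>B\<^esub> \<in> A" unfolding section_one by (rule trace_in_tracial[OF trace_algebra_ops(1)])
next
  fix x y assume x: "x \<in> A" and y: "y \<in> A"
  obtain F where F: "F \<in> equivariant_maps" "x = section_of F" using x tracial_subset carrierE by blast
  obtain G where G: "G \<in> equivariant_maps" "y = section_of G" using y tracial_subset carrierE by blast
  have apx: "\<exists>\<phi>\<in>trace_algebra. \<forall>z\<in>PE. opnorm (F z - \<phi> z) \<le> e"
      "\<exists>\<phi>\<in>trace_algebra. \<forall>z\<in>PE. opnorm (G z - \<phi> z) \<le> e" if "0 < e" for e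
    using x y that unfolding F(2) G(2) mem_tracial_iff[OF F(1)] mem_tracial_iff[OF G(1)] by blast+
  show "x \<oplus>\<^bsub>B\<^esub> y \<in> A"
    unfolding F(2) G(2) section_add[OF F(1) G(1)] mem_tracial_iff[OF equivariant_add[OF F(1) G(1)]]
  proof (intro allI impI)
    fix e :: real assume e: "0 < e"
    obtain \<phi> where \<phi>: "\<phi> \<in> trace_algebra" "\<And>z. z \<in> PE \<Longrightarrow> opnorm (F z - \<phi> z) \<le> e / 2"
      using apx(1)[of "e / 2"] e by auto
    obtain \<psi> where \<psi>: "\<psi> \<in> trace_algebra" "\<And>z. z \<in> PE \<Longrightarrow> opnorm (G z - \<psi> z) \<le> e / 2"
      using apx(2)[of "e / 2"] e by auto
    have "opnorm (F z + G z - (\<phi> z + \<psi> z)) \<le> e" if "z \<in> PE" for z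
      using opnorm_add[of "F z - \<phi> z" "G z - \<psi> z"] \<phi>(2)[OF that] \<psi>(2)[OF that]
      by (simp add: algebra_simps)
    then show "\<exists>\<phi>\<in>trace_algebra. \<forall>z\<in>PE. opnorm (F z + G z - \<phi> z) \<le> e"
      by (intro bexI[OF _ trace_algebra_ops(2)[OF \<phi>(1) \<psi>(1)]]) blast
  qed
  show "x \<otimes>\<^bsub>B\<^esub> y \<in> A"
    unfolding F(2) G(2) section_mult[OF F(1) G(1)] mem_tracial_iff[OF equivariant_mult[OF F(1) G(1)]]
  proof (intro allI impI)
    fix e :: real assume e: "0 < e"
    define a where "a = cnorm B (section_of F)"
    define b where "b = cnorm B (section_of G)"
    have ab: "0 \<le> a" "0 \<le> b" using cnorm_section_nonneg F G by (auto simp: a_def b_def)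
    define d where "d = min 1 (e / (a + b + 1))"
    have d: "0 < d" "d \<le> 1" using ab e by (auto simp: d_def)
    have de: "a * d + d * (b + 1) \<le> e"
    proof -
      have "d \<le> e / (a + b + 1)" "0 < a + b + 1" using ab by (auto simp: d_def)
      then have "d * (a + b + 1) \<le> e" by (simp only: pos_le_divide_eq)
      then show ?thesis by (simp add: algebra_simps)
    qed
    obtain \<phi> where \<phi>: "\<phi> \<in> trace_algebra" "\<And>z. z \<in> PE \<Longrightarrow> opnorm (F z - \<phi> z) \<le> d"
      using apx(1)[OF d(1)] by auto
    obtain \<psi> where \<psi>: "\<psi> \<in> trace_algebra" "\<And>z. z \<in> PE \<Longrightarrow> opnorm (G z - \<psi> z) \<le> d"
      using apx(2)[OF d(1)] by auto
    have "opnorm (F z ** G z - \<phi> z ** \<psi> z) \<le> e" if z: "z \<in> PE" for z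
    proof -
      have 1: "F z ** G z - \<phi> z ** \<psi> z = F z ** (G z - \<psi> z) + (F z - \<phi> z) ** \<psi> z"
        by (simp add: diff_conv_add_uminus matrix_add_ldistrib matrix_add_rdistrib matrix_mult_minus
            del: add_uminus_conv_diff)
      have "opnorm (\<psi> z) \<le> opnorm (G z) + opnorm (\<psi> z - G z)"
        using opnorm_add[of "G z" "\<psi> z - G z"] by simp
      then have 2: "opnorm (\<psi> z) \<le> b + 1"
        using opnorm_le_cnorm[OF G(1) z] \<psi>(2)[OF z] d(2) opnorm_minus_commute[of "\<psi> z" "G z"]
        by (simp add: b_def)
      have "opnorm (F z ** G z - \<phi> z ** \<psi> z) \<le> opnorm (F z) * opnorm (G z - \<psi> z) + opnorm (F z - \<phi> z) * opnorm (\<psi> z)"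
        unfolding 1 by (intro order_trans[OF opnorm_add] add_mono opnorm_mult)
      also have "\<dots> \<le> a * d + d * (b + 1)"
        using opnorm_le_cnorm[OF F(1) z] \<phi>(2)[OF z] \<psi>(2)[OF z] 2 ab d
        by (intro add_mono mult_mono opnorm_nonneg) (auto simp: a_def)
      finally show ?thesis using de by linarith
    qed
    then show "\<exists>\<phi>\<in>trace_algebra. \<forall>z\<in>PE. opnorm (F z ** G z - \<phi> z) \<le> e"
      by (intro bexI[OF _ trace_algebra_ops(3)[OF \<phi>(1) \<psi>(1)]]) blast
  qed
next
  fix c x assume x: "x \<in> A"
  obtain F where F: "F \<in> equivariant_maps" "x = section_of F" using x tracial_subset carrierE by blast
  show "scale B c x \<in> A"
    unfolding F(2) section_scale[OF F(1)] mem_tracial_iff[OF equivariant_scale[OF F(1)]]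
  proof (intro allI impI)
    fix e :: real assume e: "0 < e"
    have p: "0 < cmod c + 1" by (simp add: add_nonneg_pos)
    obtain \<phi> where \<phi>: "\<phi> \<in> trace_algebra" "\<And>z. z \<in> PE \<Longrightarrow> opnorm (F z - \<phi> z) \<le> e / (cmod c + 1)"
      using x e p unfolding F(2) mem_tracial_iff[OF F(1)] by (meson divide_pos_pos)
    have "opnorm (mat c ** F z - mat c ** \<phi> z) \<le> e" if z: "z \<in> PE" for z
    proof -
      have "mat c ** F z - mat c ** \<phi> z = mat c ** (F z - \<phi> z)"
        by (simp add: mat_scale_diff)
      then have "opnorm (mat c ** F z - mat c ** \<phi> z) = cmod c * opnorm (F z - \<phi> z)"
        by (simp add: opnorm_scale)
      also have "\<dots> \<le> (cmod c + 1) * (e / (cmod c + 1))"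
        using \<phi>(2)[OF z] p by (intro mult_mono) (auto simp: opnorm_nonneg)
      also have "\<dots> = e" using p by simp
      finally show ?thesis .
    qed
    then show "\<exists>\<phi>\<in>trace_algebra. \<forall>z\<in>PE. opnorm (mat c ** F z - \<phi> z) \<le> e"
      by (intro bexI[OF _ trace_algebra_ops(4)[OF \<phi>(1)]]) blast
  qed
next
  show "norm_closure B A \<subseteq> A"
  proof
    fix x assume x: "x \<in> norm_closure B A"
    then obtain F where F: "F \<in> equivariant_maps" "x = section_of F"
      unfolding norm_closure_def using carrierE by blast
    show "x \<in> A"
      unfolding F(2) mem_tracial_iff[OF F(1)]
    proof (intro allI impI)
      fix e :: real assume e: "0 < e"
      obtain y where y: "y \<in> A" "cnorm B (x \<ominus>\<^bsub>B\<^esub> y) < e / 2"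
        using x half_gt_zero[OF e] unfolding norm_closure_def by blast
      obtain G where G: "G \<in> equivariant_maps" "y = section_of G" using y(1) tracial_subset carrierE by blast
      have 1: "opnorm (F z - G z) \<le> e / 2" if "z \<in> PE" for z
        using opnorm_le_cnorm[OF equivariant_diff[OF F(1) G(1)] that] y(2)
        by (simp add: F(2) G(2) section_minus F(1) G(1))
      obtain \<phi> where \<phi>: "\<phi> \<in> trace_algebra" "\<And>z. z \<in> PE \<Longrightarrow> opnorm (G z - \<phi> z) \<le> e / 2"
        using y(1) e unfolding G(2) mem_tracial_iff[OF G(1)] by (meson half_gt_zero)
      have "opnorm (F z - \<phi> z) \<le> e" if "z \<in> PE" for z
        using opnorm_add[of "F z - G z" "G z - \<phi> z"] 1[OF that] \<phi>(2)[OF that] by simp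
      then show "\<exists>\<phi>\<in>trace_algebra. \<forall>z\<in>PE. opnorm (F z - \<phi> z) \<le> e" using \<phi>(1) by blast
    qed
  qed
qed

subsection \<open>Generation\<close>

text \<open>
  An invariant continuous function on \<open>PE\<close> is a continuous function of the base point.
\<close>

lemma descend_invariant_function:
  fixes g :: "complex^'n^'n^'d \<Rightarrow> 'b::topological_space"
  assumes g: "continuous_on PE g" and inv: "\<And>z k. z \<in> PE \<Longrightarrow> unitary_mat k \<Longrightarrow> g (tuple_conj z k) = g z"
  shows "\<exists>f. continuous_on E f \<and> (\<forall>z\<in>PE. f (quot_map z) = g z)"
proof -
  define f where "f u = g (SOME z. z \<in> PE \<and> quot_map z = u)" for u
  have f: "f (quot_map z) = g z" if z: "z \<in> PE" for z
  proof -
    define w where "w = (SOME w. w \<in> PE \<and> quot_map w = quot_map z)"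
    have w: "w \<in> PE \<and> quot_map w = quot_map z" unfolding w_def by (rule someI) (use z in simp)
    then obtain k where "unitary_mat k" "w = tuple_conj z k" using P_orbit[of z w] PE_P z by metis
    then show ?thesis using inv[OF z] by (simp add: f_def w_def[symmetric])
  qed
  have "continuous_map (top_of_set PE) euclidean (f \<circ> quot_map)"
  proof (rule continuous_map_eq)
    show "continuous_map (top_of_set PE) euclidean g" using g by simp
  qed (simp add: f)
  then have "continuous_map (top_of_set E) euclidean f"
    using PE_quotient continuous_compose_quotient_map by blast
  then show ?thesis using f by auto
qed

lemma E_compact: "compact E"
proof -
  have "E = quot_map ` PE" using E_obtain PE_E by blast
  then show ?thesis using compact_continuous_image[OF continuous_on_quot_map compact_PE] by metis
qed

text \<open>
  Let \<open>C\<close> be a closed self-adjoint subalgebra that contains \<open>A\<close>, and \<open>S\<close> the set of equivariant maps of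
  its sections.  The Stone-Weierstrass theorem puts all real scalar functions on \<open>E\<close> into \<open>S\<close>.  A general
  \<open>F\<close> agrees at each point \<open>t\<close> with some trace polynomial \<open>\<phi> t\<close>; the functions
  \<open>h t = max 0 (e - \<parallel>F - \<phi> t\<parallel>)\<close>, for finitely many \<open>t\<close> and normalised by their sum, form a partition of unity
  that is supported where \<open>\<phi> t\<close> is close to \<open>F\<close>.
\<close>

lemma tracial_generates: "generates_cstar B A"
  unfolding generates_cstar_def
proof (intro allI impI, elim conjE)
  fix C assume AC: "A \<subseteq> C" and C: "closed_unital_subalgebra B C" and starC: "\<forall>x\<in>C. star B x \<in> C"
  define S where "S = {F \<in> equivariant_maps. section_of F \<in> C}"
  have SE: "S \<subseteq> equivariant_maps" and SC: "section_of ` S \<subseteq> C" by (auto simp: S_def)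
  have S_trace: "\<phi> \<in> S" if "\<phi> \<in> trace_algebra" for \<phi>
    using that AC trace_in_tracial equivariant_trace by (auto simp: S_def)
  have S_add: "(\<lambda>z. F z + G z) \<in> S" if "F \<in> S" "G \<in> S" for F G
    using that C by (auto simp: S_def closed_unital_subalgebra_def equivariant_add section_add[symmetric])
  have S_mult: "(\<lambda>z. F z ** G z) \<in> S" if "F \<in> S" "G \<in> S" for F G
    using that C by (auto simp: S_def closed_unital_subalgebra_def equivariant_mult section_mult[symmetric])
  have S_scale: "(\<lambda>z. mat c ** F z) \<in> S" if "F \<in> S" for F c
    using that C by (auto simp: S_def closed_unital_subalgebra_def equivariant_scale section_scale[symmetric])
  have S_star: "(\<lambda>z. mat_star (F z)) \<in> S" if "F \<in> S" for F
    using that starC by (auto simp: S_def equivariant_star section_star[symmetric])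
  have S_one: "(\<lambda>_. mat 1) \<in> S" by (rule S_trace[OF trace_algebra_ops(1)])
  have S_sum: "(\<lambda>z. \<Sum>i\<in>I. F i z) \<in> S" if "\<And>i. i \<in> I \<Longrightarrow> F i \<in> S" for F and I :: "'i set"
    using that
  proof (induction I rule: infinite_finite_induct)
    case (insert i I)
    then show ?case using S_add[of "F i" "\<lambda>z. \<Sum>i\<in>I. F i z"] by simp
  qed (use S_scale[OF S_one, of 0] in simp_all)
  have S_lim: "F \<in> S" if F: "F \<in> equivariant_maps"
    and ap: "\<And>e. 0 < e \<Longrightarrow> \<exists>G\<in>S. \<forall>z\<in>PE. opnorm (F z - G z) \<le> e" for F
  proof -
    have "section_of F \<in> norm_closure B (section_of ` S)"
      unfolding norm_closure_iff[OF F SE] using ap by blast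
    then have "section_of F \<in> norm_closure B C" using SC by (auto simp: norm_closure_def) blast
    then have "section_of F \<in> C" using C by (auto simp: closed_unital_subalgebra_def)
    then show ?thesis using F by (simp add: S_def)
  qed
  define R where "R = {r. continuous_on E r \<and> (\<lambda>z. mat (complex_of_real (r (quot_map z)))) \<in> S}"
  obtain j :: "('d, 'n) quot_point \<Rightarrow> nat \<Rightarrow> complex"
    where j: "continuous_on UNIV j" "inj_on j (range quot_map)" using quot_embedding by blast
  have Er: "E \<subseteq> range quot_map" using E_subset by blast
  have scalar: "(\<lambda>z. mat (complex_of_real (f (quot_map z)))) \<in> S" if f: "continuous_on E f" for f
  proof (rule S_lim)
    have "continuous_on E (\<lambda>u. complex_of_real (f u))" using f by (intro continuous_intros)
    then show "(\<lambda>z. mat (complex_of_real (f (quot_map z)))) \<in> equivariant_maps" by (rule equivariant_scalar)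
    fix e :: real assume e: "0 < e"
    have "\<exists>r\<in>R. \<forall>x\<in>E. \<bar>f x - r x\<bar> < e"
    proof (rule Stone_Weierstrass_of_embedding[where j = j, OF E_compact _ _ _ _ _ _ _ f e])
      show "continuous_on E j" using j(1) continuous_on_subset by blast
      show "inj_on j E" using j(2) Er inj_on_subset by blast
      show "continuous_on E r" if "r \<in> R" for r using that by (simp add: R_def)
      show "(\<lambda>_. c) \<in> R" for c using S_scale[OF S_one, of "of_real c"] by (simp add: R_def)
      show "(\<lambda>x. r x + s x) \<in> R" if "r \<in> R" "s \<in> R" for r s
        using that S_add[of "\<lambda>z. mat (complex_of_real (r (quot_map z)))" "\<lambda>z. mat (complex_of_real (s (quot_map z)))"]
        by (auto simp: R_def mat_add intro!: continuous_intros)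
      show "(\<lambda>x. r x * s x) \<in> R" if "r \<in> R" "s \<in> R" for r s
        using that S_mult[of "\<lambda>z. mat (complex_of_real (r (quot_map z)))" "\<lambda>z. mat (complex_of_real (s (quot_map z)))"]
        by (auto simp: R_def mat_mult_mat intro!: continuous_intros)
      show "\<exists>r\<in>R. r x \<noteq> r y" if x: "x \<in> E" and y: "y \<in> E" and ne: "x \<noteq> y" for x y
      proof -
        have Re_R: "(\<lambda>x. Re (x p)) \<in> R" if p: "p \<in> invariants" for p
        proof -
          let ?F = "\<lambda>z. mat (p z) :: complex^'n^'n"
          have F: "?F \<in> S" by (rule S_trace[OF invariant_in_trace_algebra[OF p]])
          have "mat (1/2) ** (mat (p z) + mat_star (mat (p z))) = (mat (complex_of_real (Re (quot_map z p))) :: complex^'n^'n)" for z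
          proof -
            have "1/2 * (p z + cnj (p z)) = complex_of_real (Re (p z))"
              by (simp add: complex_add_cnj)
            then show ?thesis by (simp add: mat_add[symmetric] mat_mult_mat quot_map_apply p)
          qed
          then have "(\<lambda>z. mat (complex_of_real (Re (quot_map z p)))) \<in> S"
            using S_scale[OF S_add[OF F S_star[OF F]], of "1/2"] by simp
          moreover have "continuous_on E (\<lambda>x. Re (x p))"
            by (intro continuous_on_Re continuous_on_subset[OF continuous_on_product_coordinates]) simp
          ultimately show ?thesis by (simp add: R_def)
        qed
        obtain z w where zw: "x = quot_map z" "y = quot_map w" using x y Er by blast
        obtain p where "x p \<noteq> y p" using ne by blast
        then have p: "p \<in> invariants" "p z \<noteq> p w" by (auto simp: zw quot_map_def split: if_splits)
        have q: "(\<lambda>z. - \<i> * p z) \<in> invariants" by (rule invariants_mult[OF invariants_const p(1)])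
        show ?thesis
        proof (cases "Re (p z) = Re (p w)")
          case False
          then show ?thesis using Re_R[OF p(1)] by (intro bexI[OF _ Re_R[OF p(1)]]) (simp add: zw quot_map_apply p)
        next
          case True
          then have "Im (p z) \<noteq> Im (p w)" using p(2) complex_eq_iff by blast
          then show ?thesis
            by (intro bexI[OF _ Re_R[OF q]]) (unfold zw quot_map_apply[OF q], simp)
        qed
      qed
    qed
    then obtain r where r: "r \<in> R" "\<forall>x\<in>E. \<bar>f x - r x\<bar> < e" by blast
    have "opnorm (mat (complex_of_real (f (quot_map z))) - mat (complex_of_real (r (quot_map z))) :: complex^'n^'n) \<le> e"
      if "z \<in> PE" for z
    proof -
      have "mat (complex_of_real (f (quot_map z))) - mat (complex_of_real (r (quot_map z))) =
          (mat (complex_of_real (f (quot_map z) - r (quot_map z))) :: complex^'n^'n)"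
        by (simp add: mat_diff)
      then show ?thesis using r(2) PE_E[OF that] by (simp add: opnorm_mat less_imp_le del: of_real_diff)
    qed
    then show "\<exists>G\<in>S. \<forall>z\<in>PE. opnorm (mat (complex_of_real (f (quot_map z))) - G z) \<le> e"
      using r(1) by (intro bexI[of _ "\<lambda>z. mat (complex_of_real (r (quot_map z)))"]) (auto simp: R_def)
  qed
  have "F \<in> S" if F: "F \<in> equivariant_maps" for F
  proof (rule S_lim[OF F])
    fix e :: real assume e: "0 < e"
    have "\<forall>z\<in>PE. \<exists>\<phi>. \<phi> \<in> trace_algebra \<and> \<phi> z = F z"
      using generic_matrices_onto PE_gen generic_in_trace_algebra by meson
    from bchoice[OF this] obtain \<phi> where \<phi>: "\<And>z. z \<in> PE \<Longrightarrow> \<phi> z \<in> trace_algebra" "\<And>z. z \<in> PE \<Longrightarrow> \<phi> z z = F z"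
      by blast
    define h where "h t w = max 0 (e - opnorm (F w - \<phi> t w))" for t w
    have D: "(\<lambda>w. F w - \<phi> t w) \<in> equivariant_maps" if "t \<in> PE" for t
      by (rule equivariant_diff[OF F equivariant_trace[OF \<phi>(1)[OF that]]])
    have hc: "continuous_on PE (h t)" if "t \<in> PE" for t
      unfolding h_def by (intro continuous_on_max continuous_on_const
        continuous_on_diff[OF continuous_on_const continuous_on_opnorm] equivariant_mapsD(1)[OF D[OF that]])
    have hinv: "h t (tuple_conj w k) = h t w" if "t \<in> PE" "w \<in> PE" "unitary_mat k" for t w k
      unfolding h_def using equivariant_mapsD(2)[OF D[OF that(1)] that(2,3)] opnorm_conj[OF that(3)] by simp
    have h0: "0 \<le> h t w" for t w by (simp add: h_def)
    define U where "U t = {w \<in> PE. 0 < h t w}" for t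
    have "openin (top_of_set PE) (U t)" if "t \<in> PE" for t
    proof -
      have "openin (top_of_set PE) (PE \<inter> h t -` {0<..})"
        by (intro continuous_openin_preimage_gen[OF hc[OF that]]) auto
      moreover have "PE \<inter> h t -` {0<..} = U t" by (auto simp: U_def)
      ultimately show ?thesis by simp
    qed
    moreover have "t \<in> U t" if "t \<in> PE" for t using that \<phi>(2)[OF that] e by (simp add: U_def h_def)
    ultimately have "\<exists>D\<subseteq>U ` PE. finite D \<and> PE \<subseteq> \<Union>D"
      using compact_PE unfolding compact_eq_openin_cover by (elim allE[of _ "U ` PE"]) blast
    then obtain T where T: "T \<subseteq> PE" "finite T" "PE \<subseteq> \<Union>(U ` T)"
      by (metis finite_subset_image)
    define s where "s w = (\<Sum>t\<in>T. h t w)" for w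
    have s_pos: "0 < s w" if w: "w \<in> PE" for w
    proof -
      obtain t where t: "t \<in> T" "0 < h t w" using T(3) w by (auto simp: U_def)
      have "h t w \<le> s w" unfolding s_def using T(2) t(1) h0 by (intro member_le_sum) auto
      then show ?thesis using t(2) by simp
    qed
    have "\<exists>f. continuous_on E f \<and> (\<forall>w\<in>PE. f (quot_map w) = h t w / s w)" if t: "t \<in> T" for t
    proof (rule descend_invariant_function)
      have tP: "t \<in> PE" using t T(1) by blast
      have "continuous_on PE s" unfolding s_def using hc T(1) by (intro continuous_on_sum) auto
      then show "continuous_on PE (\<lambda>w. h t w / s w)"
        using hc[OF tP] s_pos by (intro continuous_on_divide) force+
      fix w and k :: "complex^'n^'n" assume w: "w \<in> PE" and k: "unitary_mat k"
      have "s (tuple_conj w k) = s w"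
        unfolding s_def using hinv[OF _ w k] T(1) by (intro sum.cong) auto
      then show "h t (tuple_conj w k) / s (tuple_conj w k) = h t w / s w" using hinv[OF tP w k] by simp
    qed
    then have "\<forall>t\<in>T. \<exists>f. continuous_on E f \<and> (\<forall>w\<in>PE. f (quot_map w) = h t w / s w)" by blast
    from bchoice[OF this] obtain f where fc: "\<And>t. t \<in> T \<Longrightarrow> continuous_on E (f t)"
      and f: "\<And>t w. t \<in> T \<Longrightarrow> w \<in> PE \<Longrightarrow> f t (quot_map w) = h t w / s w" by blast
    define G where "G w = (\<Sum>t\<in>T. mat (complex_of_real (f t (quot_map w))) ** \<phi> t w)" for w
    have "G \<in> S"
      unfolding G_def using T(1) by (intro S_sum S_mult scalar fc S_trace \<phi>) auto
    moreover have "opnorm (F z - G z) \<le> e" if z: "z \<in> PE" for z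
    proof -
      have sum1: "(\<Sum>t\<in>T. f t (quot_map z)) = 1"
        using f[OF _ z] s_pos[OF z] by (simp add: s_def flip: sum_divide_distrib)
      have "F z = (\<Sum>t\<in>T. mat (complex_of_real (f t (quot_map z))) ** F z)"
        unfolding sum_mat_scale of_real_sum[symmetric] sum1 by simp
      then have "F z - G z = (\<Sum>t\<in>T. mat (complex_of_real (f t (quot_map z))) ** (F z - \<phi> t z))"
        by (simp add: G_def mat_scale_diff sum_subtractf)
      then have "opnorm (F z - G z) \<le> (\<Sum>t\<in>T. opnorm (mat (complex_of_real (f t (quot_map z))) ** (F z - \<phi> t z)))"
        by (simp add: opnorm_sum)
      also have "\<dots> \<le> (\<Sum>t\<in>T. f t (quot_map z) * e)"
      proof (rule sum_mono)
        fix t assume t: "t \<in> T"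
        have "h t z * opnorm (F z - \<phi> t z) \<le> h t z * e"
          using h0[of t z] by (cases "h t z = 0") (auto simp: h_def max_def split: if_splits intro!: mult_left_mono)
        then have "h t z / s z * opnorm (F z - \<phi> t z) \<le> h t z / s z * e"
          using s_pos[OF z] by (simp add: divide_right_mono)
        then show "opnorm (mat (complex_of_real (f t (quot_map z))) ** (F z - \<phi> t z)) \<le> f t (quot_map z) * e"
          using f[OF t z] h0[of t z] s_pos[OF z] by (simp add: opnorm_scale norm_divide)
      qed
      also have "\<dots> = e" using sum1 by (simp add: sum_distrib_right[symmetric])
      finally show ?thesis .
    qed
    ultimately show "\<exists>G\<in>S. \<forall>z\<in>PE. opnorm (F z - G z) \<le> e" by blast
  qed
  then have "carrier B \<subseteq> C" using carrierE by (metis (no_types, lifting) S_def mem_Collect_eq subsetI)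
  then show "C = carrier B" using C by (auto simp: closed_unital_subalgebra_def)
qed

section \<open>The boundary representation\<close>

lemma eval_irreducible:
  assumes z0: "z0 \<in> PE"
  shows "irreducible_representation B (eval_rep z0 (quot_map z0))"
proof -
  let ?\<rho> = "eval_rep z0 (quot_map z0)"
  have \<rho>: "?\<rho> (section_of F) = F z0" if "F \<in> equivariant_maps" for F
    using eval_rep_induced[OF that z0] .
  have "linear_into_mat B ?\<rho>"
    unfolding linear_into_mat_def
  proof (intro conjI ballI allI)
    fix x y assume "x \<in> carrier B" "y \<in> carrier B"
    then obtain F G where "F \<in> equivariant_maps" "G \<in> equivariant_maps" "x = section_of F" "y = section_of G"
      by (metis carrierE)
    then show "?\<rho> (x \<oplus>\<^bsub>B\<^esub> y) = ?\<rho> x + ?\<rho> y"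
      by (simp add: section_add \<rho> equivariant_add)
  next
    fix c x assume "x \<in> carrier B"
    then obtain F where "F \<in> equivariant_maps" "x = section_of F" by (rule carrierE)
    then show "?\<rho> (scale B c x) = mat c ** ?\<rho> x"
      by (simp add: section_scale \<rho> equivariant_scale)
  qed
  moreover have "?\<rho> \<one>\<^bsub>B\<^esub> = mat 1" by (simp add: section_one \<rho> equivariant_const)
  moreover have "?\<rho> (x \<otimes>\<^bsub>B\<^esub> y) = ?\<rho> x ** ?\<rho> y" if x: "x \<in> carrier B" and y: "y \<in> carrier B" for x y
  proof -
    obtain F G where "F \<in> equivariant_maps" "G \<in> equivariant_maps" "x = section_of F" "y = section_of G"
      using x y by (metis carrierE)
    then show ?thesis by (simp add: section_mult \<rho> equivariant_mult)
  qed
  moreover have "?\<rho> (star B x) = mat_star (?\<rho> x)" if x: "x \<in> carrier B" for x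
  proof -
    obtain F where "F \<in> equivariant_maps" "x = section_of F" using x by (rule carrierE)
    then show ?thesis by (simp add: section_star \<rho> equivariant_star)
  qed
  ultimately have "star_representation B ?\<rho>" by (simp add: star_representation_def)
  moreover have "W = {0} \<or> W = UNIV"
    if W: "vec.subspace W" and inv: "\<forall>x\<in>carrier B. \<forall>v\<in>W. ?\<rho> x *v v \<in> W" for W
  proof (cases "W = {0}")
    case False
    then obtain v where v: "v \<in> W" "v \<noteq> 0" using vec.subspace_0[OF W] by blast
    have "w \<in> W" for w
    proof -
      obtain i where i: "v $ i \<noteq> 0" using v(2) by (auto simp: vec_eq_iff)
      \<comment> \<open>A matrix that maps \<open>v\<close> to \<open>w\<close>.\<close>
      define M :: "complex^'n^'n" where "M = (\<chi> k l. if l = i then w $ k / v $ i else 0)"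
      have "M *v v = w"
        using i by (simp add: vec_eq_iff M_def matrix_vector_mult_def if_distrib if_distribR sum.delta cong: if_cong)
      moreover obtain \<phi> where \<phi>: "\<phi> \<in> generic_matrices" "\<phi> z0 = M"
        using generic_matrices_onto[OF PE_gen[OF z0]] by blast
      moreover have m: "\<phi> \<in> equivariant_maps" by (rule equivariant_trace[OF generic_in_trace_algebra[OF \<phi>(1)]])
      ultimately show ?thesis using inv section_closed[OF m] v(1) \<rho>[OF m] by force
    qed
    then show ?thesis by blast
  qed simp
  ultimately show ?thesis by (simp add: irreducible_representation_def)
qed

subsection \<open>Uniqueness of the completely positive extension\<close>

text \<open>
  The section \<open>f 1\<close> of scalar matrices.
\<close>

definition scalar_section :: "(('d, 'n) quot_point \<Rightarrow> complex) \<Rightarrow> ('d, 'n) quot_point \<Rightarrow> ('d, 'n) bundle_point" where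
  "scalar_section f = section_of (\<lambda>z. mat (f (quot_map z)))"

abbreviation real_section :: "(('d, 'n) quot_point \<Rightarrow> real) \<Rightarrow> ('d, 'n) quot_point \<Rightarrow> ('d, 'n) bundle_point" where
  "real_section f \<equiv> scalar_section (\<lambda>x. complex_of_real (f x))"

lemma ucp_positive:
  assumes "unital_completely_positive B \<omega>" and "positive_matrix B m a"
  shows "(\<Sum>i<m. \<Sum>j<m. cinner (\<omega> (a i j) *v v j) (v i)) \<in> \<real>\<^sub>\<ge>\<^sub>0"
  using assms by (simp add: unital_completely_positive_def)

lemma ucp_positive1:
  assumes \<omega>: "unital_completely_positive B \<omega>" and x: "x \<in> carrier B"
  shows "cinner (\<omega> (star B x \<otimes>\<^bsub>B\<^esub> x) *v v) v \<in> \<real>\<^sub>\<ge>\<^sub>0"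
proof -
  interpret ring B by (rule section_ring)
  interpret cs: unital_cstar_algebra B by (rule section_cstar_algebra)
  have xx: "star B x \<otimes>\<^bsub>B\<^esub> x \<in> carrier B" using x cs.star_closed by blast
  have "positive_matrix B 1 (\<lambda>_ _. star B x \<otimes>\<^bsub>B\<^esub> x)"
    unfolding positive_matrix_def using x xx by (intro exI[of _ "\<lambda>_ _. x"]) (simp add: lessThan_Suc)
  from ucp_positive[OF \<omega> this, of "\<lambda>_. v"] show ?thesis by (simp add: lessThan_Suc)
qed

lemma ucp_positive2:
  assumes \<omega>: "unital_completely_positive B \<omega>" and x: "x \<in> carrier B" and y: "y \<in> carrier B"
  shows "cinner (\<omega> (star B x \<otimes>\<^bsub>B\<^esub> x) *v v) v + cinner (\<omega> (star B x \<otimes>\<^bsub>B\<^esub> y) *v w) v +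
    (cinner (\<omega> (star B y \<otimes>\<^bsub>B\<^esub> x) *v v) w + cinner (\<omega> (star B y \<otimes>\<^bsub>B\<^esub> y) *v w) w) \<in> \<real>\<^sub>\<ge>\<^sub>0"
proof -
  interpret ring B by (rule section_ring)
  interpret cs: unital_cstar_algebra B by (rule section_cstar_algebra)
  have z: "star B \<zero>\<^bsub>B\<^esub> = \<zero>\<^bsub>B\<^esub>"
    by (simp add: section_zero section_star equivariant_zero) (simp add: mat_star_def zero_vec_def)
  define t where "t i = (if i = (0::nat) then x else y)" for i
  have t: "t i \<in> carrier B" "star B (t i) \<in> carrier B" for i
    using x y cs.star_closed by (auto simp: t_def)
  define b where "b k i = (if k = (0::nat) then t i else \<zero>\<^bsub>B\<^esub>)" for k i
  have bc: "b k i \<in> carrier B" for k i using t by (simp add: b_def)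
  have "positive_matrix B 2 (\<lambda>i j. star B (t i) \<otimes>\<^bsub>B\<^esub> t j)"
    unfolding positive_matrix_def
  proof (intro exI[of _ b] conjI allI impI)
    fix i j
    have "(\<Oplus>\<^bsub>B\<^esub>k\<in>{..<2}. star B (b k i) \<otimes>\<^bsub>B\<^esub> b k j) = star B (t i) \<otimes>\<^bsub>B\<^esub> t j"
      using t by (simp add: b_def z numeral_2_eq_2 lessThan_Suc)
    then show "star B (t i) \<otimes>\<^bsub>B\<^esub> t j = (\<Oplus>\<^bsub>B\<^esub>k\<in>{..<2}. star B (b k i) \<otimes>\<^bsub>B\<^esub> b k j)" by simp
  qed (rule bc)
  from ucp_positive[OF \<omega> this, of "\<lambda>i. if i = 0 then v else w"]
  show ?thesis by (simp add: numeral_2_eq_2 lessThan_Suc t_def algebra_simps)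
qed

text \<open>The Cauchy-Schwarz inequality in the degenerate case.\<close>

lemma ucp_degenerate:
  assumes \<omega>: "unital_completely_positive B \<omega>" and x: "x \<in> carrier B" and y: "y \<in> carrier B"
    and zero: "\<omega> (star B x \<otimes>\<^bsub>B\<^esub> x) = 0"
  shows "\<omega> (star B x \<otimes>\<^bsub>B\<^esub> y) = 0"
proof -
  have "cinner (\<omega> (star B x \<otimes>\<^bsub>B\<^esub> y) *v w) v = 0" for v w
  proof (rule linear_nonneg_imp_zero)
    fix t
    show "cnj t * cinner (\<omega> (star B x \<otimes>\<^bsub>B\<^esub> y) *v w) v + t * cinner (\<omega> (star B y \<otimes>\<^bsub>B\<^esub> x) *v v) w +
        cinner (\<omega> (star B y \<otimes>\<^bsub>B\<^esub> y) *v w) w \<in> \<real>\<^sub>\<ge>\<^sub>0"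
      using ucp_positive2[OF \<omega> x y, of "t *s v" w]
      by (simp add: zero cinner_scale_left cinner_scale_right vec.scale vector_scalar_commute algebra_simps)
  qed
  then show ?thesis using cinner_eq_zero_iff by blast
qed

lemma ucp_linear:
  assumes "unital_completely_positive B \<omega>"
  shows "F \<in> equivariant_maps \<Longrightarrow> G \<in> equivariant_maps \<Longrightarrow>
      \<omega> (section_of (\<lambda>z. F z + G z)) = \<omega> (section_of F) + \<omega> (section_of G)"
    and "F \<in> equivariant_maps \<Longrightarrow> \<omega> (section_of (\<lambda>z. mat c ** F z)) = mat c ** \<omega> (section_of F)"
    and "\<omega> (section_of (\<lambda>_. mat 1)) = mat 1"
proof -
  have l: "linear_into_mat B \<omega>" and o: "\<omega> \<one>\<^bsub>B\<^esub> = mat 1"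
    using assms by (auto simp: unital_completely_positive_def)
  show "\<omega> (section_of (\<lambda>_. mat 1)) = mat 1" using o by (simp add: section_one)
  show "\<omega> (section_of (\<lambda>z. F z + G z)) = \<omega> (section_of F) + \<omega> (section_of G)"
    if "F \<in> equivariant_maps" "G \<in> equivariant_maps"
    using l that unfolding linear_into_mat_def section_add[OF that, symmetric]
    by (simp add: section_closed)
  show "\<omega> (section_of (\<lambda>z. mat c ** F z)) = mat c ** \<omega> (section_of F)" if "F \<in> equivariant_maps"
    using l that unfolding linear_into_mat_def section_scale[OF that, symmetric]
    by (simp add: section_closed)
qed

text \<open>
  The functional \<open>f \<mapsto> \<langle>\<omega>(f 1) v, v\<rangle> / \<parallel>v\<parallel>\<^sup>2\<close> on real functions; it is a state for \<open>v \<noteq> 0\<close>.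
\<close>

definition vector_functional ::
  "((('d, 'n) quot_point \<Rightarrow> ('d, 'n) bundle_point) \<Rightarrow> complex^'n^'n) \<Rightarrow> complex^'n \<Rightarrow>
   (('d, 'n) quot_point \<Rightarrow> real) \<Rightarrow> real" where
  "vector_functional \<omega> v f = Re (cinner (\<omega> (real_section f) *v v) v) / (norm v)\<^sup>2"

lemma ucp_scalar_add:
  assumes \<omega>: "unital_completely_positive B \<omega>" and f: "continuous_on E f" and g: "continuous_on E g"
  shows "\<omega> (scalar_section (\<lambda>x. f x + g x)) = \<omega> (scalar_section f) + \<omega> (scalar_section g)"
  using ucp_linear(1)[OF \<omega> equivariant_scalar[OF f] equivariant_scalar[OF g]]
  by (simp add: scalar_section_def mat_add)

lemma ucp_scalar_scale:
  assumes \<omega>: "unital_completely_positive B \<omega>" and f: "continuous_on E f"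
  shows "\<omega> (scalar_section (\<lambda>x. c * f x)) = mat c ** \<omega> (scalar_section f)"
  using ucp_linear(2)[OF \<omega> equivariant_scalar[OF f], of c]
  by (simp add: scalar_section_def mat_mult_mat)

lemma ucp_scalar_nonneg:
  assumes \<omega>: "unital_completely_positive B \<omega>" and f: "continuous_on E f" and nn: "\<And>x. x \<in> E \<Longrightarrow> 0 \<le> f x"
  shows "cinner (\<omega> (real_section f) *v v) v \<in> \<real>\<^sub>\<ge>\<^sub>0"
proof -
  have c: "continuous_on E (\<lambda>x. complex_of_real (sqrt (f x)))" using f by (intro continuous_intros)
  note m = equivariant_scalar[OF c]
  have cf: "continuous_on E (\<lambda>x. complex_of_real (f x))" using f by (intro continuous_intros)
  have "star B (real_section (\<lambda>x. sqrt (f x))) \<otimes>\<^bsub>B\<^esub> real_section (\<lambda>x. sqrt (f x))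
      = section_of (\<lambda>z. mat (complex_of_real (sqrt (f (quot_map z))) * complex_of_real (sqrt (f (quot_map z)))))"
    using m equivariant_star[OF m] by (simp add: scalar_section_def section_star section_mult mat_mult_mat)
  also have "\<dots> = real_section f"
  proof -
    have "continuous_on E (\<lambda>x. complex_of_real (sqrt (f x)) * complex_of_real (sqrt (f x)))"
      using f by (intro continuous_intros)
    then show ?thesis
      unfolding scalar_section_def
      by (subst induced_section_eq_iff[OF equivariant_scalar equivariant_scalar[OF cf]])
        (auto simp: nn PE_E simp flip: of_real_mult)
  qed
  finally have "star B (real_section (\<lambda>x. sqrt (f x))) \<otimes>\<^bsub>B\<^esub> real_section (\<lambda>x. sqrt (f x))
      = real_section f" .
  then show ?thesis
    using ucp_positive1[OF \<omega> section_closed[OF m], of v] by (simp add: scalar_section_def)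
qed

text \<open>
  This reduces to nonnegative functions by writing \<open>f\<close> as \<open>max f 0 - max (- f) 0\<close>.
\<close>

lemma ucp_scalar_real:
  assumes \<omega>: "unital_completely_positive B \<omega>" and f: "continuous_on E f"
  shows "Im (cinner (\<omega> (real_section f) *v v) v) = 0"
proof -
  let ?c = "\<lambda>f. cinner (\<omega> (real_section f) *v v) v"
  have n: "continuous_on E (\<lambda>x. max (- f x) 0)" "continuous_on E (\<lambda>x. max (f x) 0)"
    using f by (auto intro!: continuous_intros)
  have "?c (\<lambda>x. f x + max (- f x) 0) = ?c f + ?c (\<lambda>x. max (- f x) 0)"
    using ucp_scalar_add[OF \<omega>, of "\<lambda>x. complex_of_real (f x)" "\<lambda>x. complex_of_real (max (- f x) 0)"] f n
    by (simp add: matrix_vector_mult_add_rdistrib cinner_add_left continuous_on_of_real)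
  moreover have "f x + max (- f x) 0 = max (f x) 0" for x by auto
  ultimately have "?c (\<lambda>x. max (f x) 0) = ?c f + ?c (\<lambda>x. max (- f x) 0)" by (simp only:)
  then have "Im (?c (\<lambda>x. max (f x) 0)) = Im (?c f) + Im (?c (\<lambda>x. max (- f x) 0))"
    by (simp only: plus_complex.simps)
  moreover have "Im (?c (\<lambda>x. max (f x) 0)) = 0"
    using ucp_scalar_nonneg[OF \<omega> n(2), of v] by (simp add: complex_nonneg_Reals_iff)
  moreover have "Im (?c (\<lambda>x. max (- f x) 0)) = 0"
    using ucp_scalar_nonneg[OF \<omega> n(1), of v] by (simp add: complex_nonneg_Reals_iff)
  ultimately show ?thesis by linarith
qed

lemma vector_functional_state:
  assumes \<omega>: "unital_completely_positive B \<omega>" and v: "v \<noteq> 0"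
  shows "state_on E (vector_functional \<omega> v)"
  unfolding state_on_def
proof (intro conjI allI impI)
  fix f g :: "('d, 'n) quot_point \<Rightarrow> real"
  assume f: "continuous_on E f" and g: "continuous_on E g"
  show "vector_functional \<omega> v (\<lambda>x. f x + g x) = vector_functional \<omega> v f + vector_functional \<omega> v g"
    using ucp_scalar_add[OF \<omega>, of "\<lambda>x. complex_of_real (f x)" "\<lambda>x. complex_of_real (g x)"] f g
    by (simp add: vector_functional_def matrix_vector_mult_add_rdistrib cinner_add_left continuous_on_of_real
        add_divide_distrib)
next
  fix c and f :: "('d, 'n) quot_point \<Rightarrow> real" assume f: "continuous_on E f"
  show "vector_functional \<omega> v (\<lambda>x. c * f x) = c * vector_functional \<omega> v f"
    using ucp_scalar_scale[OF \<omega>, of "\<lambda>x. complex_of_real (f x)" "of_real c"] f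
    by (simp add: vector_functional_def mat_scale_vec cinner_scale_left continuous_on_of_real)
next
  fix f :: "('d, 'n) quot_point \<Rightarrow> real" assume f: "continuous_on E f" "\<forall>x\<in>E. 0 \<le> f x"
  then show "0 \<le> vector_functional \<omega> v f"
    using ucp_scalar_nonneg[OF \<omega> f(1), of v] by (simp add: vector_functional_def complex_nonneg_Reals_iff)
next
  show "vector_functional \<omega> v (\<lambda>_. 1) = 1"
    using v ucp_linear(3)[OF \<omega>] by (simp add: vector_functional_def scalar_section_def cinner_self)
qed

lemma scalar_section_in_tracial:
  assumes f: "f \<in> invariant_function_algebra (quot_map ` P)"
  shows "scalar_section f \<in> A"
proof -
  have c: "continuous_on E f"
    using invariant_function_algebra_continuous[OF f] E_subset continuous_on_subset by blast
  show ?thesis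
    unfolding scalar_section_def mem_tracial_iff[OF equivariant_scalar[OF c]]
  proof (intro allI impI)
    fix e :: real assume e: "0 < e"
    obtain p where p: "p \<in> invariants" "\<forall>x\<in>quot_map ` P. cmod (f x - x p) < e"
      using f e unfolding invariant_function_algebra_def by blast
    have "opnorm (mat (f (quot_map z)) - mat (p z) :: complex^'n^'n) \<le> e" if "z \<in> PE" for z
      using p(2) PE_P[OF that] by (simp add: opnorm_mat quot_map_apply[OF p(1)] less_imp_le flip: mat_diff)
    then show "\<exists>\<phi>\<in>trace_algebra. \<forall>z\<in>PE. opnorm (mat (f (quot_map z)) - \<phi> z) \<le> e"
      by (intro bexI[OF _ invariant_in_trace_algebra[OF p(1)]]) blast
  qed
qed

lemma ucp_extension_unique:
  assumes X: "compact (quot_map ` P)"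
    and z0: "z0 \<in> PE"
    and u: "quot_map z0 \<in> choquet_boundary (quot_map ` P) (invariant_function_algebra (quot_map ` P))"
    and \<omega>: "unital_completely_positive B \<omega>"
    and agree: "\<And>a. a \<in> A \<Longrightarrow> \<omega> a = eval_rep z0 (quot_map z0) a"
    and b: "b \<in> carrier B"
  shows "\<omega> b = eval_rep z0 (quot_map z0) b"
proof -
  let ?X = "quot_map ` P" and ?u = "quot_map z0" and ?FA = "invariant_function_algebra (quot_map ` P)"
  obtain j :: "('d, 'n) quot_point \<Rightarrow> nat \<Rightarrow> complex"
    where j: "continuous_on UNIV j" "inj_on j (range quot_map)" using quot_embedding by blast
  have jX: "continuous_on ?X j" "inj_on j ?X" using j by (auto intro: continuous_on_subset inj_on_subset)
  have pn: "perfectly_normal_on ?X" by (rule perfectly_normal_of_embedding[OF X jX])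
  have cE: "continuous_on E f" if "continuous_on ?X f" for f :: "('d, 'n) quot_point \<Rightarrow> 'b::topological_space"
    using that E_subset continuous_on_subset by blast
  have at_u: "vector_functional \<omega> v h = h ?u" if v: "v \<noteq> 0" and h: "continuous_on ?X h" for v h
  proof (rule state_at_choquet_point[OF X pn u invariant_function_algebra_continuous _ _ h])
    have st: "state_on E (vector_functional \<omega> v)" by (rule vector_functional_state[OF \<omega> v])
    then show "state_on ?X (vector_functional \<omega> v)" by (rule state_on_superset[OF _ E_subset])
    fix f assume f: "f \<in> ?FA"
    have fc: "continuous_on E f" by (rule cE[OF invariant_function_algebra_continuous[OF f]])
    have rc: "continuous_on E (\<lambda>x. complex_of_real (Re (f x)))" "continuous_on E (\<lambda>x. complex_of_real (Im (f x)))"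
      using fc by (auto intro!: continuous_intros)
    have "\<omega> (scalar_section f) = mat (f ?u)"
      using agree[OF scalar_section_in_tracial[OF f]] eval_rep_induced[OF equivariant_scalar[OF fc] z0]
      by (simp add: scalar_section_def)
    moreover have "\<omega> (scalar_section f) = \<omega> (real_section (\<lambda>x. Re (f x))) +
        mat \<i> ** \<omega> (real_section (\<lambda>x. Im (f x)))"
    proof -
      have "f = (\<lambda>x. complex_of_real (Re (f x)) + \<i> * complex_of_real (Im (f x)))"
        by (rule ext) (rule complex_eq)
      then have "\<omega> (scalar_section f) = \<omega> (scalar_section (\<lambda>x. complex_of_real (Re (f x)) + \<i> * complex_of_real (Im (f x))))"
        by (rule arg_cong)
      then show ?thesis
        using ucp_scalar_add[OF \<omega> rc(1) continuous_on_mult_left[OF rc(2), of \<i>]] ucp_scalar_scale[OF \<omega> rc(2), of \<i>]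
        by simp
    qed
    ultimately have "mat (f ?u) = \<omega> (real_section (\<lambda>x. Re (f x))) +
        mat \<i> ** \<omega> (real_section (\<lambda>x. Im (f x)))" by simp
    then have "cinner (mat (f ?u) *v v) v = cinner ((\<omega> (real_section (\<lambda>x. Re (f x))) +
        mat \<i> ** \<omega> (real_section (\<lambda>x. Im (f x)))) *v v) v" by (rule arg_cong)
    moreover have "cinner (mat (f ?u) *v v) v = f ?u * of_real ((norm v)\<^sup>2)"
      using mat_scale_vec[of "f ?u" "mat 1" v] by (simp add: cinner_scale_left cinner_self)
    ultimately have "f ?u * of_real ((norm v)\<^sup>2) =
        cinner (\<omega> (real_section (\<lambda>x. Re (f x))) *v v) v +
        \<i> * cinner (\<omega> (real_section (\<lambda>x. Im (f x))) *v v) v"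
      by (simp add: matrix_vector_mult_add_rdistrib mat_scale_vec cinner_add_left cinner_scale_left)
    then have eq: "Re (f ?u) * (norm v)\<^sup>2 = Re (cinner (\<omega> (real_section (\<lambda>x. Re (f x))) *v v) v)"
      "Im (f ?u) * (norm v)\<^sup>2 = Re (cinner (\<omega> (real_section (\<lambda>x. Im (f x))) *v v) v)"
      using ucp_scalar_real[OF \<omega>, of "\<lambda>x. Re (f x)" v] ucp_scalar_real[OF \<omega>, of "\<lambda>x. Im (f x)" v] fc
      by (simp_all add: complex_eq_iff continuous_on_Re continuous_on_Im)
    show "vector_functional \<omega> v (\<lambda>x. Re (f x)) = Re (f ?u) \<and> vector_functional \<omega> v (\<lambda>x. Im (f x)) = Im (f ?u)"
      unfolding vector_functional_def eq[symmetric] using v by simp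
  qed
  \<comment> \<open>Functions on \<open>E\<close> need not extend to \<open>X\<close>: \<open>f\<close> is compared with \<open>e + M h\<close>, where \<open>h\<close> is continuous on \<open>X\<close> and vanishes only at \<open>u\<close>.\<close>
  have vanish: "\<omega> (real_section f) = 0" if f: "continuous_on E f"
    and nn: "\<And>x. x \<in> E \<Longrightarrow> 0 \<le> f x" and fu: "f ?u = 0" for f :: "('d, 'n) quot_point \<Rightarrow> real"
  proof -
    let ?T = "\<omega> (real_section f)"
    have zero: "vector_functional \<omega> v f = 0" if v: "v \<noteq> 0" for v
    proof (rule antisym)
      note st = vector_functional_state[OF \<omega> v]
      show "0 \<le> vector_functional \<omega> v f" using state_onD(3)[OF st f nn] .
      show "vector_functional \<omega> v f \<le> 0"
      proof (rule field_le_epsilon)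
        fix e :: real assume e: "0 < e"
        define h where "h x = dist (j x) (j ?u)" for x
        have hX: "continuous_on ?X h" unfolding h_def by (rule continuous_on_dist[OF jX(1) continuous_on_const])
        note hE = cE[OF hX]
        have hpos: "0 < h x" if "x \<in> E" "x \<noteq> ?u" for x
          using inj_onD[OF j(2), of x ?u] that E_subset by (auto simp: h_def)
        have "\<exists>M\<ge>0. \<forall>x\<in>E. f x \<le> e + M * h x"
        proof -
          define C where "C = {x \<in> E. e \<le> f x}"
          have "closedin (top_of_set E) (E \<inter> f -` {e..})"
            by (rule continuous_closedin_preimage[OF f closed_atLeast])
          moreover have "E \<inter> f -` {e..} = C" by (auto simp: C_def)
          ultimately have Cc: "compact C" using closedin_compact[OF E_compact] by simp
          have CE: "C \<subseteq> E" by (auto simp: C_def)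
          show ?thesis
          proof (cases "C = {}")
            case True
            then show ?thesis by (intro exI[of _ 0]) (auto simp: C_def not_le intro: less_imp_le)
          next
            case False
            obtain x0 where x0: "x0 \<in> C" "\<And>x. x \<in> C \<Longrightarrow> h x0 \<le> h x"
              using continuous_attains_inf[OF Cc False continuous_on_subset[OF hE CE]] by blast
            obtain x1 where x1: "x1 \<in> C" "\<And>x. x \<in> C \<Longrightarrow> f x \<le> f x1"
              using continuous_attains_sup[OF Cc False continuous_on_subset[OF f CE]] by blast
            have "x0 \<noteq> ?u" using x0(1) fu e by (auto simp: C_def)
            then have d: "0 < h x0" using hpos x0(1) CE by blast
            have f1: "0 \<le> f x1" using nn x1(1) CE by blast
            have "f x \<le> e + f x1 / h x0 * h x" if x: "x \<in> E" for x
            proof (cases "x \<in> C")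
              case True
              have "f x1 / h x0 * h x0 \<le> f x1 / h x0 * h x"
                using x0(2)[OF True] f1 d by (intro mult_left_mono) auto
              then show ?thesis using x1(2)[OF True] d e by simp
            next
              case False
              have "0 \<le> f x1 / h x0 * h x" using f1 d by (simp add: h_def)
              then show ?thesis using False x by (auto simp: C_def)
            qed
            then show ?thesis using f1 d by (intro exI[of _ "f x1 / h x0"]) auto
          qed
        qed
        then obtain M where M: "0 \<le> M" "\<And>x. x \<in> E \<Longrightarrow> f x \<le> e + M * h x" by blast
        have cX: "continuous_on ?X (\<lambda>x. e + M * h x)" using hX by (intro continuous_intros)
        have "vector_functional \<omega> v f \<le> vector_functional \<omega> v (\<lambda>x. e + M * h x)"
          using M(2) by (intro state_on_mono[OF st f cE[OF cX]])
        also have "\<dots> = e" using at_u[OF v cX] by (simp add: h_def)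
        finally show "vector_functional \<omega> v f \<le> 0 + e" by simp
      qed
    qed
    \<comment> \<open>The quadratic form of \<open>?T\<close> vanishes; polarisation gives \<open>?T = 0\<close>.\<close>
    have quad: "cinner (?T *v v) v = 0" for v
    proof (cases "v = 0")
      case False
      then have "Re (cinner (?T *v v) v) = 0" using zero[OF False] by (simp add: vector_functional_def)
      then show ?thesis using ucp_scalar_real[OF \<omega> f] by (simp add: complex_eq_iff)
    qed simp
    have "cinner (?T *v w) v = 0" for v w
    proof (rule linear_nonneg_imp_zero)
      fix t
      have "cinner (?T *v (w + t *s v)) (w + t *s v) = cinner (?T *v w) w + cinner (?T *v (t *s v)) (t *s v) +
          (cnj t * cinner (?T *v w) v + t * cinner (?T *v v) w)"
        by (simp add: matrix_vector_right_distrib vector_scalar_commute cinner_add_left cinner_add_right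
            cinner_scale_left cinner_scale_right algebra_simps)
      then show "cnj t * cinner (?T *v w) v + t * cinner (?T *v v) w + 0 \<in> \<real>\<^sub>\<ge>\<^sub>0"
        using quad by simp
    qed
    then show ?thesis using cinner_eq_zero_iff by blast
  qed
  \<comment> \<open>A section vanishing at \<open>u\<close> is the product of \<open>\<parallel>F\<parallel>\<^sup>1\<^sup>/\<^sup>2\<close> and \<open>root_part F\<close>.\<close>
  have kill: "\<omega> (section_of F) = 0" if F: "F \<in> equivariant_maps" and F0: "F z0 = 0" for F
  proof -
    have "\<exists>f. continuous_on E f \<and> (\<forall>z\<in>PE. f (quot_map z) = opnorm (F z))"
      using equivariant_mapsD(1)[OF F]
      by (intro descend_invariant_function continuous_on_opnorm) (simp_all add: equivariant_mapsD(2)[OF F] opnorm_conj)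
    then obtain f where f: "continuous_on E f" and fF: "\<And>z. z \<in> PE \<Longrightarrow> f (quot_map z) = opnorm (F z)" by blast
    have f0: "0 \<le> f x" if x: "x \<in> E" for x
    proof -
      obtain z where "z \<in> PE" "quot_map z = x" using x by (rule E_obtain)
      then show ?thesis using fF opnorm_nonneg by metis
    qed
    let ?g = "\<lambda>x. complex_of_real (sqrt (f x))"
    have gc: "continuous_on E ?g" using f by (intro continuous_intros)
    have fc: "continuous_on E (\<lambda>x. complex_of_real (f x))" using f by (intro continuous_intros)
    note g = equivariant_scalar[OF gc]
    have R: "(\<lambda>z. root_part (F z)) \<in> equivariant_maps"
    proof (rule equivariant_mapsI)
      show "continuous_on PE (\<lambda>z. root_part (F z))"
        by (rule continuous_on_compose2[OF continuous_on_root_part equivariant_mapsD(1)[OF F]]) simp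
    qed (simp add: equivariant_mapsD(2)[OF F] root_part_conj)
    have gstar: "star B (scalar_section ?g) = scalar_section ?g"
      using g by (simp add: scalar_section_def section_star)
    have "star B (scalar_section ?g) \<otimes>\<^bsub>B\<^esub> scalar_section ?g = real_section f"
      unfolding gstar unfolding scalar_section_def section_mult[OF g g]
      by (subst induced_section_eq_iff[OF equivariant_mult[OF g g] equivariant_scalar[OF fc]])
        (auto simp: mat_mult_mat f0 PE_E simp flip: of_real_mult)
    then have z: "\<omega> (star B (scalar_section ?g) \<otimes>\<^bsub>B\<^esub> scalar_section ?g) = 0"
      using vanish[OF f f0] fF[OF z0] F0 by simp
    have "star B (scalar_section ?g) \<otimes>\<^bsub>B\<^esub> section_of (\<lambda>z. root_part (F z)) = section_of F"
      unfolding gstar unfolding scalar_section_def section_mult[OF g R]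
      by (subst induced_section_eq_iff[OF equivariant_mult[OF g R] F]) (auto simp: fF root_part_mult)
    then show ?thesis
      using ucp_degenerate[OF \<omega> _ section_closed[OF R] z] section_closed[OF g] by (simp add: scalar_section_def)
  qed
  obtain F where F: "F \<in> equivariant_maps" "b = section_of F" using b by (rule carrierE)
  obtain \<phi> where \<phi>: "\<phi> \<in> generic_matrices" "\<phi> z0 = F z0" using generic_matrices_onto[OF PE_gen[OF z0]] by blast
  note tr = generic_in_trace_algebra[OF \<phi>(1)]
  note m = equivariant_trace[OF tr]
  have "\<omega> (section_of (\<lambda>z. (F z - \<phi> z) + \<phi> z)) = \<omega> (section_of (\<lambda>z. F z - \<phi> z)) + \<omega> (section_of \<phi>)"
    by (rule ucp_linear(1)[OF \<omega> equivariant_diff[OF F(1) m] m])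
  also have "\<omega> (section_of (\<lambda>z. F z - \<phi> z)) = 0"
    by (rule kill[OF equivariant_diff[OF F(1) m]]) (simp add: \<phi>(2))
  also have "\<omega> (section_of \<phi>) = \<phi> z0"
    using agree[OF trace_in_tracial[OF tr]] eval_rep_induced[OF m z0] by simp
  finally show ?thesis using eval_rep_induced[OF F(1) z0] F(2) \<phi>(2) by simp
qed

end

theorem theorem1p6:
  fixes D :: "('d::finite, 'n::finite) quot_point set"
    and P :: "(complex^'n^'n^'d) set"
    and u :: "('d::finite, 'n::finite) quot_point"
  assumes "CARD('d) \<ge> 2" and "CARD('n) \<ge> 2"
    and "quot_domain D"
    and "compact (domain_closure D)" and "domain_closure D \<subseteq> gen_quot"
    and "bundle_reduction (domain_closure D) P"
    and "u \<in> domain_choquet D"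
  shows "\<forall>z\<in>P. quot_map z = u \<longrightarrow>
    boundary_representation (section_algebra P (domain_shilov D))
      (tracial_function_algebra P (domain_shilov D)) (eval_rep z u)"
proof (intro ballI impI)
  fix z assume z: "z \<in> P" "quot_map z = u"
  let ?X = "quot_map ` P" and ?E = "domain_shilov D"
  have X: "domain_closure D = ?X" using assms(6) by (simp add: bundle_reduction_def)
  have Xc: "compact ?X" using assms(4) X by simp
  obtain j :: "('d, 'n) quot_point \<Rightarrow> nat \<Rightarrow> complex"
    where j: "continuous_on UNIV j" "inj_on j (range quot_map)" using quot_embedding by blast
  have pn: "perfectly_normal_on ?X"
    using j by (intro perfectly_normal_of_embedding[OF Xc, of j]) (auto intro: continuous_on_subset inj_on_subset)
  have ch: "u \<in> choquet_boundary ?X (invariant_function_algebra ?X)"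
    using assms(7) by (simp add: domain_choquet_def X)
  then have uE: "u \<in> ?E"
    using quot_choquet_subset_shilov[OF Xc pn] by (auto simp: domain_shilov_def X)
  have cl: "closedin (top_of_set ?X) ?E"
    unfolding domain_shilov_def X by (rule closedin_shilov_boundary)
  interpret bundle_sections P ?E
    using assms(6) X cl uE by unfold_locales auto
  have zE: "z \<in> PE" using z uE by (simp add: PE_def)
  show "boundary_representation (section_algebra P ?E) (tracial_function_algebra P ?E) (eval_rep z u)"
    unfolding boundary_representation_def
    using section_cstar_algebra tracial_closed_subalgebra tracial_generates eval_irreducible[OF zE]
      ucp_extension_unique[OF Xc zE] ch z(2) by blast
qed

end
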